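(* Let $n>1$ and let $\mathcal{G}\subseteq\mathcal{M}_n(\mathbb{C})$ be an irreducible compact group of matrices. Then the following are equivalent. (1) All ring commutators $AB-BA$, with $A,B\in\mathcal{G}$, have real spectra. (2) The number $n$ is odd and, up to simultaneous similarity, $\mathcal{G}=\mathcal{C}_n\mathcal{D}$ for some nonscalar $\mathcal{C}_n$-stable subgroup $\mathcal{D}$ of $\mathcal{J}_n$ (that is, there are an invertible $X\in\mathcal{M}_n(\mathbb{C})$ and such a $\mathcal{D}$ with $X^{-1}\mathcal{G}X=\{CD: C\in\mathcal{C}_n, D\in\mathcal{D}\}$).
   Context: $\mathcal{M}_n(\mathbb{C})$ is the algebra of $n\times n$ complex matrices. A group of matrices means a group of invertible matrices under multiplication (with identity $I$); compact is with respect to the usual topology. Irreducible means having no common invariant subspace of $\mathbb{C}^n$ other than $\{0\}$ and $\mathbb{C}^n$. Real spectrum means all eigenvalues are real. $C_n\in\mathcal{M}_n(\mathbb{C})$ is the cycle permutation matrix with $C_ne_i=e_{i+1}$ for $1\le i<n$ and $C_ne_n=e_1$ (where $(e_i)$ is the standard basis), and $\mathcal{C}_n=\langle C_n\rangle$ is the cyclic group of order $n$ it generates. $\mathcal{D}_n(\pm1)$ is the group of diagonal $n\times n$ matrices with diagonal entries in $\{1,-1\}$. For $D\in\mathcal{D}_n(\pm 1)$ and a permutation matrix $G$ of order $m$ put $D^G=G^{-1}DG$ and $\operatorname{avg}_G(D)=D\,D^{G}D^{G^2}\cdots D^{G^{m-1}}$. For odd $n>1$, $$\mathcal{J}_n=\{J\in\mathcal{D}_n(\pm1):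 \operatorname{avg}_G(J)=\det(J)I\text{ for all }G\in\mathcal{C}_n\setminus\{I\}\}.$$ A subgroup $\mathcal{D}$ of $\mathcal{D}_n(\pm1)$ is $\mathcal{C}_n$-stable if $D^G\in\mathcal{D}$ for all $D\in\mathcal{D}$, $G\in\mathcal{C}_n$; it is nonscalar if it contains a matrix that is not a scalar multiple of $I$. *)

theory Defs
  imports
    "HOL-Analysis.Function_Topology"
    "HOL-Algebra.Generated_Groups"
    "HOL-Algebra.Multiplicative_Group"
    "Jordan_Normal_Form.VS_Connect"
    "Jordan_Normal_Form.Spectral_Radius"
begin

definition GL :: "nat \<Rightarrow> complex mat monoid" where
  "GL n = units_of (ring_mat TYPE(complex) n ())"

text \<open>The type of matrices carries no topology of its own; the usual one on the
  \<open>n \<times> n\<close> matrices is pulled back from the product topology along the entries.\<close>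

definition mat_topology :: "nat \<Rightarrow> complex mat topology" where
  "mat_topology n = pullback_topology (carrier_mat n n)
     (\<lambda>A. restrict (\<lambda>ij. A $$ ij) ({..<n} \<times> {..<n}))
     (product_topology (\<lambda>_. euclidean) ({..<n} \<times> {..<n}))"

definition irreducible_mats :: "nat \<Rightarrow> complex mat set \<Rightarrow> bool" where
  "irreducible_mats n S \<longleftrightarrow>
     (\<forall>W. VectorSpace.subspace class_ring W (module_vec TYPE(complex) n) \<and>
          (\<forall>A\<in>S. \<forall>v\<in>W. A *\<^sub>v v \<in> W)
        \<longrightarrow> W = {0\<^sub>v n} \<or> W = carrier_vec n)"

text \<open>Indices start at \<open>0\<close>: \<open>cycle_mat n\<close> sends \<open>e\<^sub>j\<close> to \<open>e\<^sub>j\<^sub>+\<^sub>1\<close>, indices modulo \<open>n\<close>.\<close>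

definition cycle_mat :: "nat \<Rightarrow> complex mat" where
  "cycle_mat n = mat n n (\<lambda>(i, j). if i = (j + 1) mod n then 1 else 0)"

definition cycle_group :: "nat \<Rightarrow> complex mat set" where
  "cycle_group n = generate (GL n) {cycle_mat n}"

definition sign_diag :: "nat \<Rightarrow> complex mat set" where
  "sign_diag n = {D \<in> carrier_mat n n. diagonal_mat D \<and> (\<forall>i<n. D $$ (i, i) \<in> {1, -1})}"

definition conj_by :: "nat \<Rightarrow> complex mat \<Rightarrow> complex mat \<Rightarrow> complex mat" where
  "conj_by n G D = inv\<^bsub>GL n\<^esub> G * D * G"

definition avg :: "nat \<Rightarrow> complex mat \<Rightarrow> complex mat \<Rightarrow> complex mat" where
  "avg n G D =
     foldr (*) (map (\<lambda>k. conj_by n (G ^\<^sub>m k) D) [0..<group.ord (GL n) G]) (1\<^sub>m n)"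

definition J_set :: "nat \<Rightarrow> complex mat set" where
  "J_set n = {J \<in> sign_diag n. \<forall>G \<in> cycle_group n - {1\<^sub>m n}. avg n G J = det J \<cdot>\<^sub>m 1\<^sub>m n}"

definition cycle_stable :: "nat \<Rightarrow> complex mat set \<Rightarrow> bool" where
  "cycle_stable n \<D> \<longleftrightarrow> (\<forall>D\<in>\<D>. \<forall>G\<in>cycle_group n. conj_by n G D \<in> \<D>)"

definition nonscalar :: "nat \<Rightarrow> complex mat set \<Rightarrow> bool" where
  "nonscalar n \<D> \<longleftrightarrow> (\<exists>D\<in>\<D>. \<forall>c. D \<noteq> c \<cdot>\<^sub>m 1\<^sub>m n)"

lemma group_GL: "group (GL n)"
proof -
  interpret ring "ring_mat TYPE(complex) n ()" by (rule ring_mat)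
  show ?thesis unfolding GL_def by (rule units_group)
qed

lemma GL_simps [simp]:
  "carrier (GL n) = {A \<in> carrier_mat n n. det A \<noteq> 0}"
  "A \<otimes>\<^bsub>GL n\<^esub> B = A * B"
  "\<one>\<^bsub>GL n\<^esub> = 1\<^sub>m n"
proof -
  have "Units (ring_mat TYPE(complex) n ()) \<subseteq> carrier_mat n n"
    by (auto simp: Units_def ring_mat_def)
  then show "carrier (GL n) = {A \<in> carrier_mat n n. det A \<noteq> 0}"
    by (auto simp: GL_def units_of_def intro: det_non_zero_imp_unit
        dest: unit_imp_det_non_zero)
qed (simp_all add: GL_def units_of_def ring_mat_simps)

lemma topspace_mat_topology [simp]: "topspace (mat_topology n) = carrier_mat n n"
  by (auto simp: mat_topology_def topspace_pullback_topology)

lemma compactin_mat_topology: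
  "compactin (mat_topology n) S \<longleftrightarrow>
     S \<subseteq> carrier_mat n n \<and>
     compactin (product_topology (\<lambda>_. euclidean) ({..<n} \<times> {..<n}))
       ((\<lambda>A. restrict (\<lambda>ij. A $$ ij) ({..<n} \<times> {..<n})) ` S)"
  (is "?L \<longleftrightarrow> _ \<and> compactin ?T (?f ` S)")
proof
  assume L: ?L
  have "continuous_map (mat_topology n) ?T ?f"
    unfolding mat_topology_def
    using continuous_map_pullback[OF continuous_map_id] by (simp add: comp_def id_def)
  with L show "S \<subseteq> carrier_mat n n \<and> compactin ?T (?f ` S)"
    using compactin_subset_topspace[OF L] by (simp add: image_compactin)
next
  assume R: "S \<subseteq> carrier_mat n n \<and> compactin ?T (?f ` S)"
  show ?L
    unfolding compactin_def
  proof (intro conjI allI impI)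
    show "S \<subseteq> topspace (mat_topology n)" using R by simp
    fix \<U> assume U: "Ball \<U> (openin (mat_topology n)) \<and> S \<subseteq> \<Union>\<U>"
    then have "\<forall>U\<in>\<U>. \<exists>V. openin ?T V \<and> U = ?f -` V \<inter> carrier_mat n n"
      by (auto simp: mat_topology_def openin_pullback_topology)
    then obtain V where V: "\<And>U. U \<in> \<U> \<Longrightarrow> openin ?T (V U)"
      "\<And>U. U \<in> \<U> \<Longrightarrow> U = ?f -` V U \<inter> carrier_mat n n"
      by metis
    have "?f ` S \<subseteq> \<Union>(V ` \<U>)" using U V(2) by blast
    then obtain \<F> where F: "finite \<F>" "\<F> \<subseteq> V ` \<U>" "?f ` S \<subseteq> \<Union>\<F>"
      using compactinD[of ?T "?f ` S" "V ` \<U>"] R V(1) by blast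
    then obtain \<F>' where F': "\<F>' \<subseteq> \<U>" "finite \<F>'" "\<F> = V ` \<F>'"
      by (meson finite_subset_image)
    have "S \<subseteq> \<Union>\<F>'"
    proof
      fix x assume x: "x \<in> S"
      then obtain U where "U \<in> \<F>'" "?f x \<in> V U" using F F' by blast
      then show "x \<in> \<Union>\<F>'" using V(2)[of U] F'(1) R x by blast
    qed
    with F' show "\<exists>\<F>. finite \<F> \<and> \<F> \<subseteq> \<U> \<and> S \<subseteq> \<Union>\<F>" by blast
  qed
qed

lemma cycle_mat_unit_vec:
  assumes "j < n"
  shows "cycle_mat n *\<^sub>v unit_vec n j = unit_vec n ((j + 1) mod n)"
  using assms by (intro eq_vecI) (auto simp: cycle_mat_def)

lemma cycle_mat_power:
  "cycle_mat n ^\<^sub>m k = mat n n (\<lambda>(i, j). if i = (j + k) mod n then 1 else 0)"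
proof (induction k)
  case 0
  then show ?case by (intro eq_matI) (auto simp: cycle_mat_def)
next
  case (Suc k)
  have "(\<Sum>l<n. (if i = (l + k) mod n then 1 else 0) * (if l = (j + 1) mod n then 1 else 0 :: complex))
     = (if i = (j + Suc k) mod n then 1 else 0)" if "i < n" "j < n" for i j
  proof -
    have "(\<Sum>l<n. (if i = (l + k) mod n then 1 else 0) * (if l = (j + 1) mod n then 1 else 0 :: complex))
      = (\<Sum>l<n. if (j + 1) mod n = l then (if i = (l + k) mod n then 1 else 0) else 0)"
      by (intro sum.cong) auto
    also have "\<dots> = (if i = ((j + 1) mod n + k) mod n then 1 else 0)"
      using that by simp
    also have "((j + 1) mod n + k) mod n = (j + Suc k) mod n"
      by (simp add: mod_add_left_eq)
    finally show ?thesis .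
  qed
  then show ?case
    unfolding pow_mat.simps Suc unfolding cycle_mat_def
    by (intro eq_matI) (simp_all add: scalar_prod_def lessThan_atLeast0)
qed

lemma cycle_mat_in_GL:
  assumes "n > 0"
  shows "cycle_mat n \<in> carrier (GL n)"
proof -
  have C: "cycle_mat n \<in> carrier_mat n n" by (simp add: cycle_mat_def)
  have "cycle_mat n ^\<^sub>m (n - 1) * cycle_mat n = cycle_mat n ^\<^sub>m n"
    using assms by (cases n) simp_all
  also have "\<dots> = 1\<^sub>m n" unfolding cycle_mat_power by (intro eq_matI) auto
  finally have "det (cycle_mat n ^\<^sub>m (n - 1)) * det (cycle_mat n) = 1"
    using C by (metis det_mult det_one pow_carrier_mat)
  then show ?thesis using C by auto
qed

lemma ord_cycle_mat:
  assumes "n > 0"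
  shows "group.ord (GL n) (cycle_mat n) = n"
proof -
  interpret group "GL n" by (rule group_GL)
  have C: "cycle_mat n \<in> carrier_mat n n" by (simp add: cycle_mat_def)
  have pow: "cycle_mat n [^]\<^bsub>GL n\<^esub> k = cycle_mat n ^\<^sub>m k" for k :: nat
    using C by (induction k) simp_all
  have "cycle_mat n ^\<^sub>m k = 1\<^sub>m n \<longleftrightarrow> n dvd k" for k
  proof
    assume "cycle_mat n ^\<^sub>m k = 1\<^sub>m n"
    then have "(cycle_mat n ^\<^sub>m k) $$ (0, 0) = 1\<^sub>m n $$ (0, 0)" by simp
    then show "n dvd k"
      using assms by (simp add: cycle_mat_power split: if_splits) (simp add: mod_eq_0_iff_dvd)
  next
    assume "n dvd k"
    then show "cycle_mat n ^\<^sub>m k = 1\<^sub>m n"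
      unfolding cycle_mat_power by (intro eq_matI) (auto elim!: dvdE)
  qed
  then show ?thesis
    by (subst ord_unique[OF cycle_mat_in_GL[OF assms]]) (simp add: pow)
qed

end

theory Submission
  imports Defs "HOL-Analysis.Convex" "HOL-Number_Theory.Cong" "HOL-Algebra.Sylow"
begin

text \<open>
  A compact group of matrices leaves a positive definite hermitian form invariant, so it may be
  taken to consist of unitary matrices. Since \<open>A (A\<inverse> C) - (A\<inverse> C) A = C - A\<inverse> C A\<close>,
  real spectra of ring commutators mean that any two conjugate elements of the group \<open>G\<close> differ
  by a matrix with real spectrum. A matrix with real spectrum has a square of nonnegative trace
  (\<open>real_spectrum_trace\<close>), so it vanishes as soon as it is skew-hermitian
  (\<open>skew_real_spectrum_zero\<close>).

  This makes \<open>G\<close> finite: an element near the identity coincides with its conjugates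
  (\<open>near_one_conjugate_eq\<close>), so it is central, hence scalar, and the scalars in \<open>G\<close> are \<open>1\<close> and
  \<open>-1\<close>, because a nonreal scalar would turn all commutators nilpotent, which an irreducible group
  does not allow (\<open>not_nilpotent_commutators\<close>). The commutator of two involutions is
  skew-hermitian, so the involutions commute and form, with the identity, a normal subgroup \<open>D\<close>.
  There are no elements of order four (\<open>no_order_four\<close>); therefore \<open>D\<close> contains a Sylow
  2-subgroup, its index is odd, and it has a complement \<open>L\<close> (\<open>complement_exists\<close>), which is abelian
  because commuting conjugates in \<open>L\<close> are equal (\<open>conj_commute_imp_abelian\<close>). An element
  of \<open>D\<close> that commutes with a single nontrivial element of \<open>L\<close> is scalar
  (\<open>fixed_by_nontrivial_scalar\<close>), and an abelian group acting in this way is cyclic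
  (\<open>prime_torsion\<close>).

  Let \<open>c\<close> generate \<open>L\<close> and let \<open>u\<close> be a common eigenvector of \<open>D\<close>. The vectors \<open>c\<^sup>j u\<close>
  belong to different characters of \<open>D\<close>, so they are orthogonal, and they span an invariant
  subspace; in this basis \<open>c\<close> is the cycle matrix and \<open>D\<close> consists of diagonal sign matrices
  (\<open>monomial_basis\<close>). The average of an element of \<open>D\<close> over a nontrivial element of \<open>L\<close> is fixed
  by that element, so it is a scalar \<open>\<epsilon> = 1\<close> or \<open>\<epsilon> = -1\<close>, and since \<open>n\<close> is odd,
  comparing determinants identifies \<open>\<epsilon>\<close> with the determinant demanded in \<open>J_set\<close>.

  Conversely, the commutator of \<open>C\<^sup>a D\<close> and \<open>C\<^sup>b E\<close> is the shift \<open>C\<^sup>a\<^sup>+\<^sup>b\<close> with real weights. If the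
  shift is trivial, this is a real diagonal matrix. Otherwise a nonzero eigenvalue requires an
  orbit of the shift without a zero weight; multiplying the sign relations along it gives
  \<open>det D det E = - det D det E\<close> by the defining property of \<open>J_set\<close>, a contradiction
  (\<open>cycle_J_commutator_real\<close>).
\<close>

section \<open>Groups in which commuting conjugates are equal\<close>

lemma (in group) conj_eq_iff:
  assumes "x \<in> carrier G" "y \<in> carrier G" "g \<in> carrier G"
  shows "inv g \<otimes> x \<otimes> g = y \<longleftrightarrow> x \<otimes> g = g \<otimes> y"
proof -
  have "inv g \<otimes> x \<otimes> g = inv g \<otimes> (x \<otimes> g)" using assms by (simp add: m_assoc)
  then show ?thesis using assms inv_solve_left[of "x \<otimes> g" g y] by (metis inv_closed m_closed inv_solve_left')
qed

lemma (in group) inv_commute: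
  assumes "x \<otimes> a = a \<otimes> x" "x \<in> carrier G" "a \<in> carrier G"
  shows "x \<otimes> inv a = inv a \<otimes> x"
proof -
  have "inv a \<otimes> x \<otimes> a = x" using assms conj_eq_iff by auto
  then have "inv a \<otimes> x = x \<otimes> inv a" using assms inv_solve_right[of x "inv a \<otimes> x" a]
    by (metis inv_closed inv_solve_right' m_closed)
  then show ?thesis by simp
qed

lemma (in group) conj_mult:
  assumes "x \<in> carrier G" "y \<in> carrier G" "k \<in> carrier G"
  shows "(k \<otimes> x \<otimes> inv k) \<otimes> (k \<otimes> y \<otimes> inv k) = k \<otimes> (x \<otimes> y) \<otimes> inv k"
proof -
  have "inv k \<otimes> (k \<otimes> (y \<otimes> inv k)) = y \<otimes> inv k"
    using assms by (simp add: m_assoc[symmetric])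
  then show ?thesis using assms by (simp add: m_assoc)
qed

text \<open>
  In a minimal counterexample the centralizers of noncentral elements are abelian, and those of
  two noncentral elements are equal or meet in the centre. By hypothesis two commuting conjugates
  are equal, so the conjugates of the noncentral part of one such centralizer are pairwise
  disjoint and fill at least half of the group. One such family cannot fill everything outside
  the centre, and two of them leave no room for the identity.
\<close>

theorem (in group) conj_commute_imp_abelian:
  assumes "subgroup H G" and "finite H"
    and "\<And>x g. \<lbrakk>x \<in> H; g \<in> H; x \<otimes> (inv g \<otimes> x \<otimes> g) = (inv g \<otimes> x \<otimes> g) \<otimes> x\<rbrakk>
           \<Longrightarrow> x \<otimes> g = g \<otimes> x"
    and "x \<in> H" and "y \<in> H"
  shows "x \<otimes> y = y \<otimes> x"
  using assms
proof (induction "card H" arbitrary: H x y rule: less_induct)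
  case less
  note sub = \<open>subgroup H G\<close> and fin = \<open>finite H\<close> and conj = less.prems(3)
  interpret H: subgroup H G by (rule sub)
  have HG: "x \<in> carrier G" if "x \<in> H" for x using that by (rule H.mem_carrier)
  define Z where "Z = {z \<in> H. \<forall>y\<in>H. z \<otimes> y = y \<otimes> z}"
  define C where "C x = {y \<in> H. x \<otimes> y = y \<otimes> x}" for x
  have CH: "C x \<subseteq> H" and finC: "finite (C x)" for x using fin by (auto simp: C_def)
  have CG: "y \<in> carrier G" if "y \<in> C x" for x y using that CH HG by blast
  have subC: "subgroup (C x) G" if "x \<in> H" for x
  proof (rule subgroupI)
    show "C x \<subseteq> carrier G" "C x \<noteq> {}" using that HG by (auto simp: C_def)
    show "inv a \<in> C x" if "a \<in> C x" for a
      using that \<open>x \<in> H\<close> HG by (auto simp: C_def intro: inv_commute)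
    show "a \<otimes> b \<in> C x" if "a \<in> C x" "b \<in> C x" for a b
      using that \<open>x \<in> H\<close> HG by (auto simp: C_def) (metis HG m_assoc)
  qed
  show ?case
  proof (rule ccontr)
    assume nc: "x \<otimes> y \<noteq> y \<otimes> x"
    \<comment> \<open>Centralizers of noncentral elements are proper, hence abelian by induction.\<close>
    have Cab: "a \<otimes> b = b \<otimes> a" if "v \<in> H - Z" "a \<in> C v" "b \<in> C v" for v a b
    proof -
      have "C v \<subset> H" using that CH by (auto simp: C_def Z_def)
      then have "card (C v) < card H" using fin by (rule psubset_card_mono[rotated])
      then show ?thesis
      proof (rule less.hyps)
        show "subgroup (C v) G" "finite (C v)" "a \<in> C v" "b \<in> C v"
          using subC[of v] finC[of v] that by auto
        show "p \<otimes> g = g \<otimes> p"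
          if "p \<in> C v" "g \<in> C v" "p \<otimes> (inv g \<otimes> p \<otimes> g) = (inv g \<otimes> p \<otimes> g) \<otimes> p" for p g
          using conj[of p g] that CH[of v] by blast
      qed
    qed
    have Ceq: "C w = C v" if "v \<in> H - Z" "w \<in> C v - Z" for v w
    proof -
      have w: "w \<in> H - Z" using that CH by auto
      have "v \<in> C w" using that by (auto simp: C_def)
      show ?thesis
      proof (intro equalityI subsetI)
        fix a assume "a \<in> C w"
        then have "v \<otimes> a = a \<otimes> v" using Cab[OF w \<open>v \<in> C w\<close>] by blast
        then show "a \<in> C v" using \<open>a \<in> C w\<close> by (simp add: C_def)
      next
        fix a assume "a \<in> C v"
        then have "w \<otimes> a = a \<otimes> w" using Cab[OF that(1), of w a] that(2) by blast
        then show "a \<in> C w" using \<open>a \<in> C v\<close> by (simp add: C_def)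
      qed
    qed
    define U where "U v = (\<lambda>(g, y). inv g \<otimes> y \<otimes> g) ` (H \<times> (C v - Z))" for v
    have ZH: "Z \<subseteq> H" by (auto simp: Z_def)
    have Zconj: "inv g \<otimes> y \<otimes> g \<in> H - Z" if g: "g \<in> H" and y: "y \<in> H - Z" for g y
    proof
      show H: "inv g \<otimes> y \<otimes> g \<in> H" using that by auto
      show "inv g \<otimes> y \<otimes> g \<notin> Z"
      proof
        assume "inv g \<otimes> y \<otimes> g \<in> Z"
        then have "(inv g \<otimes> y \<otimes> g) \<otimes> inv g = inv g \<otimes> (inv g \<otimes> y \<otimes> g)"
          using g by (auto simp: Z_def)
        then have "inv g \<otimes> y = inv g \<otimes> (inv g \<otimes> y \<otimes> g)"
          using g y HG by (simp add: m_assoc)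
        then have "y = inv g \<otimes> y \<otimes> g" using g y HG H by auto
        with \<open>inv g \<otimes> y \<otimes> g \<in> Z\<close> y show False by auto
      qed
    qed
    have UH: "U v \<subseteq> H - Z" for v
    proof
      fix w assume "w \<in> U v"
      then obtain g y where "g \<in> H" "y \<in> C v - Z" "w = inv g \<otimes> y \<otimes> g" by (auto simp: U_def)
      then show "w \<in> H - Z" using Zconj[of g y] CH[of v] by blast
    qed
    have finU: "finite (U v)" for v using UH fin by (meson finite_Diff finite_subset)
    have selfU: "v \<in> U v" if "v \<in> H - Z" for v
      unfolding U_def by (rule image_eqI[of _ _ "(\<one>, v)"]) (use that HG in \<open>auto simp: C_def\<close>)
    have conj_in: "inv k \<otimes> y \<otimes> k = y \<and> k \<in> C v"
      if v: "v \<in> H - Z" and y: "y \<in> C v - Z" and k: "k \<in> H" and y': "inv k \<otimes> y \<otimes> k \<in> C v" for v y k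
    proof -
      have "y \<otimes> (inv k \<otimes> y \<otimes> k) = (inv k \<otimes> y \<otimes> k) \<otimes> y" using Cab[OF v] y y' by auto
      then have "y \<otimes> k = k \<otimes> y" using conj y k CH by auto
      moreover from this have "k \<in> C y" using k by (auto simp: C_def)
      moreover have "inv k \<otimes> y \<otimes> k = y"
        using conj_eq_iff[of y y k] \<open>y \<otimes> k = k \<otimes> y\<close> y k CG HG by auto
      ultimately show ?thesis using Ceq[OF v y] by auto
    qed
    have cardU: "card H * card (C v - Z) = card (U v) * card (C v)" if v: "v \<in> H - Z" for v
    proof -
      define f where "f = (\<lambda>(g, y). inv g \<otimes> y \<otimes> g)"
      have U: "U v = f ` (H \<times> (C v - Z))" by (simp add: U_def f_def)
      define s where "s = inv_into (H \<times> (C v - Z)) f"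
      have s: "s w \<in> H \<times> (C v - Z)" "f (s w) = w" if "w \<in> U v" for w
        using that unfolding U s_def by (rule inv_into_into, rule f_inv_into_f)
      have "bij_betw (\<lambda>(w, k). (k \<otimes> fst (s w), snd (s w))) (U v \<times> C v) (H \<times> (C v - Z))"
        unfolding bij_betw_def
      proof
        have shift: "f (k \<otimes> g, y) = f (g, y)" if "k \<in> C v" "g \<in> H" "y \<in> C v - Z" for k g y
        proof -
          have "y \<otimes> k = k \<otimes> y" using that Cab[OF v] by auto
          then have e: "inv k \<otimes> y \<otimes> k = y" using conj_eq_iff[of y y k] that CG HG by auto
          have "f (k \<otimes> g, y) = inv g \<otimes> (inv k \<otimes> y \<otimes> k) \<otimes> g"
            using that CH[of v] HG by (simp add: f_def inv_mult_group m_assoc subset_iff)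
          then show ?thesis by (simp add: e f_def)
        qed
        show "inj_on (\<lambda>(w, k). (k \<otimes> fst (s w), snd (s w))) (U v \<times> C v)"
        proof (rule inj_onI, clarify)
          fix w k w' k'
          assume w: "w \<in> U v" "w' \<in> U v" and k: "k \<in> C v" "k' \<in> C v"
            and e: "k \<otimes> fst (s w) = k' \<otimes> fst (s w')" "snd (s w) = snd (s w')"
          have "w = f (k \<otimes> fst (s w), snd (s w))"
            using shift[of k "fst (s w)" "snd (s w)"] s[OF w(1)] k by (metis mem_Sigma_iff prod.collapse)
          also have "\<dots> = w'"
            using shift[of k' "fst (s w')" "snd (s w')"] s[OF w(2)] k e by (metis mem_Sigma_iff prod.collapse)
          finally have "w = w'" .
          moreover have "fst (s w) \<in> carrier G" using s[OF w(1)] HG by (metis mem_Times_iff)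
          moreover have "k \<in> carrier G" "k' \<in> carrier G" using k CH HG by blast+
          ultimately show "w = w' \<and> k = k'" using e by auto
        qed
        show "(\<lambda>(w, k). (k \<otimes> fst (s w), snd (s w))) ` (U v \<times> C v) = H \<times> (C v - Z)"
        proof (intro equalityI subsetI)
          fix p assume "p \<in> (\<lambda>(w, k). (k \<otimes> fst (s w), snd (s w))) ` (U v \<times> C v)"
          then obtain w k where "w \<in> U v" "k \<in> C v" "p = (k \<otimes> fst (s w), snd (s w))" by auto
          with s[of w] CH[of v] show "p \<in> H \<times> (C v - Z)" by (auto simp: mem_Times_iff)
        next
          fix p assume p: "p \<in> H \<times> (C v - Z)"
          obtain g y where gy: "p = (g, y)" "g \<in> H" "y \<in> C v - Z" using p by auto
          define w where "w = f p"
          have w: "w \<in> U v" using p by (auto simp: U w_def)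
          obtain g' y' where gy': "s w = (g', y')" "g' \<in> H" "y' \<in> C v - Z"
            using s(1)[OF w] by (cases "s w") auto
          have G: "g \<in> carrier G" "g' \<in> carrier G" "y \<in> carrier G" "y' \<in> carrier G"
            using gy gy' CG HG by auto
          have e: "inv g \<otimes> y \<otimes> g = inv g' \<otimes> y' \<otimes> g'"
            using s(2)[OF w] by (simp add: gy'(1)) (simp add: f_def w_def gy(1))
          define k where "k = g \<otimes> inv g'"
          have kH: "k \<in> H" using gy gy' by (auto simp: k_def)
          have "inv k \<otimes> y \<otimes> k = g' \<otimes> (inv g \<otimes> y \<otimes> g) \<otimes> inv g'"
            using G by (simp add: k_def inv_mult_group m_assoc)
          also have "\<dots> = y'" unfolding e using G by (simp add: m_assoc) (simp add: m_assoc[symmetric])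
          finally have ky: "inv k \<otimes> y \<otimes> k = y'" .
          have "y = y'" "k \<in> C v" using conj_in[OF v gy(3) kH] ky gy'(3) by auto
          moreover have "g = k \<otimes> g'" using G by (simp add: k_def m_assoc)
          ultimately show "p \<in> (\<lambda>(w, k). (k \<otimes> fst (s w), snd (s w))) ` (U v \<times> C v)"
            using w gy gy' by (intro image_eqI[of _ _ "(w, k)"]) auto
        qed
      qed
      then have "card (U v \<times> C v) = card (H \<times> (C v - Z))" by (rule bij_betw_same_card)
      then show ?thesis by (simp add: card_cartesian_product)
    qed
    have CZ: "Z \<subseteq> C v" if "v \<in> H" for v using that by (auto simp: Z_def C_def)
    have half: "card H \<le> 2 * card (U v)" if v: "v \<in> H - Z" for v
    proof -
      have "(\<lambda>z. z \<otimes> v) ` Z \<subseteq> C v - Z"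
      proof (clarify, intro DiffI notI)
        fix z assume z: "z \<in> Z"
        have zH: "z \<in> H" "v \<in> H" using z v ZH by auto
        show "z \<otimes> v \<in> C v"
        proof -
          have "v \<otimes> (z \<otimes> v) = (z \<otimes> v) \<otimes> v"
            using z v zH HG by (simp add: m_assoc[symmetric]) (auto simp: Z_def)
          then show ?thesis using zH by (auto simp: C_def)
        qed
        assume zv: "z \<otimes> v \<in> Z"
        have "v \<in> Z"
        proof -
          have "v \<otimes> y = y \<otimes> v" if "y \<in> H" for y
          proof -
            have "z \<otimes> (v \<otimes> y) = y \<otimes> (z \<otimes> v)"
              using zv that zH HG by (simp add: Z_def m_assoc)
            also have "\<dots> = (z \<otimes> y) \<otimes> v"
            proof -
              have "z \<otimes> y = y \<otimes> z" using z that by (simp add: Z_def)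
              then show ?thesis using that zH HG by (simp add: m_assoc)
            qed
            also have "\<dots> = z \<otimes> (y \<otimes> v)" using that zH HG by (simp add: m_assoc)
            finally have "z \<otimes> (v \<otimes> y) = z \<otimes> (y \<otimes> v)" .
            then show ?thesis using that zH HG by auto
          qed
          then show ?thesis using zH by (auto simp: Z_def)
        qed
        with v show False by auto
      qed
      moreover have "inj_on (\<lambda>z. z \<otimes> v) Z" by (intro inj_onI) (metis DiffD1 HG ZH right_cancel subset_iff v)
      ultimately have "card Z \<le> card (C v - Z)"
        using card_inj_on_le finC by (metis finite_Diff)
      moreover have "card (C v - Z) = card (C v) - card Z"
        using CZ v fin finite_subset[OF ZH] by (intro card_Diff_subset) auto
      ultimately have "card (C v) \<le> 2 * card (C v - Z)" by linarith
      then have "card H * card (C v) \<le> card H * (2 * card (C v - Z))" by simp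
      also have "\<dots> = 2 * card (U v) * card (C v)" using cardU[OF v] by (simp add: algebra_simps)
      finally show ?thesis using v finC[of v]
        by (auto simp: card_gt_0_iff C_def) 
    qed
    have x: "x \<in> H - Z" using nc less.prems(4,5) unfolding Z_def by blast
    have oneZ: "\<one> \<in> Z" using HG by (auto simp: Z_def)
    show False
    proof (cases "U x = H - Z")
      case True
      have finZ: "finite Z" using finite_subset[OF ZH fin] .
      have xH: "x \<in> H" using x by blast
      have cZ: "card (H - Z) = card H - card Z" "card (C x - Z) = card (C x) - card Z"
        using card_Diff_subset[OF finZ ZH] card_Diff_subset[OF finZ CZ[OF xH]] by auto
      have le: "card Z \<le> card (C x)" "card (C x) \<le> card H" "0 < card Z"
        using card_mono[OF finC CZ[OF xH]] card_mono[OF fin CH] card_gt_0_iff[of Z] finZ oneZ by blast+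
      obtain c' where c': "card (C x) = card Z + c'" using le(1) le_Suc_ex by blast
      obtain h' where h': "card H = card Z + h'" using le_trans[OF le(1,2)] le_Suc_ex by blast
      have "card H * c' = h' * card (C x)"
        using cardU[OF x] True cZ c' h' by simp
      then have "card Z * c' = h' * card Z" using c' h' by (simp add: algebra_simps)
      then have "card (C x) = card H" using le c' h' by simp
      then have "C x = H" using CH fin by (simp add: card_subset_eq)
      then show False using x by (auto simp: Z_def C_def)
    next
      case False
      then obtain v where v: "v \<in> H - Z" "v \<notin> U x" using UH by blast
      have "U x \<inter> U v = {}"
      proof (rule ccontr)
        assume "U x \<inter> U v \<noteq> {}"
        then obtain g y g' y' where gy: "g \<in> H" "y \<in> C x - Z" "g' \<in> H" "y' \<in> C v - Z"
          and e: "inv g \<otimes> y \<otimes> g = inv g' \<otimes> y' \<otimes> g'"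
          unfolding U_def by auto
        have G: "g \<in> carrier G" "g' \<in> carrier G" "y \<in> carrier G" "y' \<in> carrier G" "v \<in> carrier G"
          using gy CG HG v by auto
        define k where "k = g \<otimes> inv g'"
        have kH: "k \<in> H" and kG: "k \<in> carrier G" using gy HG by (auto simp: k_def)
        have "inv k \<otimes> y \<otimes> k = g' \<otimes> (inv g \<otimes> y \<otimes> g) \<otimes> inv g'"
          using G by (simp add: k_def inv_mult_group m_assoc)
        also have "\<dots> = y'" unfolding e using G by (simp add: m_assoc) (simp add: m_assoc[symmetric])
        finally have y': "y \<otimes> k = k \<otimes> y'" using conj_eq_iff[of y y' k] kG G by auto
        define v' where "v' = k \<otimes> v \<otimes> inv k"
        have v'v: "inv k \<otimes> v' \<otimes> k = v"
          using kG G by (simp add: v'_def m_assoc) (simp add: m_assoc[symmetric])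
        have vy: "v \<otimes> y' = y' \<otimes> v" using gy by (auto simp: C_def)
        have yk: "y = k \<otimes> y' \<otimes> inv k"
        proof -
          have "k \<otimes> y' \<otimes> inv k = y \<otimes> k \<otimes> inv k" by (simp add: y')
          then show ?thesis using kG G by (simp add: m_assoc)
        qed
        have "y \<otimes> v' = k \<otimes> (y' \<otimes> v) \<otimes> inv k" "v' \<otimes> y = k \<otimes> (v \<otimes> y') \<otimes> inv k"
          unfolding yk v'_def using conj_mult kG G by auto
        then have "y \<otimes> v' = v' \<otimes> y" using vy by simp
        then have "v' \<in> C y" using v kH by (auto simp: C_def v'_def)
        then have "v' \<in> C x" using Ceq[OF x gy(2)] by simp
        moreover have "v' \<notin> Z"
        proof
          assume "v' \<in> Z"
          then have "v' \<otimes> k = k \<otimes> v'" using kH by (auto simp: Z_def)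
          moreover have "v' \<in> carrier G" using kG G by (simp add: v'_def)
          ultimately have "v = v'" using v'v conj_eq_iff[of v' v' k] kG by metis
          then show False using v \<open>v' \<in> Z\<close> by simp
        qed
        ultimately have "v \<in> U x"
          unfolding U_def by (intro image_eqI[of _ _ "(k, v')"]) (simp_all only: split v'v mem_Sigma_iff kH Diff_iff simp_thms)
        with v show False by simp
      qed
      then have "card (U x) + card (U v) = card (U x \<union> U v)"
        using finU by (simp add: card_Un_disjoint)
      also have "\<dots> \<le> card (H - Z)" using UH fin by (intro card_mono) auto
      also have "\<dots> < card H" using oneZ ZH fin by (intro psubset_card_mono) auto
      finally show False using half[OF x] half[OF v(1)] by linarith
    qed
  qed
qed

section \<open>Complements of groups of involutions and free abelian actions\<close>

context group begin

definition cj :: "'a \<Rightarrow> 'a \<Rightarrow> 'a" where "cj d g = inv g \<otimes> d \<otimes> g"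

lemma cj_closed [simp]: "d \<in> carrier G \<Longrightarrow> g \<in> carrier G \<Longrightarrow> cj d g \<in> carrier G"
  by (simp add: cj_def)

lemma cj_cj: "\<lbrakk>d \<in> carrier G; g \<in> carrier G; h \<in> carrier G\<rbrakk> \<Longrightarrow> cj (cj d g) h = cj d (g \<otimes> h)"
  by (simp add: cj_def inv_mult_group m_assoc)

lemma cj_one [simp]: "d \<in> carrier G \<Longrightarrow> cj d \<one> = d"
  by (simp add: cj_def)

lemma one_cj [simp]: "g \<in> carrier G \<Longrightarrow> cj \<one> g = \<one>"
  by (simp add: cj_def)

lemma cj_mult:
  assumes "d \<in> carrier G" "e \<in> carrier G" "g \<in> carrier G"
  shows "cj (d \<otimes> e) g = cj d g \<otimes> cj e g"
proof -
  have "g \<otimes> (inv g \<otimes> (e \<otimes> g)) = e \<otimes> g" using assms by (simp add: m_assoc[symmetric])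
  then show ?thesis using assms by (simp add: cj_def m_assoc)
qed

end

locale normal_involutions = group G for G (structure) +
  fixes D
  assumes D: "subgroup D G"
    and D_cj: "\<And>d g. d \<in> D \<Longrightarrow> g \<in> carrier G \<Longrightarrow> cj d g \<in> D"
    and D_comm: "\<And>a b. a \<in> D \<Longrightarrow> b \<in> D \<Longrightarrow> a \<otimes> b = b \<otimes> a"
    and D_sq: "\<And>d. d \<in> D \<Longrightarrow> d \<otimes> d = \<one>"
begin

lemma DG: "d \<in> D \<Longrightarrow> d \<in> carrier G"
  using D by (rule subgroup.mem_carrier)

sublocale K: comm_group "G\<lparr>carrier := D\<rparr>"
proof -
  interpret K: group "G\<lparr>carrier := D\<rparr>" using D by (rule subgroup_imp_group)
  show "comm_group (G\<lparr>carrier := D\<rparr>)"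
    by (rule K.group_comm_groupI) (simp, rule D_comm)
qed

abbreviation prodD :: "('i \<Rightarrow> 'a) \<Rightarrow> 'i set \<Rightarrow> 'a" where
  "prodD \<equiv> finprod (G\<lparr>carrier := D\<rparr>)"

lemma prodD_closed: "(\<And>x. x \<in> A \<Longrightarrow> f x \<in> D) \<Longrightarrow> prodD f A \<in> D"
  using K.finprod_closed[of f A] by auto

lemma prodD_mult:
  "(\<And>x. x \<in> A \<Longrightarrow> f x \<in> D) \<Longrightarrow> (\<And>x. x \<in> A \<Longrightarrow> g x \<in> D) \<Longrightarrow>
   prodD (\<lambda>x. f x \<otimes> g x) A = prodD f A \<otimes> prodD g A"
  using K.finprod_multf[of f A g] by (simp add: Pi_iff)

lemma prodD_insert:
  "finite A \<Longrightarrow> a \<notin> A \<Longrightarrow> (\<And>x. x \<in> insert a A \<Longrightarrow> f x \<in> D) \<Longrightarrow>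
   prodD f (insert a A) = f a \<otimes> prodD f A"
  using K.finprod_insert[of A a f] by (simp add: Pi_iff)

lemma prodD_cong: "(\<And>x. x \<in> A \<Longrightarrow> f x = g x) \<Longrightarrow> (\<And>x. x \<in> A \<Longrightarrow> g x \<in> D) \<Longrightarrow> prodD f A = prodD g A"
  by (rule K.finprod_cong') (auto simp: Pi_iff)

lemma prodD_reindex:
  "inj_on h A \<Longrightarrow> (\<And>x. x \<in> A \<Longrightarrow> f (h x) \<in> D) \<Longrightarrow> prodD f (h ` A) = prodD (\<lambda>x. f (h x)) A"
  using K.finprod_reindex[of f h A] by (auto simp: Pi_iff)

lemma prodD_cj:
  assumes "finite A" "\<And>x. x \<in> A \<Longrightarrow> f x \<in> D" "g \<in> carrier G"
  shows "cj (prodD f A) g = prodD (\<lambda>x. cj (f x) g) A"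
  using assms(1,2)
proof (induction A rule: finite_induct)
  case empty
  show ?case using assms(3) K.finprod_empty by simp
next
  case (insert a A)
  have "cj (prodD f (insert a A)) g = cj (f a \<otimes> prodD f A) g"
    using insert by (simp add: prodD_insert)
  also have "\<dots> = cj (f a) g \<otimes> prodD (\<lambda>x. cj (f x) g) A"
    using insert assms(3) prodD_closed[of A f] by (simp add: cj_mult DG)
  also have "\<dots> = prodD (\<lambda>x. cj (f x) g) (insert a A)"
    using insert assms(3) by (subst prodD_insert) (auto simp: D_cj)
  finally show ?case .
qed

lemma prodD_swap:
  assumes "finite A" "finite B" "\<And>x y. x \<in> A \<Longrightarrow> y \<in> B \<Longrightarrow> f x y \<in> D"
  shows "prodD (\<lambda>x. prodD (f x) B) A = prodD (\<lambda>y. prodD (\<lambda>x. f x y) A) B"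
  using assms(1,3)
proof (induction A rule: finite_induct)
  case empty
  show ?case using K.finprod_one K.finprod_empty by simp
next
  case (insert a A)
  have "prodD (\<lambda>x. prodD (f x) B) (insert a A) = prodD (f a) B \<otimes> prodD (\<lambda>y. prodD (\<lambda>x. f x y) A) B"
    using insert by (subst prodD_insert) (auto intro: prodD_closed)
  also have "\<dots> = prodD (\<lambda>y. f a y \<otimes> prodD (\<lambda>x. f x y) A) B"
    using insert by (subst prodD_mult) (auto intro: prodD_closed)
  also have "\<dots> = prodD (\<lambda>y. prodD (\<lambda>x. f x y) (insert a A)) B"
    using insert by (intro prodD_cong) (auto simp: prodD_insert intro: prodD_closed D_cj subgroup.m_closed[OF D])
  finally show ?case .
qed

lemma pow_odd: "d \<in> D \<Longrightarrow> odd k \<Longrightarrow> d [^] (k::nat) = d"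
proof -
  assume d: "d \<in> D" "odd k"
  obtain m where "k = 2 * m + 1" using d(2) by (auto elim: oddE)
  moreover have "d [^] (2 * m) = (d [^] (2::nat)) [^] m"
    using d DG by (simp add: nat_pow_pow)
  moreover have "d [^] (2::nat) = \<one>" using d D_sq DG by (simp add: numeral_2_eq_2)
  ultimately show ?thesis using d DG by simp
qed

lemma prodD_const_odd:
  assumes "d \<in> D" "odd (card A)"
  shows "prodD (\<lambda>_. d) A = d"
proof -
  have "prodD (\<lambda>_. d) A = d [^]\<^bsub>G\<lparr>carrier := D\<rparr>\<^esub> card A"
    using K.finprod_const[of d A] assms by simp
  also have "\<dots> = d [^] card A" by (rule nat_pow_consistent[symmetric])
  finally show ?thesis using assms by (simp add: pow_odd)
qed

text \<open>
  This is the splitting half of Gaschuetz's theorem, made explicit. For a transversal \<open>t\<close> of the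
  cosets of \<open>D\<close>, the product over all cosets \<open>Q\<close> of the elements of \<open>D\<close> that measure the failure
  of \<open>t Q \<otimes> g\<close> to be a representative is a crossed homomorphism \<open>\<phi>\<close> to \<open>D\<close>. On \<open>D\<close>
  it raises to the power of the index, which is odd, so it is the identity there; its kernel is
  the complement.
\<close>

theorem complement_exists:
  assumes fin: "finite (carrier G)" and odd: "odd (card (rcosets D))"
  shows "\<exists>L. subgroup L G \<and> L \<inter> D = {\<one>} \<and> (\<forall>g\<in>carrier G. \<exists>l\<in>L. \<exists>d\<in>D. g = l \<otimes> d)"
proof -
  define X where "X = rcosets D"
  have XG: "Q \<subseteq> carrier G" if "Q \<in> X" for Q
    using that rcosets_subset_PowG[OF D] by (auto simp: X_def)
  define t where "t Q = (SOME y. y \<in> Q)" for Q :: "'a set"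
  have Xcase: "\<exists>x\<in>carrier G. Q = D #> x" if "Q \<in> X" for Q
    using that unfolding X_def RCOSETS_def by blast
  have tQ: "t Q \<in> Q" if Q: "Q \<in> X" for Q
  proof -
    obtain x where x: "x \<in> carrier G" "Q = D #> x" using Xcase[OF Q] by blast
    then have "x \<in> Q" using rcos_self[OF _ D] by blast
    then show ?thesis unfolding t_def by (rule someI)
  qed
  have tG: "t Q \<in> carrier G" if "Q \<in> X" for Q using tQ XG that by blast
  have Qt: "Q = D #> t Q" if Q: "Q \<in> X" for Q
  proof -
    obtain x where x: "x \<in> carrier G" "Q = D #> x" using Xcase[OF Q] by blast
    then show ?thesis using repr_independence[of "t Q" D x] tQ[OF Q] D by simp
  qed
  have act: "Q #> g = D #> (t Q \<otimes> g)" if "Q \<in> X" "g \<in> carrier G" for Q g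
    using coset_mult_assoc[of D "t Q" g] that Qt[OF that(1)] tG subgroup.subset[OF D] by simp
  have actX: "Q #> g \<in> X" if "Q \<in> X" "g \<in> carrier G" for Q g
    unfolding act[OF that] X_def using that tG by (intro rcosetsI subgroup.subset[OF D]) simp_all
  have actact: "(Q #> g) #> h = Q #> (g \<otimes> h)" if "Q \<in> X" "g \<in> carrier G" "h \<in> carrier G" for Q g h
    using coset_mult_assoc[OF XG] that by simp
  \<comment> \<open>The element of \<open>D\<close> by which \<open>t Q \<otimes> g\<close> differs from the representative of its coset.\<close>
  define c where "c Q g = inv (t (Q #> g)) \<otimes> t Q \<otimes> g" for Q g
  have cD: "c Q g \<in> D" if Q: "Q \<in> X" and g: "g \<in> carrier G" for Q g
  proof -
    define s where "s = t Q \<otimes> g"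
    have s: "s \<in> carrier G" using tG[OF Q] g by (simp add: s_def)
    have "t (Q #> g) \<in> D #> s" using tQ[OF actX[OF Q g]] act[OF Q g] by (simp add: s_def)
    then obtain d where d: "d \<in> D" "t (Q #> g) = d \<otimes> s" by (auto simp: r_coset_def)
    have "c Q g = inv (t (Q #> g)) \<otimes> s"
      using tG[OF Q] tG[OF actX[OF Q g]] g by (simp add: c_def s_def m_assoc)
    also have "\<dots> = cj (inv d) s" using s d DG by (simp add: cj_def d inv_mult_group)
    finally show ?thesis using d s D_cj subgroup.m_inv_closed[OF D] by simp
  qed
  define \<phi> where "\<phi> g = prodD (\<lambda>Q. c Q g) X" for g
  have finX: "finite X" using fin rcosets_subset_PowG[OF D] by (auto simp: X_def intro: finite_subset)
  have \<phi>D: "\<phi> g \<in> D" if "g \<in> carrier G" for g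
    unfolding \<phi>_def using cD that by (intro prodD_closed) auto
  have cocycle: "\<phi> (g \<otimes> h) = \<phi> h \<otimes> cj (\<phi> g) h" if g: "g \<in> carrier G" and h: "h \<in> carrier G" for g h
  proof -
    have 1: "c Q (g \<otimes> h) = c (Q #> g) h \<otimes> cj (c Q g) h" if Q: "Q \<in> X" for Q
    proof -
      let ?a = "t Q" and ?b = "t (Q #> g)" and ?e = "t (Q #> (g \<otimes> h))"
      have G: "?a \<in> carrier G" "?b \<in> carrier G" "?e \<in> carrier G"
        using tG Q actX g h by auto
      have "h \<otimes> (inv h \<otimes> (inv ?b \<otimes> (?a \<otimes> (g \<otimes> h)))) = inv ?b \<otimes> (?a \<otimes> (g \<otimes> h))"
        "?b \<otimes> (inv ?b \<otimes> (?a \<otimes> (g \<otimes> h))) = ?a \<otimes> (g \<otimes> h)"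
        using G g h by (simp_all add: m_assoc[symmetric])
      then show ?thesis using G g h by (simp add: c_def cj_def actact[OF Q g h] m_assoc)
    qed
    have inj: "inj_on (\<lambda>Q. Q #> g) X"
    proof (rule inj_onI)
      fix P Q assume PQ: "P \<in> X" "Q \<in> X" "P #> g = Q #> g"
      then have "(P #> g) #> inv g = (Q #> g) #> inv g" by simp
      then have "P #> (g \<otimes> inv g) = Q #> (g \<otimes> inv g)"
        using actact[OF PQ(1) g, of "inv g"] actact[OF PQ(2) g, of "inv g"] g by simp
      then show "P = Q" using coset_mult_one[OF XG[OF PQ(1)]] coset_mult_one[OF XG[OF PQ(2)]] g by simp
    qed
    have img: "(\<lambda>Q. Q #> g) ` X = X"
      using inj actX g finX by (intro endo_inj_surj) auto
    have "\<phi> (g \<otimes> h) = prodD (\<lambda>Q. c (Q #> g) h \<otimes> cj (c Q g) h) X"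
      unfolding \<phi>_def using 1 cD actX g h
      by (intro prodD_cong) (auto intro!: subgroup.m_closed[OF D] D_cj)
    also have "\<dots> = prodD (\<lambda>Q. c (Q #> g) h) X \<otimes> prodD (\<lambda>Q. cj (c Q g) h) X"
      using cD actX g h by (intro prodD_mult) (auto intro!: D_cj)
    also have "prodD (\<lambda>Q. c (Q #> g) h) X = \<phi> h"
      using prodD_reindex[OF inj, of "\<lambda>Q. c Q h"] cD actX g h by (simp add: img \<phi>_def)
    also have "prodD (\<lambda>Q. cj (c Q g) h) X = cj (\<phi> g) h"
      unfolding \<phi>_def using finX cD g h by (subst prodD_cj) auto
    finally show ?thesis .
  qed
  have \<phi>id: "\<phi> d = d" if d: "d \<in> D" for d
  proof -
    have "c Q d = d" if Q: "Q \<in> X" for Q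
    proof -
      have tq: "t Q \<in> carrier G" using tG Q by simp
      have "t Q \<otimes> d = cj d (inv (t Q)) \<otimes> t Q"
        using tq d DG by (simp add: cj_def m_assoc)
      then have "t Q \<otimes> d \<in> D #> t Q"
        using D_cj[OF d, of "inv (t Q)"] tq by (auto simp: r_coset_def)
      then have "D #> t Q = D #> (t Q \<otimes> d)"
        using tq D by (intro repr_independence)
      then have "Q #> d = Q" using act[OF Q] d DG Qt[OF Q] by simp
      then show ?thesis using tq d DG by (simp add: c_def)
    qed
    then have "\<phi> d = prodD (\<lambda>_. d) X" unfolding \<phi>_def using d by (intro prodD_cong) auto
    then show ?thesis using prodD_const_odd[OF d] odd by (simp add: X_def)
  qed
  define L where "L = {g \<in> carrier G. \<phi> g = \<one>}"
  have oneD: "\<one> \<in> D" using D by (rule subgroup.one_closed)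
  have "subgroup L G"
  proof (rule subgroupI)
    show "L \<subseteq> carrier G" "L \<noteq> {}" using \<phi>id[OF oneD] by (auto simp: L_def)
    show "a \<otimes> b \<in> L" if "a \<in> L" "b \<in> L" for a b
      using that cocycle[of a b] by (auto simp: L_def)
    show "inv a \<in> L" if "a \<in> L" for a
      using that cocycle[of a "inv a"] \<phi>id[OF oneD] \<phi>D[of "inv a"] DG by (auto simp: L_def)
  qed
  moreover have "L \<inter> D = {\<one>}" using \<phi>id oneD by (auto simp: L_def)
  moreover have "\<exists>l\<in>L. \<exists>d\<in>D. g = l \<otimes> d" if g: "g \<in> carrier G" for g
  proof -
    define d where "d = \<phi> g"
    have d: "d \<in> D" using \<phi>D[OF g] by (simp add: d_def)
    have "cj d d = d" using d D_sq DG by (simp add: cj_def m_assoc)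
    then have "\<phi> (g \<otimes> d) = \<one>" using cocycle[OF g, of d] d \<phi>id DG D_sq by (simp add: d_def[symmetric])
    then have "g \<otimes> d \<in> L" using g d DG by (simp add: L_def)
    moreover have "g = (g \<otimes> d) \<otimes> d" using g d DG D_sq by (simp add: m_assoc)
    ultimately show ?thesis using d by (intro bexI)
  qed
  ultimately show ?thesis by (intro exI[of _ L] conjI ballI)
qed

end

lemma (in group) odd_index_if_two_elements:
  assumes fin: "finite (carrier G)" and D: "subgroup D G"
    and two: "\<And>g k. g \<in> carrier G \<Longrightarrow> g [^] ((2::nat) ^ k) = \<one> \<Longrightarrow> g \<in> D"
  shows "odd (card (rcosets D))"
proof -
  define a where "a = multiplicity 2 (Coset.order G)"
  have "Coset.order G \<noteq> 0" using fin order_gt_0_iff_finite by simp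
  then obtain m where m: "Coset.order G = 2 ^ a * m" "\<not> 2 dvd m"
    using multiplicity_decompose'[of "Coset.order G" 2] by (auto simp: a_def)
  obtain P where P: "subgroup P G" "card P = 2 ^ a"
    using sylow_thm[OF two_is_prime_nat group_axioms m(1) fin] by blast
  have "P \<subseteq> D"
  proof
    fix x assume x: "x \<in> P"
    interpret P: group "G\<lparr>carrier := P\<rparr>" using P(1) by (rule subgroup_imp_group)
    have "x [^]\<^bsub>G\<lparr>carrier := P\<rparr>\<^esub> Coset.order (G\<lparr>carrier := P\<rparr>) = \<one>\<^bsub>G\<lparr>carrier := P\<rparr>\<^esub>"
      using x by (intro P.pow_order_eq_1) simp
    then have "x [^] ((2::nat) ^ a) = \<one>"
      using P(2) by (simp add: Coset.order_def nat_pow_consistent[symmetric])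
    then show "x \<in> D" using two[of x a] x subgroup.mem_carrier[OF P(1)] by blast
  qed
  then have "subgroup P (G\<lparr>carrier := D\<rparr>)" by (rule subgroup_incl[OF P(1) D])
  then have "card (rcosets\<^bsub>G\<lparr>carrier := D\<rparr>\<^esub> P) * card P = card D"
    using group.lagrange[OF subgroup_imp_group[OF D]] by (simp add: Coset.order_def)
  then obtain e where "card D = 2 ^ a * e" using P(2) by (metis mult.commute)
  then have "card (rcosets D) * e * 2 ^ a = m * 2 ^ a"
    using lagrange[OF D] m by (simp add: algebra_simps)
  then have "card (rcosets D) * e = m" by simp
  then show ?thesis using m(2) by auto
qed

lemma (in group) ord_mult_coprime:
  assumes "x \<otimes> y = y \<otimes> x" "x \<in> carrier G" "y \<in> carrier G" "coprime (ord x) (ord y)"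
  shows "ord (x \<otimes> y) = ord x * ord y"
proof (rule dvd_antisym)
  show "ord (x \<otimes> y) dvd ord x * ord y" using assms by (intro ord_mul_divides)
  define N where "N = ord (x \<otimes> y)"
  have pow1: "(x \<otimes> y) [^] (N * k) = \<one>" for k
    using assms by (simp add: N_def nat_pow_pow[symmetric])
  have pw: "(x \<otimes> y) [^] (k::nat) = x [^] k \<otimes> y [^] k" for k
    using assms by (intro pow_mult_distrib)
  have y1: "y [^] (N * ord y) = \<one>" "x [^] (N * ord x) = \<one>"
    using assms by (metis mult.commute nat_pow_pow pow_ord_eq_1 nat_pow_one)+
  have "x [^] (N * ord y) = \<one>"
    using pow1[of "ord y"] pw[of "N * ord y"] y1 assms by simp
  then have "ord x dvd N * ord y" using assms by (simp add: pow_eq_id)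
  then have 1: "ord x dvd N" using assms(4) by (simp add: coprime_dvd_mult_left_iff)
  have "y [^] (N * ord x) = \<one>"
    using pow1[of "ord x"] pw[of "N * ord x"] y1 assms by simp
  then have "ord y dvd N * ord x" using assms by (simp add: pow_eq_id)
  then have 2: "ord y dvd N" using assms(4) by (simp add: coprime_commute coprime_dvd_mult_left_iff)
  show "ord x * ord y dvd ord (x \<otimes> y)"
    using divides_mult[OF 1 2 assms(4)] by (simp add: N_def)
qed

text \<open>
  The powers of an element \<open>c\<close> of maximal order are everything: if some power \<open>z\<close> of
  an element outside has its \<open>p\<close>-th power among the powers of \<open>c\<close>, then dividing \<open>z\<close> by a suitable
  power of \<open>c\<close> leaves an element of order \<open>p\<close>, and \<open>c\<close> already accounts for those.
\<close>

lemma (in group) cyclic_if_prime_torsion_cyclic: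
  assumes L: "subgroup L G" and fin: "finite L"
    and comm: "\<And>x y. x \<in> L \<Longrightarrow> y \<in> L \<Longrightarrow> x \<otimes> y = y \<otimes> x"
    and uniq: "\<And>p a b. \<lbrakk>prime (p::nat); a \<in> L; b \<in> L; a [^] p = \<one>; b [^] p = \<one>; b \<noteq> \<one>\<rbrakk>
            \<Longrightarrow> \<exists>k::nat. a = b [^] k"
  shows "\<exists>c\<in>L. \<forall>x\<in>L. \<exists>k::nat. x = c [^] k"
proof -
  have LG: "x \<in> carrier G" if "x \<in> L" for x using that L by (rule subgroup.mem_carrier[rotated])
  have Lpow: "x [^] (k::nat) \<in> L" if "x \<in> L" for x k
    using that L by (induction k) (auto simp: subgroup.one_closed subgroup.m_closed)
  have pos: "ord x > 0" if "x \<in> L" for x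
  proof -
    interpret M: group "G\<lparr>carrier := L\<rparr>" using L by (rule subgroup_imp_group)
    have "x [^]\<^bsub>G\<lparr>carrier := L\<rparr>\<^esub> Coset.order (G\<lparr>carrier := L\<rparr>) = \<one>\<^bsub>G\<lparr>carrier := L\<rparr>\<^esub>"
      using that by (intro M.pow_order_eq_1) simp
    then have "x [^] card L = \<one>" by (simp add: Coset.order_def nat_pow_consistent[symmetric])
    then have "ord x dvd card L" using that LG by (simp add: pow_eq_id)
    moreover have "card L > 0" using that fin by (auto simp: card_gt_0_iff)
    ultimately show ?thesis using dvd_pos_nat by blast
  qed
  have neL: "ord ` L \<noteq> {}" using subgroup.one_closed[OF L] by blast
  obtain c where c: "c \<in> L" and cm: "ord c = Max (ord ` L)"
    using Max_in[OF finite_imageI[OF fin] neL] by (metis imageE)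
  have max: "ord x \<le> ord c" if "x \<in> L" for x
    unfolding cm using that fin by (intro Max_ge) auto
  have cG: "c \<in> carrier G" using c LG by blast
  define m where "m = ord c"
  have m0: "m > 0" using pos c by (simp add: m_def)
  \<comment> \<open>An element of maximal order realises the exponent.\<close>
  have expo: "ord y dvd m" if y: "y \<in> L" for y
  proof (rule ccontr)
    assume "\<not> ord y dvd m"
    then obtain p where p: "prime p" "\<not> multiplicity p (ord y) \<le> multiplicity p m"
      using multiplicity_le_imp_dvd[of "ord y" m] pos[OF y] by auto
    define e where "e = multiplicity p (ord y)"
    define a where "a = multiplicity p m"
    obtain m' where m': "m = p ^ a * m'" "\<not> p dvd m'"
      using multiplicity_decompose'[of m p] m0 not_prime_unit[of p] p(1) unfolding a_def by blast
    obtain r where r: "ord y = p ^ e * r" "\<not> p dvd r"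
      using multiplicity_decompose'[of "ord y" p] pos[OF y] not_prime_unit[of p] p(1) unfolding e_def by blast
    have r0: "r \<noteq> 0" "m' \<noteq> 0" using r(2) m'(2) by (metis dvd_0_right)+
    have p0: "p > 0" using p(1) prime_gt_0_nat by blast
    have "ord (y [^] r) = p ^ e"
      using ord_pow[of y r] LG[OF y] r r0 by simp
    moreover have "ord (c [^] (p ^ a)) = m'"
      using ord_pow[of c "p ^ a"] cG m' p0 by (simp add: m_def)
    moreover have "coprime (p ^ e) m'" using p(1) m'(2) by (simp add: prime_imp_coprime)
    ultimately have "ord (y [^] r \<otimes> c [^] (p ^ a)) = p ^ e * m'"
      using ord_mult_coprime[of "y [^] r" "c [^] (p ^ a)"] comm[OF Lpow[OF y] Lpow[OF c]] LG[OF y] cG by simp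
    moreover have "y [^] r \<otimes> c [^] (p ^ a) \<in> L"
      using Lpow[OF y] Lpow[OF c] L by (simp add: subgroup.m_closed)
    ultimately have "p ^ e * m' \<le> p ^ a * m'" using max m' by (metis m_def)
    then have "p ^ e \<le> p ^ a" using r0 by simp
    moreover have "a < e" using p(2) by (simp add: a_def e_def)
    then have "p ^ a < p ^ e" using p(1) prime_gt_1_nat by (intro power_strict_increasing) auto
    ultimately show False by simp
  qed
  have ym: "y [^] m = \<one>" if "y \<in> L" for y using expo[OF that] LG[OF that] by (simp add: pow_eq_id)
  have "\<exists>k::nat. y = c [^] k" if y: "y \<in> L" for y
  proof (rule ccontr)
    assume no: "\<not> (\<exists>k::nat. y = c [^] k)"
    define P where "P r \<longleftrightarrow> r > 0 \<and> (\<exists>k::nat. y [^] r = c [^] k)" for r :: nat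
    define r where "r = (LEAST r. P r)"
    have "P m" using m0 ym[OF y] by (auto simp: P_def intro: exI[of _ 0])
    then have "P r" unfolding r_def by (rule LeastI)
    then have r: "r > 0" "\<exists>k::nat. y [^] r = c [^] k" by (auto simp: P_def)
    have least: "r \<le> s" if "s > 0" "y [^] s = c [^] k" for s k :: nat
      unfolding r_def using that by (intro Least_le) (auto simp: P_def)
    have "r \<noteq> 1" using r(2) no nat_pow_eone[OF LG[OF y]] by metis
    then obtain p where p: "prime p" "p dvd r" using prime_factor_nat by blast
    then obtain s where s: "r = p * s" by blast
    define z where "z = y [^] s"
    have z: "z \<in> L" "z \<in> carrier G" using Lpow[OF y] LG by (auto simp: z_def)
    have p1: "p > 1" using p(1) prime_gt_1_nat by blast
    have zno: "z \<noteq> c [^] k" for k :: nat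
      using least[of s k] r(1) s p1 by (auto simp: z_def)
    obtain k where k: "z [^] p = c [^] (k::nat)"
      using r(2) s LG[OF y] by (auto simp: z_def nat_pow_pow mult.commute)
    show False
    proof (cases "p dvd m")
      case False
      then have "coprime p m" using p(1) by (simp add: prime_imp_coprime)
      then obtain u where u: "[p * u = 1] (mod m)" using cong_solve_coprime_nat[of p m] by auto
      have "z = z [^] (p * u)"
      proof -
        have "(p * u) mod m = 1 mod m" using u by (simp add: cong_def)
        moreover have "z [^] (q::nat) = z [^] (q mod m)" for q
        proof -
          have "z [^] q = z [^] (m * (q div m) + q mod m)" by simp
          also have "\<dots> = (z [^] m) [^] (q div m) \<otimes> z [^] (q mod m)"
            using z by (simp add: nat_pow_mult nat_pow_pow)
          finally show ?thesis using ym[OF z(1)] z by simp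
        qed
        ultimately have "z [^] (p * u) = z [^] (1::nat)" by metis
        then show ?thesis using z by simp
      qed
      also have "\<dots> = c [^] (k * u)" using k z cG by (simp add: nat_pow_pow[symmetric])
      finally show False using zno by blast
    next
      case True
      then obtain q where q: "m = p * q" by blast
      have "c [^] (k * q) = (z [^] p) [^] q" using k cG by (simp add: nat_pow_pow)
      also have "\<dots> = \<one>" using ym[OF z(1)] z q by (simp add: nat_pow_pow)
      finally have "m dvd k * q" using cG by (simp add: pow_eq_id m_def)
      then have "p dvd k" using q m0 by auto
      then obtain j where j: "k = p * j" by blast
      define x where "x = z \<otimes> inv (c [^] j)"
      have cjL: "c [^] j \<in> L" "inv (c [^] j) \<in> L"
        using Lpow[OF c] subgroup.m_inv_closed[OF L] by auto
      have cjG: "c [^] j \<in> carrier G" using cG by simp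
      have x: "x \<in> L" using z cjL by (simp add: x_def subgroup.m_closed[OF L])
      have zx: "z = x \<otimes> c [^] j" using z cjG by (simp add: x_def m_assoc)
      have "x [^] p = z [^] p \<otimes> inv (c [^] j) [^] p"
        unfolding x_def using comm[OF z(1) cjL(2)] z cjG by (intro pow_mult_distrib) auto
      also have "inv (c [^] j) [^] p = inv (c [^] (p * j))"
        using cG by (simp add: nat_pow_inv nat_pow_pow mult.commute)
      finally have xp: "x [^] p = \<one>" using k j cG by simp
      define b where "b = c [^] q"
      have "b [^] p = \<one>" using ym[OF c] q cG by (simp add: b_def nat_pow_pow mult.commute)
      moreover have "b \<noteq> \<one>"
      proof
        assume "b = \<one>"
        then have "m dvd q" using cG by (simp add: b_def pow_eq_id m_def)
        then show False using q m0 p1 by (auto dest: dvd_imp_le)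
      qed
      ultimately obtain i where "x = b [^] (i::nat)"
        using uniq[OF p(1) x, of b] xp Lpow[OF c] by (auto simp: b_def)
      then have "z = c [^] (q * i + j)" using zx cG by (simp add: b_def nat_pow_pow nat_pow_mult)
      then show False using zno by blast
    qed
  qed
  with c show ?thesis by blast
qed

text \<open>
  An abelian group \<open>L\<close> of odd order acts by conjugation on the involutions \<open>D\<close>, and modulo the
  trivially acted part \<open>Z\<close> it acts freely. This is the situation of a Frobenius complement.
\<close>

locale free_abelian_action = normal_involutions +
  fixes L Z
  assumes L: "subgroup L G" "finite L"
    and L_comm: "\<And>x y. x \<in> L \<Longrightarrow> y \<in> L \<Longrightarrow> x \<otimes> y = y \<otimes> x"
    and L_sq: "\<And>x. x \<in> L \<Longrightarrow> x \<otimes> x = \<one> \<Longrightarrow> x = \<one>"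
    and Z: "subgroup Z G" "Z \<subset> D"
    and Z_cj: "\<And>z g. z \<in> Z \<Longrightarrow> g \<in> L \<Longrightarrow> cj z g = z"
    and fixed: "\<And>g u. \<lbrakk>g \<in> L; g \<noteq> \<one>; u \<in> D; cj u g = u\<rbrakk> \<Longrightarrow> u \<in> Z"
begin

lemma LG: "x \<in> L \<Longrightarrow> x \<in> carrier G"
  using L(1) by (rule subgroup.mem_carrier)

lemma Lpow: "x \<in> L \<Longrightarrow> x [^] (k::nat) \<in> L"
  using L(1) by (induction k) (auto simp: subgroup.one_closed subgroup.m_closed)

lemma prodD_Z:
  assumes "finite A" "\<And>x. x \<in> A \<Longrightarrow> f x \<in> Z"
  shows "prodD f A \<in> Z"
  using assms
proof (induction A rule: finite_induct)
  case empty
  show ?case using K.finprod_empty subgroup.one_closed[OF Z(1)] by simp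
next
  case (insert a A)
  then have "prodD f (insert a A) = f a \<otimes> prodD f A" using Z(2) by (subst prodD_insert) auto
  then show ?case using insert subgroup.m_closed[OF Z(1)] by simp
qed

definition orbit_prod :: "nat \<Rightarrow> 'a \<Rightarrow> 'a \<Rightarrow> 'a" where
  "orbit_prod p g d = prodD (\<lambda>j. cj d (g [^] j)) {..<p}"

text \<open>
  Conjugation by \<open>g\<close> permutes the factors of the product cyclically, so the product is fixed by \<open>g\<close>.
\<close>

lemma orbit_prod_Z:
  assumes g: "g \<in> L" "g \<noteq> \<one>" "g [^] p = \<one>" and d: "d \<in> D"
  shows "orbit_prod p g d \<in> Z"
proof (cases p)
  case 0
  then show ?thesis
    using K.finprod_empty subgroup.one_closed[OF Z(1)] by (simp add: orbit_prod_def)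
next
  case (Suc n)
  have gG: "g \<in> carrier G" "d \<in> carrier G" using g LG d DG by auto
  define f where "f j = cj d (g [^] j)" for j :: nat
  have fD: "f j \<in> D" for j using d gG D_cj by (simp add: f_def)
  have op: "orbit_prod p g d = prodD f {..n}"
    by (simp add: orbit_prod_def f_def[abs_def] Suc lessThan_Suc_atMost)
  have "cj (prodD f {..n}) g = prodD (\<lambda>j. cj (f j) g) {..n}"
    using fD gG by (intro prodD_cj) auto
  also have "\<dots> = prodD (\<lambda>j. f (Suc j)) {..n}"
    using gG fD[of "Suc _"] by (intro prodD_cong) (auto simp: f_def cj_cj)
  finally have e: "cj (prodD f {..n}) g = prodD (\<lambda>j. f (Suc j)) {..n}" .
  have "prodD (\<lambda>j. f (Suc j)) {..n} \<otimes> f 0 = f (Suc n) \<otimes> prodD f {..n}"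
    using K.finprod_Suc2[of f n] K.finprod_Suc[of f n] fD by (simp add: Pi_iff)
  also have "f (Suc n) = f 0" using g gG Suc by (simp add: f_def)
  also have "f 0 \<otimes> prodD f {..n} = prodD f {..n} \<otimes> f 0"
    using fD by (intro D_comm prodD_closed) auto
  finally have "prodD (\<lambda>j. f (Suc j)) {..n} = prodD f {..n}"
    using fD DG prodD_closed by (metis right_cancel)
  then show ?thesis
    unfolding op using fixed[OF g(1,2)] e fD prodD_closed by metis
qed

text \<open>
  If \<open>a\<close> and \<open>b\<close> spanned a plane over the field of \<open>p\<close> elements, the lines through the origin
  other than that of \<open>b\<close> would cover each point off the line of \<open>b\<close> exactly once and the origin
  \<open>p\<close> times. Taking the product of the conjugates of \<open>d\<close> over all these lines expresses \<open>d\<close>,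
  as \<open>p\<close> is odd, through orbit products, which all lie in \<open>Z\<close>.
\<close>

lemma prime_torsion:
  assumes p: "prime (p::nat)" and ab: "a \<in> L" "b \<in> L" "a [^] p = \<one>" "b [^] p = \<one>" "b \<noteq> \<one>"
  shows "\<exists>k::nat. a = b [^] k"
proof (rule ccontr)
  assume no: "\<not> (\<exists>k::nat. a = b [^] k)"
  have G: "a \<in> carrier G" "b \<in> carrier G" using ab LG by auto
  have "p \<noteq> 2" using ab(4,5) L_sq[OF ab(2)] G by (auto simp: numeral_2_eq_2)
  then have odd: "odd p" using p primes_dvd_imp_eq[OF two_is_prime_nat p] by blast
  have p0: "p > 0" using p prime_gt_0_nat by blast
  obtain d where d: "d \<in> D" "d \<notin> Z" using Z(2) by blast
  have dG: "d \<in> carrier G" using d DG by simp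
  define f where "f j k = cj d ((a \<otimes> b [^] k) [^] j)" for j k :: nat
  have L2: "a \<otimes> b [^] k \<in> L" for k :: nat
    using ab Lpow by (intro subgroup.m_closed[OF L(1)]) auto
  have fD: "f j k \<in> D" for j k
    using d D_cj LG[OF L2] by (simp add: f_def)
  have comm_ab: "a \<otimes> b [^] k = b [^] k \<otimes> a" for k :: nat
    using ab Lpow by (intro L_comm) auto
  have line: "prodD (\<lambda>j. f j k) {..<p} \<in> Z" for k
  proof -
    have "(a \<otimes> b [^] k) [^] p = a [^] p \<otimes> (b [^] k) [^] p"
      using G comm_ab by (intro pow_mult_distrib) auto
    also have "(b [^] k) [^] p = (b [^] p) [^] k" using G by (simp add: nat_pow_pow mult.commute)
    finally have 1: "(a \<otimes> b [^] k) [^] p = \<one>" using ab by simp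
    have "a \<otimes> b [^] k \<noteq> \<one>"
    proof
      assume e: "a \<otimes> b [^] k = \<one>"
      have kp: "k + k * (p - 1) = p * k" using p0 by (cases p) (simp_all add: mult.commute)
      have "b [^] k \<otimes> b [^] (k * (p - 1)) = b [^] (p * k)"
        using G nat_pow_mult[of b k "k * (p - 1)"] unfolding kp by simp
      also have "\<dots> = (b [^] p) [^] k" using G by (simp add: nat_pow_pow)
      also have "\<dots> = \<one>" using ab by simp
      finally have b1: "b [^] k \<otimes> b [^] (k * (p - 1)) = \<one>" .
      have "a = a \<otimes> (b [^] k \<otimes> b [^] (k * (p - 1)))" using b1 G by simp
      also have "\<dots> = (a \<otimes> b [^] k) \<otimes> b [^] (k * (p - 1))" using G by (simp add: m_assoc)
      finally have "a = b [^] (k * (p - 1))" using e G by simp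
      with no show False by blast
    qed
    then show ?thesis using orbit_prod_Z[OF L2 _ 1 d(1)] by (simp add: orbit_prod_def f_def)
  qed
  have col: "prodD (f j) {..<p} \<in> Z" if j: "0 < j" "j < p" for j
  proof -
    have cop: "coprime j p" using p j by (metis coprime_commute nat_dvd_not_less prime_imp_coprime)
    define h where "h k = (k * j) mod p" for k
    have inj: "inj_on h {..<p}"
    proof (rule inj_onI)
      fix x y assume xy: "x \<in> {..<p}" "y \<in> {..<p}" "h x = h y"
      then have "[x * j = y * j] (mod p)" by (simp add: h_def cong_def)
      then have "[x = y] (mod p)" using cop by (simp add: cong_mult_rcancel_nat)
      then show "x = y" using xy by (simp add: cong_def)
    qed
    have img: "h ` {..<p} = {..<p}"
      using inj p0 by (intro endo_inj_surj) (auto simp: h_def)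
    have bh: "b [^] (k * j) = b [^] h k" for k
    proof -
      have "b [^] (k * j) = b [^] (p * ((k * j) div p) + h k)" by (simp add: h_def)
      also have "\<dots> = (b [^] p) [^] ((k * j) div p) \<otimes> b [^] h k"
        using G by (simp add: nat_pow_mult nat_pow_pow)
      finally show ?thesis using ab G by simp
    qed
    have "f j k = cj (cj d (b [^] h k)) (a [^] j)" for k
    proof -
      have "(a \<otimes> b [^] k) [^] j = (b [^] k \<otimes> a) [^] j" by (simp add: comm_ab)
      also have "\<dots> = (b [^] k) [^] j \<otimes> a [^] j"
        using G comm_ab by (intro pow_mult_distrib) auto
      finally show ?thesis using G dG by (simp add: f_def cj_cj nat_pow_pow bh[symmetric])
    qed
    then have "prodD (f j) {..<p} = prodD (\<lambda>k. cj (cj d (b [^] h k)) (a [^] j)) {..<p}"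
      using G d D_cj by (intro prodD_cong) auto
    also have "\<dots> = cj (prodD (\<lambda>k. cj d (b [^] h k)) {..<p}) (a [^] j)"
      using G d D_cj by (subst prodD_cj) auto
    also have "prodD (\<lambda>k. cj d (b [^] h k)) {..<p} = prodD (\<lambda>k. cj d (b [^] k)) (h ` {..<p})"
      using inj G d D_cj by (subst prodD_reindex) auto
    also have "\<dots> = orbit_prod p b d" by (simp add: img orbit_prod_def)
    finally show ?thesis using orbit_prod_Z[OF ab(2,5,4) d(1)] Z_cj Lpow[OF ab(1)] by simp
  qed
  have "prodD (\<lambda>j. prodD (f j) {..<p}) {..<p} = prodD (\<lambda>k. prodD (\<lambda>j. f j k) {..<p}) {..<p}"
    using fD by (intro prodD_swap) auto
  also have "\<dots> \<in> Z" using line by (rule prodD_Z[rotated]) auto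
  finally have total: "prodD (\<lambda>j. prodD (f j) {..<p}) {..<p} \<in> Z" .
  have sp: "{..<p} = insert 0 {0<..<p}" using p0 by auto
  have "prodD (\<lambda>j. prodD (f j) {..<p}) {..<p} = prodD (f 0) {..<p} \<otimes> prodD (\<lambda>j. prodD (f j) {..<p}) {0<..<p}"
    using prodD_insert[of "{0<..<p}" 0 "\<lambda>j. prodD (f j) {..<p}"] prodD_closed[of "{..<p}" "f _"] fD
    unfolding sp[symmetric] by simp
  moreover have "prodD (f 0) {..<p} = d"
  proof -
    have "prodD (f 0) {..<p} = prodD (\<lambda>_. d) {..<p}"
      using d dG by (intro prodD_cong) (auto simp: f_def)
    then show ?thesis using prodD_const_odd[OF d(1), of "{..<p}"] odd by simp
  qed
  moreover have rest: "prodD (\<lambda>j. prodD (f j) {..<p}) {0<..<p} \<in> Z" (is "?r \<in> Z")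
    using col by (rule prodD_Z[rotated]) auto
  ultimately have "d \<otimes> ?r \<in> Z" using total by simp
  then have "(d \<otimes> ?r) \<otimes> inv ?r \<in> Z"
    using subgroup.m_closed[OF Z(1) _ subgroup.m_inv_closed[OF Z(1) rest]] by simp
  moreover have "?r \<in> carrier G" using subgroup.mem_carrier[OF Z(1) rest] .
  ultimately have "d \<in> Z" using dG by (simp add: m_assoc)
  with d show False by simp
qed

theorem cyclic: "\<exists>c\<in>L. \<forall>x\<in>L. \<exists>k::nat. x = c [^] k"
  by (rule cyclic_if_prime_torsion_cyclic[OF L L_comm prime_torsion])

end

section \<open>Matrices, spectra and irreducibility\<close>

abbreviation M :: "nat \<Rightarrow> complex mat set" where "M n \<equiv> carrier_mat n n"

lemma mat_mult_entry:
  "\<lbrakk>A \<in> M n; B \<in> M n; i < n; j < n\<rbrakk> \<Longrightarrow> (A * B) $$ (i, j) = (\<Sum>k<n. A $$ (i, k) * B $$ (k, j))"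
  by (simp add: scalar_prod_def lessThan_atLeast0)

lemma mat_eqI:
  assumes "A \<in> M n" "B \<in> M n" "\<And>i j. i < n \<Longrightarrow> j < n \<Longrightarrow> A $$ (i, j) = B $$ (i, j)"
  shows "A = B"
  using assms by (intro eq_matI) auto

lemma mult_M [simp]: "A \<in> M n \<Longrightarrow> B \<in> M n \<Longrightarrow> A * B \<in> M n" by simp
lemma add_M [simp]: "A \<in> M n \<Longrightarrow> B \<in> M n \<Longrightarrow> A + B \<in> M n" by simp
lemma minus_M [simp]: "A \<in> M n \<Longrightarrow> B \<in> M n \<Longrightarrow> A - B \<in> M n" by (simp add: minus_carrier_mat)

lemma one_M [simp]: "A \<in> M n \<Longrightarrow> A * 1\<^sub>m n = A" "A \<in> M n \<Longrightarrow> 1\<^sub>m n * A = A" by auto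

lemma mat_idx:
  assumes "A \<in> M n" "B \<in> M n" "i < n" "j < n"
  shows "(A + B) $$ (i, j) = A $$ (i, j) + B $$ (i, j)" "(A - B) $$ (i, j) = A $$ (i, j) - B $$ (i, j)"
  using assms by auto

lemma smult_idx: "A \<in> M n \<Longrightarrow> i < n \<Longrightarrow> j < n \<Longrightarrow> (c \<cdot>\<^sub>m A) $$ (i, j) = c * A $$ (i, j)"
  by auto

lemmas mat_assoc = assoc_mult_mat[of _ n n _ n _ n for n]
lemmas mat_distrib = add_mult_distrib_mat[of _ n n _ _ n for n] mult_add_distrib_mat[of _ n n _ n for n]
  minus_mult_distrib_mat[of _ n n _ _ n for n] mult_minus_distrib_mat[of _ n n _ n for n]
lemmas mat_smult = mult_smult_assoc_mat[of _ n n _ n for n] mult_smult_distrib[of _ n n _ n for n]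

definition tr :: "complex mat \<Rightarrow> complex" where
  "tr A = (\<Sum>i<dim_row A. A $$ (i, i))"

definition adj :: "complex mat \<Rightarrow> complex mat" where
  "adj A = mat (dim_col A) (dim_row A) (\<lambda>(i, j). cnj (A $$ (j, i)))"

text \<open>
  The square of the Frobenius norm.
\<close>

definition nrm2 :: "complex mat \<Rightarrow> real" where
  "nrm2 A = (\<Sum>i<dim_row A. \<Sum>j<dim_col A. (cmod (A $$ (i, j)))\<^sup>2)"

lemma adj_carrier [simp]: "A \<in> carrier_mat r c \<Longrightarrow> adj A \<in> carrier_mat c r"
  by (simp add: adj_def)

lemma dim_adj [simp]: "dim_row (adj A) = dim_col A" "dim_col (adj A) = dim_row A"
  by (simp_all add: adj_def)

lemma adj_adj [simp]: "adj (adj A) = A"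
  by (intro eq_matI) (auto simp: adj_def)

lemma adj_one [simp]: "adj (1\<^sub>m n) = 1\<^sub>m n"
  by (intro eq_matI) (auto simp: adj_def)

lemma adj_smult [simp]: "adj (c \<cdot>\<^sub>m A) = cnj c \<cdot>\<^sub>m adj A"
  by (intro eq_matI) (auto simp: adj_def)

lemma adj_add: "A \<in> M n \<Longrightarrow> B \<in> M n \<Longrightarrow> adj (A + B) = adj A + adj B"
  by (intro eq_matI) (auto simp: adj_def)

lemma adj_minus: "A \<in> M n \<Longrightarrow> B \<in> M n \<Longrightarrow> adj (A - B) = adj A - adj B"
  by (intro eq_matI) (auto simp: adj_def)

lemma adj_mult: "A \<in> carrier_mat r c \<Longrightarrow> B \<in> carrier_mat c d \<Longrightarrow> adj (A * B) = adj B * adj A"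
  by (intro eq_matI) (auto simp: adj_def scalar_prod_def mult.commute)

lemma tr_mult_comm:
  assumes "A \<in> carrier_mat n m" "B \<in> carrier_mat m n"
  shows "tr (A * B) = tr (B * A)"
proof -
  have "tr (A * B) = (\<Sum>i<n. \<Sum>k<m. A $$ (i, k) * B $$ (k, i))"
    using assms by (auto simp: tr_def scalar_prod_def lessThan_atLeast0 intro!: sum.cong)
  also have "\<dots> = (\<Sum>k<m. \<Sum>i<n. B $$ (k, i) * A $$ (i, k))"
    by (subst sum.swap) (simp add: mult.commute)
  also have "\<dots> = tr (B * A)"
    using assms by (auto simp: tr_def scalar_prod_def lessThan_atLeast0 intro!: sum.cong)
  finally show ?thesis .
qed

lemma tr_add: "A \<in> M n \<Longrightarrow> B \<in> M n \<Longrightarrow> tr (A + B) = tr A + tr B"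
  by (simp add: tr_def sum.distrib)

lemma tr_adj: "A \<in> M n \<Longrightarrow> tr (adj A) = cnj (tr A)"
  by (simp add: tr_def adj_def)

lemma tr_smult: "A \<in> M n \<Longrightarrow> tr (c \<cdot>\<^sub>m A) = c * tr A"
  by (simp add: tr_def sum_distrib_left)

lemma tr_one [simp]: "tr (1\<^sub>m n) = of_nat n"
  by (simp add: tr_def)

lemma nrm2_eq_tr: "A \<in> carrier_mat r c \<Longrightarrow> of_real (nrm2 A) = tr (adj A * A)"
  by (auto simp: nrm2_def tr_def adj_def scalar_prod_def lessThan_atLeast0 complex_norm_square mult.commute
      sum.swap[of _ "{0..<r}" "{0..<c}"] simp del: of_real_power intro!: sum.cong)

lemma nrm2_smult: "nrm2 (c \<cdot>\<^sub>m A) = (cmod c)\<^sup>2 * nrm2 A"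
  by (simp add: nrm2_def norm_mult power_mult_distrib sum_distrib_left)

lemma nrm2_nonneg [simp]: "nrm2 A \<ge> 0"
  by (simp add: nrm2_def sum_nonneg)

lemma nrm2_zero: "A \<in> carrier_mat r c \<Longrightarrow> nrm2 A = 0 \<Longrightarrow> A = 0\<^sub>m r c"
  by (intro eq_matI) (auto simp: nrm2_def sum_nonneg_eq_0_iff sum_nonneg)

lemma nrm2_adj: "nrm2 (adj A) = nrm2 A"
  by (simp add: nrm2_def adj_def sum.swap[of _ "{..<dim_row A}"])

lemma nrm2_mult_le:
  assumes "A \<in> carrier_mat r m" "B \<in> carrier_mat m c"
  shows "nrm2 (A * B) \<le> nrm2 A * nrm2 B"
proof -
  have "(cmod ((A * B) $$ (i, j)))\<^sup>2 \<le> (\<Sum>k<m. (cmod (A $$ (i, k)))\<^sup>2) * (\<Sum>k<m. (cmod (B $$ (k, j)))\<^sup>2)"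
    if "i < r" "j < c" for i j
  proof -
    have "cmod ((A * B) $$ (i, j)) \<le> (\<Sum>k<m. cmod (A $$ (i, k)) * cmod (B $$ (k, j)))"
      using that assms by (auto simp: scalar_prod_def lessThan_atLeast0 norm_mult[symmetric] intro!: norm_sum)
    then have "(cmod ((A * B) $$ (i, j)))\<^sup>2 \<le> (\<Sum>k<m. cmod (A $$ (i, k)) * cmod (B $$ (k, j)))\<^sup>2"
      by (intro power_mono) auto
    also have "\<dots> \<le> (\<Sum>k<m. (cmod (A $$ (i, k)))\<^sup>2) * (\<Sum>k<m. (cmod (B $$ (k, j)))\<^sup>2)"
      by (rule Cauchy_Schwarz_ineq_sum)
    finally show ?thesis .
  qed
  then have "nrm2 (A * B) \<le> (\<Sum>i<r. \<Sum>j<c. (\<Sum>k<m. (cmod (A $$ (i, k)))\<^sup>2) * (\<Sum>k<m. (cmod (B $$ (k, j)))\<^sup>2))"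
    using assms by (auto simp: nrm2_def intro!: sum_mono)
  also have "\<dots> = nrm2 A * nrm2 B"
    using assms by (simp add: nrm2_def sum_product sum.swap[of "\<lambda>x y. (cmod (B $$ (x, y)))\<^sup>2" "{..<c}"])
  finally show ?thesis .
qed

lemma nrm2_add_le:
  assumes "A \<in> M n" "B \<in> M n"
  shows "nrm2 (A + B) \<le> 2 * nrm2 A + 2 * nrm2 B"
proof -
  have "(cmod (x + y))\<^sup>2 \<le> 2 * (cmod x)\<^sup>2 + 2 * (cmod y)\<^sup>2" for x y
  proof -
    have "(cmod (x + y))\<^sup>2 \<le> (cmod x + cmod y)\<^sup>2" by (intro power_mono norm_triangle_ineq) simp
    also have "\<dots> \<le> 2 * (cmod x)\<^sup>2 + 2 * (cmod y)\<^sup>2"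
      using zero_le_power2[of "cmod x - cmod y"] by (simp add: power2_eq_square algebra_simps)
    finally show ?thesis .
  qed
  then have "(\<Sum>i<n. \<Sum>j<n. (cmod (A $$ (i, j) + B $$ (i, j)))\<^sup>2)
      \<le> (\<Sum>i<n. \<Sum>j<n. 2 * (cmod (A $$ (i, j)))\<^sup>2 + 2 * (cmod (B $$ (i, j)))\<^sup>2)"
    by (intro sum_mono)
  then have "nrm2 (A + B) \<le> (\<Sum>i<n. \<Sum>j<n. 2 * (cmod (A $$ (i, j)))\<^sup>2 + 2 * (cmod (B $$ (i, j)))\<^sup>2)"
    using assms by (simp add: nrm2_def)
  then show ?thesis using assms by (simp add: nrm2_def sum.distrib sum_distrib_left)
qed

lemma eigen_in_spectrum:
  assumes "A \<in> M n" "W \<in> M n" "W \<noteq> 0\<^sub>m n n" "A * W = lam \<cdot>\<^sub>m W"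
  shows "lam \<in> spectrum A"
proof -
  obtain i j where ij: "i < n" "j < n" "W $$ (i, j) \<noteq> 0"
    using assms(2,3) by (metis carrier_matD eq_matI index_zero_mat)
  have "col W j \<noteq> 0\<^sub>v n" using ij assms(2) by (metis carrier_matD index_col index_zero_vec(1))
  moreover have "A *\<^sub>v col W j = lam \<cdot>\<^sub>v col W j"
  proof -
    have "A *\<^sub>v col W j = col (A * W) j"
      using assms(1,2) ij by (intro eq_vecI) auto
    also have "\<dots> = lam \<cdot>\<^sub>v col W j"
      unfolding assms(4) using assms(2) ij by (intro eq_vecI) auto
    finally show ?thesis .
  qed
  ultimately show ?thesis
    using assms ij unfolding spectrum_def eigenvalue_def eigenvector_def by (auto intro!: exI[of _ "col W j"])
qed

text \<open>
  After triangularization the trace of the square is the sum of the squares of the eigenvalues.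
\<close>

lemma real_spectrum_trace:
  assumes A: "A \<in> M n" and real: "spectrum A \<subseteq> \<real>"
  shows "Re (tr (A * A)) \<ge> 0"
proof -
  obtain es where "char_poly A = (\<Prod>a\<leftarrow>es. [:- a, 1:])" using char_poly_factorized[OF A] by blast
  then obtain B where B: "B \<in> M n" "upper_triangular B" "similar_mat A B"
    using schur_decomposition_exists[OF A] by blast
  obtain P Q where wit: "similar_mat_wit A B P Q" using B(3) unfolding similar_mat_def by blast
  have PQ: "P \<in> M n" "Q \<in> M n" "Q * P = 1\<^sub>m n" "A = P * B * Q"
    using wit A unfolding similar_mat_wit_def Let_def by auto
  have "A * A = P * B * (Q * P) * (B * Q)"
    using PQ(1,2) B(1) unfolding PQ(4) by (simp add: mat_assoc[where n = n])
  then have "A * A = P * (B * B * Q)" using PQ(1,2) B(1) by (simp add: PQ(3) mat_assoc[where n = n])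
  then have "tr (A * A) = tr (B * B * Q * P)" using PQ(1,2) B(1) by (simp add: tr_mult_comm[of P n n])
  also have "B * B * Q * P = B * B" using PQ(1-3) B(1) by (simp add: mat_assoc[where n = n])
  finally have "tr (A * A) = (\<Sum>i<n. (B * B) $$ (i, i))" using B(1) by (simp add: tr_def)
  also have "\<dots> = (\<Sum>i<n. (B $$ (i, i))\<^sup>2)"
  proof (intro sum.cong refl)
    fix i assume i: "i \<in> {..<n}"
    have "(B * B) $$ (i, i) = (\<Sum>k<n. B $$ (i, k) * B $$ (k, i))" using i B(1) mat_mult_entry[of B n B i i] by simp
    also have "\<dots> = (\<Sum>k<n. if k = i then (B $$ (i, i))\<^sup>2 else 0)"
    proof (intro sum.cong refl)
      fix k assume "k \<in> {..<n}"
      then show "B $$ (i, k) * B $$ (k, i) = (if k = i then (B $$ (i, i))\<^sup>2 else 0)"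
        using i B(1) upper_triangularD[OF B(2), of k i] upper_triangularD[OF B(2), of i k]
        by (cases "k < i"; cases "i < k") (auto simp: power2_eq_square)
    qed
    finally show "(B * B) $$ (i, i) = (B $$ (i, i))\<^sup>2" using i by simp
  qed
  finally have t: "tr (A * A) = (\<Sum>i<n. (B $$ (i, i))\<^sup>2)" .
  have "Re ((B $$ (i, i))\<^sup>2) \<ge> 0" if i: "i < n" for i
  proof -
    have "poly (char_poly A) (B $$ (i, i)) = 0"
      unfolding char_poly_similar[OF B(3)] char_poly_upper_triangular[OF B(1,2)]
      using i B(1) by (auto simp: poly_prod_list prod_list_zero_iff diag_mat_def)
    then have "B $$ (i, i) \<in> spectrum A"
      using A by (simp add: spectrum_def eigenvalue_root_char_poly)
    then obtain r where "B $$ (i, i) = of_real r" using real by (auto simp: Reals_def)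
    then show ?thesis by simp
  qed
  then show ?thesis unfolding t by (auto intro: sum_nonneg)
qed

text \<open>
  For a skew-hermitian matrix the squared norm is the negative of the trace of the square.
\<close>

lemma skew_real_spectrum_zero:
  assumes A: "A \<in> M n" and skew: "adj A = (-1) \<cdot>\<^sub>m A" and real: "spectrum A \<subseteq> \<real>"
  shows "A = 0\<^sub>m n n"
proof -
  have "of_real (nrm2 A) = - tr (A * A)"
    using nrm2_eq_tr[OF A] A by (simp add: skew mat_smult[where n = n] tr_smult[of _ n])
  then have "nrm2 A = - Re (tr (A * A))" by (metis Re_complex_of_real uminus_complex.sel(1))
  with real_spectrum_trace[OF A real] nrm2_nonneg[of A] have "nrm2 A = 0" by linarith
  then show ?thesis using nrm2_zero[OF A] by simp
qed

definition unitary_mat :: "nat \<Rightarrow> complex mat \<Rightarrow> bool" where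
  "unitary_mat n U \<longleftrightarrow> U \<in> M n \<and> adj U * U = 1\<^sub>m n"

lemma unitary_matD:
  assumes "unitary_mat n U"
  shows "U \<in> M n" "adj U \<in> M n" "adj U * U = 1\<^sub>m n" "U * adj U = 1\<^sub>m n"
  using assms mat_mult_left_right_inverse[of "adj U" n U] by (auto simp: unitary_mat_def)

lemma nrm2_unitary_left:
  assumes "unitary_mat n U" "A \<in> carrier_mat n c"
  shows "nrm2 (U * A) = nrm2 A"
proof -
  note U = unitary_matD[OF assms(1)]
  have aA: "adj A \<in> carrier_mat c n" using assms(2) by simp
  have "adj A * adj U * (U * A) = adj A * ((adj U * U) * A)"
    using U(1,2) assms(2) aA
    by (simp add: assoc_mult_mat[of _ c n _ n _ c] assoc_mult_mat[of _ n n _ n _ c])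
  also have "\<dots> = adj A * A" using assms(2) by (simp add: U(3))
  finally have "complex_of_real (nrm2 (U * A)) = of_real (nrm2 A)"
    using nrm2_eq_tr[of "U * A" n c] nrm2_eq_tr[OF assms(2)] U(1) assms(2)
    by (simp add: adj_mult[of _ n n _ c])
  then show ?thesis by simp
qed

lemma nrm2_unitary_right:
  assumes "unitary_mat n U" "A \<in> M n"
  shows "nrm2 (A * U) = nrm2 A"
proof -
  note U = unitary_matD[OF assms(1)]
  have "unitary_mat n (adj U)" using U by (simp add: unitary_mat_def)
  then have "nrm2 (adj U * adj A) = nrm2 (adj A)" using assms(2) by (intro nrm2_unitary_left[of n _ _ n]) auto
  then show ?thesis using U(1) assms(2) by (simp add: adj_mult[of _ n n _ n, symmetric] nrm2_adj)
qed

text \<open>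
  Put \<open>Y = C - 1\<close>, let \<open>Y'\<close> be its conjugate and \<open>\<Delta> = Y - Y'\<close>. Unitarity of \<open>C\<close> and of
  its conjugate turns \<open>\<Delta> + \<Delta>\<^sup>*\<close> into \<open>- (\<Delta> Y\<^sup>* + Y' \<Delta>\<^sup>*)\<close>, which is small
  compared to \<open>\<Delta>\<close>. But the squared norm of \<open>\<Delta> + \<Delta>\<^sup>*\<close> is twice that of \<open>\<Delta>\<close>
  plus twice the real part of the trace of \<open>\<Delta>\<^sup>2\<close>, and the latter is nonnegative.
\<close>

lemma near_one_conjugate_eq:
  assumes C: "unitary_mat n C" and A: "unitary_mat n A"
    and real: "spectrum (C - adj A * C * A) \<subseteq> \<real>"
    and near: "nrm2 (C - 1\<^sub>m n) < 1/2"
  shows "adj A * C * A = C"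
proof -
  note CU = unitary_matD[OF C] and AU = unitary_matD[OF A]
  define Y where "Y = C - 1\<^sub>m n"
  define Y' where "Y' = adj A * Y * A"
  define C' where "C' = adj A * C * A"
  define \<Delta> where "\<Delta> = C - C'"
  have car [simp]: "Y \<in> M n" "Y' \<in> M n" "C' \<in> M n" "\<Delta> \<in> M n" "C \<in> M n" "A \<in> M n" "adj A \<in> M n" "adj C \<in> M n"
    using CU AU by (auto simp: Y_def Y'_def C'_def \<Delta>_def)
  have Y': "Y' = C' - 1\<^sub>m n"
    unfolding Y'_def Y_def C'_def by (simp add: mat_distrib[where n = n] AU(3))
  have C'u: "unitary_mat n C'"
  proof -
    have "adj C' * C' = adj A * adj C * (A * adj A) * C * A"
      by (simp add: C'_def adj_mult[of _ n n _ n] mat_assoc[where n = n])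
    also have "\<dots> = adj A * (adj C * C) * A" by (simp add: AU(4) mat_assoc[where n = n])
    finally show ?thesis by (simp add: unitary_mat_def CU(3) AU(3))
  qed
  have unit: "U - 1\<^sub>m n + adj (U - 1\<^sub>m n) + (U - 1\<^sub>m n) * adj (U - 1\<^sub>m n) = 0\<^sub>m n n" if "unitary_mat n U" for U
  proof -
    note U = unitary_matD[OF that]
    have "(U - 1\<^sub>m n) * (adj U - 1\<^sub>m n) = U * adj U - U - adj U + 1\<^sub>m n"
      using U(1,2) by (simp add: mat_distrib[where n = n]) (rule mat_eqI[where n = n]; simp add: mat_idx[where n = n] del: index_mult_mat(1))
    then show ?thesis using U(1,2) by (simp add: adj_minus[of _ n] U(4)) (rule mat_eqI[where n = n]; simp add: mat_idx[where n = n] del: index_mult_mat(1))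
  qed
  have "\<Delta> = Y - Y'" unfolding \<Delta>_def Y' Y_def by (rule mat_eqI[where n = n]; simp add: mat_idx[where n = n] del: index_mult_mat(1))
  have ex: "\<Delta> * adj Y + Y' * adj \<Delta> = Y * adj Y - Y' * adj Y'"
    unfolding \<open>\<Delta> = Y - Y'\<close> by (simp add: adj_minus[of _ n] mat_distrib[where n = n]) (rule mat_eqI[where n = n]; simp add: mat_idx[where n = n] del: index_mult_mat(1))
  have u1: "Y + adj Y + Y * adj Y = 0\<^sub>m n n" and u2: "Y' + adj Y' + Y' * adj Y' = 0\<^sub>m n n"
    using unit[OF C] unit[OF C'u] unfolding Y_def Y' by auto
  have sum0: "\<Delta> + adj \<Delta> + (\<Delta> * adj Y + Y' * adj \<Delta>) = 0\<^sub>m n n"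
  proof (rule mat_eqI)
    fix i j assume ij: "i < n" "j < n"
    have "(Y + adj Y + Y * adj Y) $$ (i, j) = 0" "(Y' + adj Y' + Y' * adj Y') $$ (i, j) = 0"
      using ij by (simp_all add: u1 u2)
    moreover have "(\<Delta> + adj \<Delta> + (Y * adj Y - Y' * adj Y')) $$ (i, j) =
       (Y + adj Y + Y * adj Y) $$ (i, j) - (Y' + adj Y' + Y' * adj Y') $$ (i, j)"
      using ij unfolding \<open>\<Delta> = Y - Y'\<close> by (simp add: adj_minus[of _ n] mat_idx[where n = n] del: index_mult_mat(1))
    ultimately show "(\<Delta> + adj \<Delta> + (\<Delta> * adj Y + Y' * adj \<Delta>)) $$ (i, j) = 0\<^sub>m n n $$ (i, j)"
      unfolding ex using ij by simp
  qed simp_all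
  have "nrm2 (\<Delta> + adj \<Delta>) = nrm2 (\<Delta> * adj Y + Y' * adj \<Delta>)"
  proof -
    have "\<Delta> + adj \<Delta> = (-1) \<cdot>\<^sub>m (\<Delta> * adj Y + Y' * adj \<Delta>)"
    proof (rule mat_eqI[where n = n])
      fix i j assume ij: "i < n" "j < n"
      have "(\<Delta> + adj \<Delta> + (\<Delta> * adj Y + Y' * adj \<Delta>)) $$ (i, j) = 0" using ij by (simp add: sum0)
      then show "(\<Delta> + adj \<Delta>) $$ (i, j) = ((-1) \<cdot>\<^sub>m (\<Delta> * adj Y + Y' * adj \<Delta>)) $$ (i, j)"
        using ij by (simp add: mat_idx[where n = n] smult_idx[where n = n] eq_neg_iff_add_eq_0 add.assoc
            del: index_mult_mat(1) minus_add_distrib)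
    qed simp_all
    then show ?thesis by (simp only: nrm2_smult) simp
  qed
  also have "\<dots> \<le> 2 * nrm2 (\<Delta> * adj Y) + 2 * nrm2 (Y' * adj \<Delta>)"
    by (rule nrm2_add_le[of _ n]) simp_all
  also have "\<dots> \<le> 2 * (nrm2 \<Delta> * nrm2 Y) + 2 * (nrm2 Y' * nrm2 \<Delta>)"
    using nrm2_mult_le[of \<Delta> n n "adj Y" n] nrm2_mult_le[of Y' n n "adj \<Delta>" n] by (simp add: nrm2_adj)
  also have "nrm2 Y' = nrm2 Y"
    unfolding Y'_def using A nrm2_unitary_left[of n "adj A" "Y * A" n] AU nrm2_unitary_right[OF A, of Y]
    by (simp add: unitary_mat_def mat_assoc[where n = n])
  finally have up: "nrm2 (\<Delta> + adj \<Delta>) \<le> 4 * nrm2 Y * nrm2 \<Delta>" by simp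
  have "complex_of_real (nrm2 (\<Delta> + adj \<Delta>)) = tr ((adj \<Delta> + \<Delta>) * (\<Delta> + adj \<Delta>))"
    using nrm2_eq_tr[of "\<Delta> + adj \<Delta>" n n] by (simp add: adj_add[of _ n])
  also have "(adj \<Delta> + \<Delta>) * (\<Delta> + adj \<Delta>) = (adj \<Delta> * \<Delta> + \<Delta> * adj \<Delta>) + (\<Delta> * \<Delta> + adj (\<Delta> * \<Delta>))"
    by (simp add: mat_distrib[where n = n] adj_mult[of _ n n _ n]) (rule mat_eqI[where n = n]; simp add: mat_idx[where n = n] del: index_mult_mat(1))
  also have "tr \<dots> = of_real (nrm2 \<Delta>) + of_real (nrm2 \<Delta>) + (tr (\<Delta> * \<Delta>) + cnj (tr (\<Delta> * \<Delta>)))"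
    using nrm2_eq_tr[of \<Delta> n n] nrm2_eq_tr[of "adj \<Delta>" n n]
    by (simp add: tr_add[of _ n] tr_adj[of _ n] nrm2_adj)
  finally have "nrm2 (\<Delta> + adj \<Delta>) = 2 * nrm2 \<Delta> + 2 * Re (tr (\<Delta> * \<Delta>))"
    by (simp add: complex_eq_iff)
  moreover have "Re (tr (\<Delta> * \<Delta>)) \<ge> 0"
    using real_spectrum_trace[of \<Delta> n] real by (simp add: \<Delta>_def C'_def)
  ultimately have "2 * nrm2 \<Delta> \<le> 4 * nrm2 Y * nrm2 \<Delta>" using up by linarith
  then have "nrm2 \<Delta> * (1 - 2 * nrm2 Y) \<le> 0" by (simp add: algebra_simps)
  moreover have "1 - 2 * nrm2 Y > 0" using near by (simp add: Y_def)
  ultimately have "nrm2 \<Delta> = 0" using mult_pos_pos[of "nrm2 \<Delta>" "1 - 2 * nrm2 Y"] nrm2_nonneg[of \<Delta>] by linarith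
  then have z: "\<Delta> = 0\<^sub>m n n" using nrm2_zero[of \<Delta> n n] by simp
  have "C' = C"
  proof (rule mat_eqI)
    fix i j assume ij: "i < n" "j < n"
    have "\<Delta> $$ (i, j) = C $$ (i, j) - C' $$ (i, j)" unfolding \<Delta>_def using ij car(3,5) by (simp del: car)
    then show "C' $$ (i, j) = C $$ (i, j)" using ij by (simp add: z)
  qed simp_all
  then show ?thesis by (simp add: C'_def)
qed

lemma pow_M [simp]: "A \<in> M n \<Longrightarrow> A ^\<^sub>m k \<in> M n"
  by (rule pow_carrier_mat)

lemma pow_mat_commute:
  assumes "A \<in> M n" "B \<in> M n" "A * B = B * A"
  shows "A ^\<^sub>m k * B = B * A ^\<^sub>m k"
proof (induction k)
  case 0
  show ?case using assms by simp
next
  case (Suc k)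
  have "A ^\<^sub>m Suc k * B = A ^\<^sub>m k * (A * B)" using assms(1,2) by (simp add: mat_assoc[where n = n])
  also have "\<dots> = (A ^\<^sub>m k * B) * A"
    unfolding assms(3) using assms(1,2) by (simp add: mat_assoc[where n = n])
  finally show ?case unfolding Suc using assms(1,2) by (simp add: mat_assoc[where n = n])
qed

text \<open>
  The matrices \<open>Q = (\<Sum>k<r. \<lambda>\<^sup>-\<^sup>k A\<^sup>k)\<close> for the \<open>r\<close>-th roots of unity \<open>\<lambda>\<close> map into
  eigenspaces of \<open>A\<close> and add up to \<open>r\<close> times the identity, so \<open>X\<close> does not annihilate all of them.
  As polynomials in \<open>A\<close> they commute with everything that commutes with \<open>A\<close>.
\<close>

lemma finite_order_eigenprojection:
  assumes A: "A \<in> M n" and r: "r > 0" "A ^\<^sub>m r = 1\<^sub>m n" and X: "X \<in> M n" "X \<noteq> 0\<^sub>m n n"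
  obtains Q lam where "Q \<in> M n" "lam ^ r = (1::complex)" "A * Q = lam \<cdot>\<^sub>m Q" "X * Q \<noteq> 0\<^sub>m n n"
    "\<And>B. B \<in> M n \<Longrightarrow> A * B = B * A \<Longrightarrow> B * Q = Q * B"
proof -
  define z where "z k = cis (2 * pi * real k / real r)" for k
  have bij: "bij_betw z {..<r} {w. w ^ r = 1}"
    using bij_betw_roots_unity[of r] r by (simp add: z_def[abs_def])
  have zr: "z k ^ r = 1" if "k < r" for k using bij that by (auto simp: bij_betw_def)
  have z0: "z k \<noteq> 0" for k by (simp add: z_def)
  have zne: "z k \<noteq> 1" if "0 < k" "k < r" for k
  proof
    assume "z k = 1"
    then have "z k = z 0" by (simp add: z_def)
    moreover have "inj_on z {..<r}" using bij by (simp add: bij_betw_def)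
    ultimately have "k = 0" using that r inj_onD[of z "{..<r}" k 0] by auto
    with that show False by simp
  qed
  have zsym: "z j ^ k = z k ^ j" for j k
    by (simp add: z_def Complex.DeMoivre mult.commute mult.left_commute)
  define Q where "Q j = mat n n (\<lambda>(a, b). \<Sum>k<r. inverse (z j) ^ k * (A ^\<^sub>m k) $$ (a, b))" for j
  have Qc: "Q j \<in> M n" for j by (simp add: Q_def)
  have AQ: "A * Q j = z j \<cdot>\<^sub>m Q j" if j: "j < r" for j
  proof (rule mat_eqI[where n = n])
    fix a b assume ab: "a < n" "b < n"
    define f where "f k = inverse (z j) ^ k * (A ^\<^sub>m k) $$ (a, b)" for k
    have "(A * Q j) $$ (a, b) = (\<Sum>c<n. A $$ (a, c) * (\<Sum>k<r. inverse (z j) ^ k * (A ^\<^sub>m k) $$ (c, b)))"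
      using mat_mult_entry[OF A Qc ab] ab by (simp add: Q_def)
    also have "\<dots> = (\<Sum>k<r. inverse (z j) ^ k * (\<Sum>c<n. A $$ (a, c) * (A ^\<^sub>m k) $$ (c, b)))"
      by (simp add: sum_distrib_left sum.swap[of _ "{..<n}"] mult.left_commute)
    also have "\<dots> = (\<Sum>k<r. z j * f (Suc k))"
    proof (intro sum.cong refl)
      fix k
      have "(\<Sum>c<n. A $$ (a, c) * (A ^\<^sub>m k) $$ (c, b)) = (A * A ^\<^sub>m k) $$ (a, b)"
        using mat_mult_entry[of A n "A ^\<^sub>m k" a b] A ab by simp
      also have "A * A ^\<^sub>m k = A ^\<^sub>m Suc k" using pow_mat_commute[OF A A, of k] by simp
      finally show "inverse (z j) ^ k * (\<Sum>c<n. A $$ (a, c) * (A ^\<^sub>m k) $$ (c, b)) = z j * f (Suc k)"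
        using z0 by (simp add: f_def field_simps)
    qed
    also have "\<dots> = z j * (\<Sum>k<r. f (Suc k))" by (simp add: sum_distrib_left)
    also have "(\<Sum>k<r. f (Suc k)) = (\<Sum>k<r. f k)"
    proof -
      have "f r = f 0" using r zr[OF j] A by (simp add: f_def power_inverse)
      then show ?thesis using sum.lessThan_Suc_shift[of f r] by simp
    qed
    finally show "(A * Q j) $$ (a, b) = (z j \<cdot>\<^sub>m Q j) $$ (a, b)"
      using ab by (simp add: Q_def f_def)
  qed (use A Qc in auto)
  have comm: "B * Q j = Q j * B" if B: "B \<in> M n" "A * B = B * A" for B j
  proof (rule mat_eqI[where n = n])
    fix a b assume ab: "a < n" "b < n"
    have "(B * Q j) $$ (a, b) = (\<Sum>c<n. B $$ (a, c) * (\<Sum>k<r. inverse (z j) ^ k * (A ^\<^sub>m k) $$ (c, b)))"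
      using mat_mult_entry[OF B(1) Qc ab] ab by (simp add: Q_def)
    also have "\<dots> = (\<Sum>k<r. inverse (z j) ^ k * (\<Sum>c<n. B $$ (a, c) * (A ^\<^sub>m k) $$ (c, b)))"
      by (simp add: sum_distrib_left sum.swap[of _ "{..<n}"] mult.left_commute)
    also have "\<dots> = (\<Sum>k<r. inverse (z j) ^ k * (B * A ^\<^sub>m k) $$ (a, b))"
      using mat_mult_entry[OF B(1) pow_M[OF A] ab] by simp
    also have "\<dots> = (\<Sum>k<r. inverse (z j) ^ k * (A ^\<^sub>m k * B) $$ (a, b))"
      using pow_mat_commute[OF A B] by simp
    also have "\<dots> = (\<Sum>k<r. inverse (z j) ^ k * (\<Sum>c<n. (A ^\<^sub>m k) $$ (a, c) * B $$ (c, b)))"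
      using mat_mult_entry[OF pow_M[OF A] B(1) ab] by simp
    also have "\<dots> = (\<Sum>c<n. (\<Sum>k<r. inverse (z j) ^ k * (A ^\<^sub>m k) $$ (a, c)) * B $$ (c, b))"
      by (simp add: sum_distrib_left sum_distrib_right sum.swap[of _ "{..<n}"] mult.assoc)
    also have "\<dots> = (Q j * B) $$ (a, b)"
      using mat_mult_entry[OF Qc B(1) ab] ab by (simp add: Q_def)
    finally show "(B * Q j) $$ (a, b) = (Q j * B) $$ (a, b)" .
  qed (use B Qc in auto)
  have sumQ: "(\<Sum>j<r. Q j $$ (a, b)) = of_nat r * 1\<^sub>m n $$ (a, b)" if ab: "a < n" "b < n" for a b
  proof -
    have "(\<Sum>j<r. Q j $$ (a, b)) = (\<Sum>k<r. (\<Sum>j<r. inverse (z j) ^ k) * (A ^\<^sub>m k) $$ (a, b))"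
      using ab by (simp add: Q_def sum_distrib_right) (rule sum.swap)
    also have "\<dots> = (\<Sum>k<r. if k = 0 then of_nat r * 1\<^sub>m n $$ (a, b) else 0)"
    proof (intro sum.cong refl)
      fix k assume k: "k \<in> {..<r}"
      have "(\<Sum>j<r. inverse (z j) ^ k) = (\<Sum>j<r. inverse (z k) ^ j)"
        by (simp add: power_inverse zsym)
      moreover have "(\<Sum>j<r. inverse (z k) ^ j) = 0" if "k \<noteq> 0"
        using zne[of k] that k zr[of k] sum_gp_strict[of "inverse (z k)" r] by (simp add: power_inverse)
      ultimately show "(\<Sum>j<r. inverse (z j) ^ k) * (A ^\<^sub>m k) $$ (a, b) = (if k = 0 then of_nat r * 1\<^sub>m n $$ (a, b) else 0)"
        using A by auto
    qed
    finally show ?thesis using r by simp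
  qed
  have "\<exists>j<r. X * Q j \<noteq> 0\<^sub>m n n"
  proof (rule ccontr)
    assume "\<not> (\<exists>j<r. X * Q j \<noteq> 0\<^sub>m n n)"
    then have zero: "X * Q j = 0\<^sub>m n n" if "j < r" for j using that by blast
    have "X = 0\<^sub>m n n"
    proof (rule mat_eqI[where n = n])
      fix a b assume ab: "a < n" "b < n"
      have "0 = (\<Sum>j<r. (X * Q j) $$ (a, b))" using zero ab by simp
      also have "\<dots> = (\<Sum>j<r. \<Sum>c<n. X $$ (a, c) * Q j $$ (c, b))"
        using mat_mult_entry[OF X(1) Qc ab] by simp
      also have "\<dots> = (\<Sum>c<n. X $$ (a, c) * (\<Sum>j<r. Q j $$ (c, b)))"
        by (simp add: sum_distrib_left sum.swap[of _ "{..<r}" "{..<n}"])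
      also have "\<dots> = (\<Sum>c<n. X $$ (a, c) * (of_nat r * 1\<^sub>m n $$ (c, b)))"
        using sumQ ab by simp
      also have "\<dots> = (\<Sum>c<n. if c = b then X $$ (a, b) * of_nat r else 0)"
        using ab by (intro sum.cong) auto
      finally show "X $$ (a, b) = 0\<^sub>m n n $$ (a, b)" using r ab by simp
    qed (use X in auto)
    with X show False by simp
  qed
  then obtain j where "j < r" "X * Q j \<noteq> 0\<^sub>m n n" by blast
  then show ?thesis using that[of "Q j" "z j"] Qc zr AQ comm by blast
qed

lemma subspace_vecI:
  fixes W :: "complex vec set"
  assumes "W \<subseteq> carrier_vec n" "0\<^sub>v n \<in> W" "\<And>v w. v \<in> W \<Longrightarrow> w \<in> W \<Longrightarrow> v + w \<in> W"
    "\<And>c v. v \<in> W \<Longrightarrow> c \<cdot>\<^sub>v v \<in> W"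
  shows "VectorSpace.subspace class_ring W (module_vec TYPE(complex) n)"
proof -
  interpret V: vec_space "TYPE(complex)" n .
  show ?thesis
    unfolding VectorSpace.subspace_def submodule_def
    using assms V.module_axioms V.vectorspace_axioms by (auto simp: module_vec_simps)
qed

lemma subspace_vecD:
  fixes W :: "complex vec set"
  assumes "VectorSpace.subspace class_ring W (module_vec TYPE(complex) n)"
  shows "W \<subseteq> carrier_vec n" "0\<^sub>v n \<in> W" "\<And>v w. v \<in> W \<Longrightarrow> w \<in> W \<Longrightarrow> v + w \<in> W"
    "\<And>c v. v \<in> W \<Longrightarrow> c \<cdot>\<^sub>v v \<in> W"
  using assms unfolding VectorSpace.subspace_def submodule_def by (auto simp: module_vec_simps)

lemma irreducible_invariant:
  assumes irr: "irreducible_mats n S"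
    and W: "W \<subseteq> carrier_vec n" "0\<^sub>v n \<in> W" "\<And>v w. v \<in> W \<Longrightarrow> w \<in> W \<Longrightarrow> v + w \<in> W"
      "\<And>c v. v \<in> W \<Longrightarrow> c \<cdot>\<^sub>v v \<in> W"
    and inv: "\<And>A v. A \<in> S \<Longrightarrow> v \<in> W \<Longrightarrow> A *\<^sub>v v \<in> W"
    and nz: "u \<in> W" "u \<noteq> 0\<^sub>v n"
  shows "W = carrier_vec n"
  using irr subspace_vecI[OF W] inv nz unfolding irreducible_mats_def by blast

lemma mat_eq_smult_one:
  fixes Y :: "complex mat"
  assumes "Y \<in> M n" "\<And>v. v \<in> carrier_vec n \<Longrightarrow> Y *\<^sub>v v = c \<cdot>\<^sub>v v"
  shows "Y = c \<cdot>\<^sub>m 1\<^sub>m n"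
proof (rule mat_eqI[where n = n])
  fix i j assume ij: "i < n" "j < n"
  have "(Y *\<^sub>v unit_vec n j) $ i = Y $$ (i, j)" using ij assms(1) by (simp add: scalar_prod_right_unit)
  moreover have "(Y *\<^sub>v unit_vec n j) $ i = (c \<cdot>\<^sub>v unit_vec n j) $ i" using assms(2)[of "unit_vec n j"] by simp
  ultimately show "Y $$ (i, j) = (c \<cdot>\<^sub>m 1\<^sub>m n) $$ (i, j)" using ij by auto
qed (use assms in auto)

text \<open>
  Schur's lemma: an eigenspace of \<open>Y\<close> is invariant under everything that commutes with \<open>Y\<close>.
\<close>

theorem irreducible_commute_scalar:
  assumes n: "n > 0" and irr: "irreducible_mats n S" and S: "S \<subseteq> M n"
    and Y: "Y \<in> M n" and comm: "\<And>A. A \<in> S \<Longrightarrow> A * Y = Y * A"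
  obtains c where "Y = c \<cdot>\<^sub>m 1\<^sub>m n"
proof -
  obtain c where "c \<in> spectrum Y" using spectrum_non_empty[OF Y] n by auto
  then obtain u where u: "u \<in> carrier_vec n" "u \<noteq> 0\<^sub>v n" "Y *\<^sub>v u = c \<cdot>\<^sub>v u"
    using Y by (auto simp: spectrum_def eigenvalue_def eigenvector_def)
  define W where "W = {v \<in> carrier_vec n. Y *\<^sub>v v = c \<cdot>\<^sub>v v}"
  have "W = carrier_vec n"
  proof (rule irreducible_invariant[OF irr])
    show "W \<subseteq> carrier_vec n" "u \<in> W" "u \<noteq> 0\<^sub>v n" using u by (auto simp: W_def)
    show "0\<^sub>v n \<in> W" using Y by (auto simp: W_def)
    show "v + w \<in> W" if "v \<in> W" "w \<in> W" for v w
      using that Y by (auto simp: W_def mult_add_distrib_mat_vec[of Y n n] smult_add_distrib_vec[of _ n])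
    show "a \<cdot>\<^sub>v v \<in> W" if "v \<in> W" for a v
      using that Y by (auto simp: W_def mult_mat_vec[of Y n n] smult_smult_assoc mult.commute)
    show "A *\<^sub>v v \<in> W" if A: "A \<in> S" and v: "v \<in> W" for A v
    proof -
      have AM: "A \<in> M n" using A S by blast
      have vc: "v \<in> carrier_vec n" "Y *\<^sub>v v = c \<cdot>\<^sub>v v" using v by (auto simp: W_def)
      have "Y *\<^sub>v (A *\<^sub>v v) = (Y * A) *\<^sub>v v" using AM Y vc by simp
      also have "\<dots> = A *\<^sub>v (Y *\<^sub>v v)" unfolding comm[OF A, symmetric] using AM Y vc by simp
      also have "\<dots> = c \<cdot>\<^sub>v (A *\<^sub>v v)" unfolding vc(2) using AM vc by (simp add: mult_mat_vec[of A n n])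
      finally show ?thesis using AM vc by (simp add: W_def)
    qed
  qed
  then have "Y = c \<cdot>\<^sub>m 1\<^sub>m n" using Y by (intro mat_eq_smult_one) (auto simp: W_def)
  then show ?thesis by (rule that)
qed

theorem irreducible_not_commutative:
  assumes n: "n > 1" and irr: "irreducible_mats n S" and S: "S \<subseteq> M n"
    and comm: "\<And>A B. A \<in> S \<Longrightarrow> B \<in> S \<Longrightarrow> A * B = B * A"
  shows False
proof -
  define W where "W = {v \<in> carrier_vec n. v $ 1 = (0::complex)}"
  have "W = carrier_vec n"
  proof (rule irreducible_invariant[OF irr])
    show "W \<subseteq> carrier_vec n" "0\<^sub>v n \<in> W" "unit_vec n 0 \<in> W" "unit_vec n 0 \<noteq> 0\<^sub>v n"
      using n by (auto simp: W_def unit_vec_def dest: arg_cong[of _ _ "\<lambda>v. v $ 0"])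
    show "v + w \<in> W" if "v \<in> W" "w \<in> W" for v w using that n by (auto simp: W_def)
    show "a \<cdot>\<^sub>v v \<in> W" if "v \<in> W" for a v using that n by (auto simp: W_def)
    show "A *\<^sub>v v \<in> W" if A: "A \<in> S" and v: "v \<in> W" for A v
    proof -
      have "A \<in> M n" using A S by blast
      then obtain c where "A = c \<cdot>\<^sub>m 1\<^sub>m n"
        using irreducible_commute_scalar[OF _ irr S, of A] comm A n by auto
      then have "A *\<^sub>v v = c \<cdot>\<^sub>v v" using v by (intro eq_vecI) (auto simp: W_def)
      then show ?thesis using v n by (auto simp: W_def)
    qed
  qed
  moreover have "unit_vec n 1 \<notin> W" using n by (auto simp: W_def)
  ultimately show False by auto
qed

lemma mult_zero_vec [simp]: "Q \<in> M n \<Longrightarrow> Q *\<^sub>v 0\<^sub>v n = 0\<^sub>v n"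
  by (intro eq_vecI) auto

lemma irreducible_conjugate:
  assumes irr: "irreducible_mats n S" and S: "S \<subseteq> M n"
    and P: "P \<in> M n" "Q \<in> M n" "P * Q = 1\<^sub>m n" "Q * P = 1\<^sub>m n"
  shows "irreducible_mats n ((\<lambda>A. Q * A * P) ` S)"
  unfolding irreducible_mats_def
proof (intro allI impI, elim conjE)
  fix W assume sub: "VectorSpace.subspace class_ring W (module_vec TYPE(complex) n)"
    and inv: "\<forall>A\<in>(\<lambda>A. Q * A * P) ` S. \<forall>v\<in>W. A *\<^sub>v v \<in> W"
  note W = subspace_vecD[OF sub]
  define V where "V = {v \<in> carrier_vec n. Q *\<^sub>v v \<in> W}"
  have lift_back: "P *\<^sub>v w \<in> V" if "w \<in> W" for w
  proof -
    have w: "w \<in> carrier_vec n" using that W by blast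
    have "Q *\<^sub>v (P *\<^sub>v w) = (Q * P) *\<^sub>v w" using w P(1,2) by simp
    also have "\<dots> = w" using w by (simp add: P(4))
    finally show ?thesis using that P w by (simp add: V_def)
  qed
  show "W = {0\<^sub>v n} \<or> W = carrier_vec n"
  proof (cases "\<exists>u\<in>W. u \<noteq> 0\<^sub>v n")
    case False
    then show ?thesis using W(2) by blast
  next
    case True
    then obtain u where u: "u \<in> W" "u \<noteq> 0\<^sub>v n" by blast
    have uc: "u \<in> carrier_vec n" using u W by blast
    have "V = carrier_vec n"
    proof (rule irreducible_invariant[OF irr])
      show "V \<subseteq> carrier_vec n" by (auto simp: V_def)
      show "0\<^sub>v n \<in> V" using W(2) P(2) by (auto simp: V_def)
      show "v + w \<in> V" if "v \<in> V" "w \<in> V" for v w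
        using that W(3) P(2) by (auto simp: V_def mult_add_distrib_mat_vec[of Q n n])
      show "a \<cdot>\<^sub>v v \<in> V" if "v \<in> V" for a v
        using that W(4) P(2) by (auto simp: V_def mult_mat_vec[of Q n n])
      show "P *\<^sub>v u \<in> V" by (rule lift_back[OF u(1)])
      show "P *\<^sub>v u \<noteq> 0\<^sub>v n"
      proof
        assume e: "P *\<^sub>v u = 0\<^sub>v n"
        have "u = (Q * P) *\<^sub>v u" using uc by (simp add: P(4))
        also have "\<dots> = Q *\<^sub>v (P *\<^sub>v u)" using uc P(1,2) by simp
        also have "\<dots> = 0\<^sub>v n" unfolding e using P(2) by auto
        finally show False using u by simp
      qed
      show "A *\<^sub>v v \<in> V" if A: "A \<in> S" and v: "v \<in> V" for A v
      proof -
        have AM: "A \<in> M n" using A S by blast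
        have vc: "v \<in> carrier_vec n" "Q *\<^sub>v v \<in> W" using v by (auto simp: V_def)
        have "Q *\<^sub>v (A *\<^sub>v v) = Q *\<^sub>v (A *\<^sub>v ((P * Q) *\<^sub>v v))" using vc by (simp add: P(3))
        also have "\<dots> = (Q * A * P) *\<^sub>v (Q *\<^sub>v v)"
          using vc(1) AM P(1,2) by (simp add: assoc_mult_mat_vec[of _ n n _ n])
        also have "\<dots> \<in> W" using bspec[OF bspec[OF inv imageI[OF A]] vc(2)] .
        finally show ?thesis using vc AM by (simp add: V_def)
      qed
    qed
    have "w \<in> W" if w: "w \<in> carrier_vec n" for w
    proof -
      have "P *\<^sub>v w \<in> V" using w P(1) \<open>V = carrier_vec n\<close> by simp
      then have "Q *\<^sub>v (P *\<^sub>v w) \<in> W" by (simp add: V_def)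
      moreover have "Q *\<^sub>v (P *\<^sub>v w) = (Q * P) *\<^sub>v w" using w P(1,2) by simp
      ultimately show ?thesis using w by (simp add: P(4))
    qed
    then show ?thesis using W(1) by blast
  qed
qed

section \<open>Bounded groups of matrices are unitarizable\<close>

text \<open>
  Splitting off the last variable by completing the square leaves the Schur complement, which is
  again positive definite.
\<close>

lemma cholesky:
  fixes H :: "nat \<Rightarrow> nat \<Rightarrow> complex"
  assumes herm: "\<And>i j. i < n \<Longrightarrow> j < n \<Longrightarrow> H j i = cnj (H i j)"
    and pos: "\<And>v. \<exists>i<n. v i \<noteq> 0 \<Longrightarrow> 0 < Re (\<Sum>i<n. \<Sum>j<n. cnj (v i) * H i j * v j)"
  shows "\<exists>X. \<forall>i<n. \<forall>j<n. H i j = (\<Sum>k<n. cnj (X k i) * X k j)"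
  using assms
proof (induction n arbitrary: H)
  case 0
  then show ?case by simp
next
  case (Suc n)
  define a where "a = Re (H n n)"
  have Hnn: "H n n = of_real a"
    using Suc.prems(1)[of n n] by (simp add: a_def complex_eq_iff)
  have hn: "H n i = cnj (H i n)" if "i < n" for i using Suc.prems(1)[of i n] that by simp
  have a: "a > 0"
  proof -
    define v where "v i = (if i = n then 1 else (0::complex))" for i
    have "v n = 1" "\<And>i. i < n \<Longrightarrow> v i = 0" by (auto simp: v_def)
    moreover from this have "\<exists>i<Suc n. v i \<noteq> 0" by (intro exI[of _ n]) simp
    ultimately show ?thesis using Suc.prems(2)[of v] by (simp add: Hnn)
  qed
  define H' where "H' i j = H i j - H i n * H n j / a" for i j
  have "\<exists>X. \<forall>i<n. \<forall>j<n. H' i j = (\<Sum>k<n. cnj (X k i) * X k j)"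
  proof (rule Suc.IH)
    show "H' j i = cnj (H' i j)" if "i < n" "j < n" for i j
      using that Suc.prems(1)[of i j] hn[of i] hn[of j] by (simp add: H'_def mult.commute)
    show "0 < Re (\<Sum>i<n. \<Sum>j<n. cnj (v i) * H' i j * v j)" if v: "\<exists>i<n. v i \<noteq> 0" for v
    proof -
      define s where "s = (\<Sum>j<n. H n j * v j)"
      define w where "w = - s / a"
      define F where "F = (\<Sum>i<n. \<Sum>j<n. cnj (v i) * H i j * v j)"
      define u where "u = v(n := w)"
      have t: "(\<Sum>i<n. cnj (v i) * H i n) = cnj s"
        by (simp add: s_def hn mult.commute)
      have "\<exists>i<Suc n. u i \<noteq> 0" using v by (auto simp: u_def less_Suc_eq)
      then have "0 < Re (\<Sum>i<Suc n. \<Sum>j<Suc n. cnj (u i) * H i j * u j)" by (rule Suc.prems(2))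
      also have "(\<Sum>i<Suc n. \<Sum>j<Suc n. cnj (u i) * H i j * u j) =
          F + (\<Sum>i<n. cnj (v i) * H i n) * w + cnj w * s + cnj w * a * w"
        by (simp add: u_def F_def s_def Hnn sum.distrib sum_distrib_left sum_distrib_right mult.assoc)
      also have "\<dots> = F - cnj s * s / a"
        using a by (simp add: t w_def field_simps)
      also have "cnj s * s / a = (\<Sum>i<n. cnj (v i) * H i n) * (\<Sum>j<n. H n j * v j) / a"
        by (simp only: t s_def[symmetric])
      also have "\<dots> = (\<Sum>i<n. \<Sum>j<n. cnj (v i) * (H i n * H n j / a) * v j)"
        unfolding sum_product sum_divide_distrib by (intro sum.cong refl) (simp add: mult.assoc)
      also have "F - \<dots> = (\<Sum>i<n. \<Sum>j<n. cnj (v i) * H' i j * v j)"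
        by (simp add: F_def H'_def sum_subtractf[symmetric] algebra_simps)
      finally show ?thesis .
    qed
  qed
  then obtain X where X: "\<And>i j. i < n \<Longrightarrow> j < n \<Longrightarrow> H' i j = (\<Sum>k<n. cnj (X k i) * X k j)" by blast
  define Y where "Y k i = (if k < n then (if i < n then X k i else 0) else H n i / sqrt a)" for k i
  have sq: "complex_of_real (sqrt a) * complex_of_real (sqrt a) = of_real a"
    using a by (simp flip: of_real_mult)
  have last: "cnj (H n i / sqrt a) * (H n j / sqrt a) = cnj (H n i) * H n j / a" for i j
    using sq by (simp add: field_simps)
  have "H i j = (\<Sum>k<Suc n. cnj (Y k i) * Y k j)" if ij: "i < Suc n" "j < Suc n" for i j
  proof -
    have "(\<Sum>k<Suc n. cnj (Y k i) * Y k j) = (\<Sum>k<n. cnj (Y k i) * Y k j) + cnj (H n i) * H n j / a"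
      using last[of i j] by (simp add: Y_def)
    also have "(\<Sum>k<n. cnj (Y k i) * Y k j) = (if i < n \<and> j < n then H' i j else 0)"
      using X[of i j] by (auto simp: Y_def)
    also have "\<dots> + cnj (H n i) * H n j / a = H i j"
      using ij a hn[of i] hn[of j] by (auto simp: H'_def less_Suc_eq Hnn)
    finally show ?thesis by simp
  qed
  then show ?case by blast
qed

definition conv :: "nat \<Rightarrow> nat \<Rightarrow> (nat \<Rightarrow> complex mat) \<Rightarrow> complex mat \<Rightarrow> bool" where
  "conv r c As A \<longleftrightarrow> (\<forall>k. As k \<in> carrier_mat r c) \<and> A \<in> carrier_mat r c \<and>
     (\<forall>i<r. \<forall>j<c. (\<lambda>k. As k $$ (i, j)) \<longlonglongrightarrow> A $$ (i, j))"

lemma conv_const: "A \<in> carrier_mat r c \<Longrightarrow> conv r c (\<lambda>_. A) A"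
  by (simp add: conv_def)

lemma conv_mult:
  assumes "conv r m As A" "conv m c Bs B"
  shows "conv r c (\<lambda>k. As k * Bs k) (A * B)"
proof -
  have car: "As k \<in> carrier_mat r m" "A \<in> carrier_mat r m" "Bs k \<in> carrier_mat m c" "B \<in> carrier_mat m c" for k
    using assms by (auto simp: conv_def)
  have e: "(P * Q) $$ (i, j) = (\<Sum>l<m. P $$ (i, l) * Q $$ (l, j))"
    if "P \<in> carrier_mat r m" "Q \<in> carrier_mat m c" "i < r" "j < c" for P Q :: "complex mat" and i j
    using that by (simp add: scalar_prod_def lessThan_atLeast0)
  have "(\<lambda>k. (As k * Bs k) $$ (i, j)) \<longlonglongrightarrow> (A * B) $$ (i, j)" if "i < r" "j < c" for i j
    unfolding e[OF car(1,3) that] e[OF car(2,4) that]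
    using assms that by (intro tendsto_sum tendsto_mult) (auto simp: conv_def)
  then show ?thesis
    unfolding conv_def using mult_carrier_mat[OF car(1,3)] mult_carrier_mat[OF car(2,4)] by blast
qed

lemma conv_tr: "conv r r As A \<Longrightarrow> (\<lambda>k. tr (As k)) \<longlonglongrightarrow> tr A"
proof -
  assume c: "conv r r As A"
  then have "tr (As k) = (\<Sum>i<r. As k $$ (i, i))" "tr A = (\<Sum>i<r. A $$ (i, i))" for k
    by (auto simp: conv_def tr_def)
  then show ?thesis using c by (auto simp: conv_def intro: tendsto_sum)
qed

lemma nrm2_entry: "A \<in> carrier_mat r c \<Longrightarrow> i < r \<Longrightarrow> j < c \<Longrightarrow> (cmod (A $$ (i, j)))\<^sup>2 \<le> nrm2 A"
proof -
  assume A: "A \<in> carrier_mat r c" "i < r" "j < c"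
  have "(cmod (A $$ (i, j)))\<^sup>2 \<le> (\<Sum>j<c. (cmod (A $$ (i, j)))\<^sup>2)"
    using A by (intro member_le_sum) auto
  also have "\<dots> \<le> (\<Sum>i<r. \<Sum>j<c. (cmod (A $$ (i, j)))\<^sup>2)"
    using A by (intro member_le_sum[of i "{..<r}" "\<lambda>i. \<Sum>j<c. (cmod (A $$ (i, j)))\<^sup>2"]) (auto intro: sum_nonneg)
  finally show ?thesis using A by (simp add: nrm2_def)
qed

lemma parallelogram:
  assumes "A \<in> M n" "B \<in> M n"
  shows "nrm2 ((1/2) \<cdot>\<^sub>m (A + B)) = nrm2 A / 2 + nrm2 B / 2 - nrm2 (A - B) / 4"
proof -
  have e: "(cmod (1/2 * (x + y)))\<^sup>2 = (cmod x)\<^sup>2 / 2 + (cmod y)\<^sup>2 / 2 - (cmod (x - y))\<^sup>2 / 4" for x y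
    unfolding norm_mult power_mult_distrib cmod_power2 by (simp add: power2_eq_square field_simps)
  have "nrm2 ((1/2) \<cdot>\<^sub>m (A + B)) = (\<Sum>i<n. \<Sum>j<n. (cmod (1/2 * (A $$ (i, j) + B $$ (i, j))))\<^sup>2)"
    using assms by (simp add: nrm2_def)
  also have "\<dots> = (\<Sum>i<n. \<Sum>j<n. (cmod (A $$ (i, j)))\<^sup>2 / 2 + (cmod (B $$ (i, j)))\<^sup>2 / 2 - (cmod (A $$ (i, j) - B $$ (i, j)))\<^sup>2 / 4)"
    by (simp only: e)
  also have "\<dots> = nrm2 A / 2 + nrm2 B / 2 - nrm2 (A - B) / 4"
    using assms by (simp add: nrm2_def sum_subtractf sum.distrib sum_divide_distrib)
  finally show ?thesis .
qed

lemma half_le: "r \<le> x \<Longrightarrow> r \<le> y \<Longrightarrow> r \<le> 1/2 * (x + y)" for r x y :: real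
  by simp

lemma GL_inverse:
  assumes "subgroup G (GL n)" "g \<in> G"
  obtains h where "h \<in> G" "h \<in> M n" "g \<in> M n" "g * h = 1\<^sub>m n" "h * g = 1\<^sub>m n" "h = inv\<^bsub>GL n\<^esub> g"
proof -
  interpret group "GL n" by (rule group_GL)
  have g: "g \<in> carrier (GL n)" using assms by (rule subgroup.mem_carrier)
  have h: "inv\<^bsub>GL n\<^esub> g \<in> G" using assms by (rule subgroup.m_inv_closed)
  have "inv\<^bsub>GL n\<^esub> g \<in> carrier (GL n)" using g by (rule inv_closed)
  then show ?thesis using that[OF h] g r_inv[OF g] l_inv[OF g] by simp
qed

text \<open>
  The matrices that dominate the same multiple of the standard form along the whole orbit of the
  group form a convex set that the group permutes, and the group acts on it by uniformly bounded
  linear maps. The supremum of the squared norm over an orbit is an invariant, uniformly convex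
  function on this set, so it has exactly one minimizer, which is therefore fixed.
\<close>

lemma bounded_group_invariant_form:
  assumes G: "subgroup G (GL n)" and bd: "\<And>g. g \<in> G \<Longrightarrow> nrm2 g \<le> B"
  obtains H c where "H \<in> M n" "adj H = H" "\<And>g. g \<in> G \<Longrightarrow> adj g * H * g = H"
    "c > 0" "\<And>V. V \<in> carrier_mat n 1 \<Longrightarrow> c * nrm2 V \<le> Re (tr (adj V * H * V))"
proof -
  have GM: "g \<in> M n" if "g \<in> G" for g using subgroup.mem_carrier[OF G that] by simp
  have Gm: "g * h \<in> G" if "g \<in> G" "h \<in> G" for g h using subgroup.m_closed[OF G that] by simp
  have G1: "1\<^sub>m n \<in> G" using subgroup.one_closed[OF G] by simp
  define b where "b = max B 1"
  have b: "b > 0" "\<And>g. g \<in> G \<Longrightarrow> nrm2 g \<le> b" using bd by (auto simp: b_def le_max_iff_disj)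
  define qf where "qf H V = Re (tr (adj V * H * V))" for H V
  define K where "K = {H \<in> M n. adj H = H \<and>
      (\<forall>g\<in>G. \<forall>V\<in>carrier_mat n 1. (1/b) * nrm2 V \<le> qf (adj g * H * g) V)}"
  have KM: "H \<in> M n" if "H \<in> K" for H using that by (auto simp: K_def)
  have conjM [simp]: "adj g * H * g \<in> M n" if "g \<in> G" "H \<in> M n" for g H
    using that GM by auto
  have K1: "1\<^sub>m n \<in> K"
  proof -
    have "(1/b) * nrm2 V \<le> qf (adj g * 1\<^sub>m n * g) V" if g: "g \<in> G" and V: "V \<in> carrier_mat n 1" for g V
    proof -
      obtain h where h: "h \<in> G" "h \<in> M n" "g \<in> M n" "h * g = 1\<^sub>m n" using GL_inverse[OF G g] by metis
      have gV: "g * V \<in> carrier_mat n 1" using h V by auto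
      have "h * (g * V) = V" using h V by (simp add: assoc_mult_mat[symmetric, of _ n n _ n _ 1])
      then have "nrm2 V \<le> nrm2 h * nrm2 (g * V)" using nrm2_mult_le[OF h(2) gV] by simp
      also have "\<dots> \<le> b * nrm2 (g * V)" using b(2)[OF h(1)] by (intro mult_right_mono) auto
      finally have "(1/b) * nrm2 V \<le> nrm2 (g * V)" using b by (simp add: field_simps)
      also have "adj V * (adj g * 1\<^sub>m n * g) * V = adj (g * V) * (g * V)"
      proof -
        have aV: "adj V \<in> carrier_mat 1 n" using V by simp
        have ag: "adj g \<in> M n" using h by simp
        have "adj V * (adj g * 1\<^sub>m n * g) * V = adj V * ((adj g * g) * V)"
          using aV ag h V by (simp add: assoc_mult_mat[of _ 1 n _ n _ 1])
        also have "\<dots> = adj V * (adj g * (g * V))" using aV ag h V by (simp add: assoc_mult_mat[of _ n n _ n _ 1])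
        also have "\<dots> = (adj V * adj g) * (g * V)" using aV ag h V gV by (simp add: assoc_mult_mat[of _ 1 n _ n _ 1])
        finally show ?thesis using h V by (simp add: adj_mult[of _ n n _ 1])
      qed
      then have "nrm2 (g * V) = qf (adj g * 1\<^sub>m n * g) V"
        using nrm2_eq_tr[OF gV] by (simp add: qf_def) (metis Re_complex_of_real)
      finally show ?thesis .
    qed
    then show ?thesis by (simp add: K_def)
  qed
  have qf_lin: "qf (c \<cdot>\<^sub>m (A + A')) V = Re c * (qf A V + qf A' V)"
    if "A \<in> M n" "A' \<in> M n" "V \<in> carrier_mat n 1" "Im c = 0" for A A' V c
  proof -
    have aV: "adj V \<in> carrier_mat 1 n" using that by simp
    have c1: "adj V * A \<in> carrier_mat 1 n" "adj V * A' \<in> carrier_mat 1 n" using that aV by auto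
    have "adj V * (c \<cdot>\<^sub>m (A + A')) * V = c \<cdot>\<^sub>m (adj V * A * V + adj V * A' * V)"
      using that aV c1
      by (simp add: mult_smult_distrib[of _ 1 n _ n] mult_smult_assoc_mat[of _ 1 n _ 1]
          mult_add_distrib_mat[of _ 1 n _ n] add_mult_distrib_mat[of _ 1 n _ _ 1] del: One_nat_def)
    moreover have "adj V * A * V \<in> carrier_mat 1 1" "adj V * A' * V \<in> carrier_mat 1 1"
      using that aV by auto
    ultimately show ?thesis
      using that(4) by (simp add: qf_def tr_smult[of _ 1] tr_add[of _ 1] del: One_nat_def assoc_mult_mat)
  qed
  have mid: "(1/2) \<cdot>\<^sub>m (H + H') \<in> K" if H: "H \<in> K" "H' \<in> K" for H H'
  proof -
    have HM: "H \<in> M n" "H' \<in> M n" using H KM by auto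
    have "(1/b) * nrm2 V \<le> qf (adj g * ((1/2) \<cdot>\<^sub>m (H + H')) * g) V" if g: "g \<in> G" and V: "V \<in> carrier_mat n 1" for g V
    proof -
      have "adj g * ((1/2) \<cdot>\<^sub>m (H + H')) * g = (1/2) \<cdot>\<^sub>m (adj g * H * g + adj g * H' * g)"
        using HM GM[OF g] by (simp add: mat_smult[where n = n] mat_distrib[where n = n])
      then have "qf (adj g * ((1/2) \<cdot>\<^sub>m (H + H')) * g) V = 1/2 * (qf (adj g * H * g) V + qf (adj g * H' * g) V)"
        using qf_lin[of "adj g * H * g" "adj g * H' * g" V "1/2"] g HM V by simp
      moreover have "(1/b) * nrm2 V \<le> qf (adj g * H * g) V" "(1/b) * nrm2 V \<le> qf (adj g * H' * g) V"
        using H g V by (auto simp: K_def)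
      ultimately show ?thesis by (simp only: half_le)
    qed
    moreover have "adj ((1/2) \<cdot>\<^sub>m (H + H')) = (1/2) \<cdot>\<^sub>m (H + H')"
      using H by (auto simp: K_def adj_add[of _ n])
    ultimately show ?thesis using HM by (simp add: K_def)
  qed
  have conj_conj: "adj g * (adj h * H * h) * g = adj (h * g) * H * (h * g)" if "g \<in> G" "h \<in> G" "H \<in> M n" for g h H
    using that GM by (simp add: adj_mult[of _ n n _ n] mat_assoc[where n = n])
  have conjK: "adj h * H * h \<in> K" if h: "h \<in> G" and H: "H \<in> K" for h H
  proof -
    have Hadj: "adj H = H" using H by (simp add: K_def)
    have "adj (adj h * H * h) = adj h * H * h"
      using h GM[OF h] KM[OF H] by (simp add: adj_mult[of _ n n _ n] mat_assoc[where n = n] Hadj)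
    moreover have "(1/b) * nrm2 V \<le> qf (adj g * (adj h * H * h) * g) V" if "g \<in> G" "V \<in> carrier_mat n 1" for g V
    proof -
      have "\<forall>g\<in>G. \<forall>V\<in>carrier_mat n 1. (1/b) * nrm2 V \<le> qf (adj g * H * g) V"
        using H by (simp add: K_def)
      then show ?thesis
        unfolding conj_conj[OF that(1) h KM[OF H]] using Gm[OF h that(1)] that(2) by blast
    qed
    ultimately show ?thesis unfolding K_def using conjM[OF h KM[OF H]] by blast
  qed
  define \<phi> where "\<phi> H = (SUP g\<in>G. nrm2 (adj g * H * g))" for H
  have conj_bd: "nrm2 (adj g * H * g) \<le> b * b * nrm2 H" if g: "g \<in> G" and H: "H \<in> M n" for g H
  proof -
    have "nrm2 (adj g * H * g) \<le> nrm2 (adj g * H) * nrm2 g"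
      using GM[OF g] H by (intro nrm2_mult_le[of _ n n _ n]) auto
    also have "\<dots> \<le> (nrm2 g * nrm2 H) * nrm2 g"
      using GM[OF g] H nrm2_mult_le[of "adj g" n n H n] by (intro mult_right_mono) (auto simp: nrm2_adj)
    also have "\<dots> \<le> (b * nrm2 H) * b"
      using b g by (intro mult_mono) auto
    finally show ?thesis by (simp add: mult_ac)
  qed
  have bdd: "bdd_above ((\<lambda>g. nrm2 (adj g * H * g)) ` G)" if "H \<in> M n" for H
    using conj_bd[OF _ that] by (intro bdd_aboveI[of _ "b * b * nrm2 H"]) auto
  have le\<phi>: "nrm2 (adj g * H * g) \<le> \<phi> H" if "g \<in> G" "H \<in> M n" for g H
    unfolding \<phi>_def using that bdd by (intro cSUP_upper) auto
  have \<phi>conj: "\<phi> (adj h * H * h) \<le> \<phi> H" if "h \<in> G" "H \<in> M n" for h H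
    unfolding \<phi>_def[of "adj h * H * h"]
    using that G1 le\<phi>[OF Gm[OF that(1)] that(2)] by (intro cSUP_least) (auto simp: conj_conj)
  define m where "m = (INF H\<in>K. \<phi> H)"
  have \<phi>0: "\<phi> H \<ge> 0" if "H \<in> M n" for H
    using le\<phi>[OF G1 that] nrm2_nonneg by (rule order_trans[rotated])
  have bddK: "bdd_below (\<phi> ` K)" using \<phi>0 KM by (intro bdd_belowI[of _ 0]) auto
  have mle: "m \<le> \<phi> H" if "H \<in> K" for H unfolding m_def using bddK that by (intro cINF_lower) auto
  \<comment> \<open>The factor \<open>4\<close> comes from the parallelogram law, \<open>b\<^sup>2\<close> from undoing a conjugation.\<close>
  define C where "C = 4 * b * b"
  have C: "C > 0" using b by (simp add: C_def)
  have key: "nrm2 (H - H') \<le> C * ((\<phi> H + \<phi> H') / 2 - m)" if H: "H \<in> K" "H' \<in> K" for H H'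
  proof -
    have HM: "H \<in> M n" "H' \<in> M n" using H KM by auto
    have "\<phi> ((1/2) \<cdot>\<^sub>m (H + H')) \<le> (\<phi> H + \<phi> H') / 2 - nrm2 (H - H') / C"
      unfolding \<phi>_def[of "(1/2) \<cdot>\<^sub>m (H + H')"]
    proof (rule cSUP_least)
      fix g assume g: "g \<in> G"
      let ?a = "adj g * H * g" and ?b = "adj g * H' * g"
      obtain h where h: "h \<in> G" "h \<in> M n" "g \<in> M n" "g * h = 1\<^sub>m n" using GL_inverse[OF G g] by metis
      have hg: "adj h * adj g = 1\<^sub>m n" using adj_mult[OF h(3,2)] by (simp add: h(4))
      have "adj g * ((1/2) \<cdot>\<^sub>m (H + H')) * g = (1/2) \<cdot>\<^sub>m (?a + ?b)"
        using HM h by (simp add: mat_smult[where n = n] mat_distrib[where n = n])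
      then have "nrm2 (adj g * ((1/2) \<cdot>\<^sub>m (H + H')) * g) = nrm2 ?a / 2 + nrm2 ?b / 2 - nrm2 (?a - ?b) / 4"
        using parallelogram[of ?a n ?b] HM g by simp
      moreover have "adj h * (?a - ?b) * h = H - H'"
      proof -
        have "?a - ?b = adj g * (H - H') * g" using HM h by (simp add: mat_distrib[where n = n])
        then have "adj h * (?a - ?b) * h = (adj h * adj g) * (H - H') * (g * h)"
          using HM h by (simp add: mat_assoc[where n = n])
        then show ?thesis using HM by (simp add: hg h)
      qed
      then have "nrm2 (H - H') \<le> b * b * nrm2 (?a - ?b)"
        using conj_bd[OF h(1), of "?a - ?b"] HM g by simp
      then have "nrm2 (H - H') / C \<le> nrm2 (?a - ?b) / 4" using b C by (simp add: C_def field_simps)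
      moreover have "nrm2 ?a \<le> \<phi> H" "nrm2 ?b \<le> \<phi> H'" using le\<phi> g HM by auto
      ultimately show "nrm2 (adj g * ((1/2) \<cdot>\<^sub>m (H + H')) * g) \<le> (\<phi> H + \<phi> H') / 2 - nrm2 (H - H') / C"
        by argo
    qed (use G1 in auto)
    moreover have "m \<le> \<phi> ((1/2) \<cdot>\<^sub>m (H + H'))" using mle mid H by simp
    ultimately have "nrm2 (H - H') / C \<le> (\<phi> H + \<phi> H') / 2 - m" by linarith
    then show ?thesis using C by (simp add: field_simps)
  qed
  have "\<exists>H\<in>K. \<phi> H < m + 1 / real (Suc k)" for k
    using cINF_less_iff[OF _ bddK, of "m + 1 / real (Suc k)"] K1 by (auto simp: m_def)
  then obtain S where S: "\<And>k. S k \<in> K" "\<And>k. \<phi> (S k) < m + 1 / real (Suc k)" by metis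
  have SM: "S k \<in> M n" for k using S KM by auto
  have entry_small: "(cmod (A $$ (i, j) - A' $$ (i, j)))\<^sup>2 \<le> C * e"
    if "i < n" "j < n" "A \<in> K" "A' \<in> K" "\<phi> A \<le> m + e" "\<phi> A' \<le> m + e" for i j A A' e
  proof -
    have "(cmod (A $$ (i, j) - A' $$ (i, j)))\<^sup>2 \<le> nrm2 (A - A')"
      using nrm2_entry[of "A - A'" n n i j] that KM by (simp add: mat_idx[where n = n])
    also have "\<dots> \<le> C * ((\<phi> A + \<phi> A') / 2 - m)" using key that by simp
    also have "\<dots> \<le> C * e"
    proof (rule mult_left_mono)
      show "(\<phi> A + \<phi> A') / 2 - m \<le> e" using that(5,6) by (simp add: field_simps)
    qed (use C in simp)
    finally show ?thesis .
  qed
  have cauchy: "Cauchy (\<lambda>k. S k $$ (i, j))" if ij: "i < n" "j < n" for i j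
  proof (rule CauchyI)
    fix e :: real assume e: "e > 0"
    obtain N where N: "C / real (Suc N) < e\<^sup>2"
      using e C reals_Archimedean[of "e\<^sup>2 / C"] by (auto simp: field_simps)
    have "cmod (S k $$ (i, j) - S l $$ (i, j)) < e" if kl: "k \<ge> N" "l \<ge> N" for k l
    proof -
      have "1 / real (Suc k) \<le> 1 / real (Suc N)" "1 / real (Suc l) \<le> 1 / real (Suc N)"
        using kl by (auto simp: field_simps)
      then have "\<phi> (S k) \<le> m + 1 / real (Suc N)" "\<phi> (S l) \<le> m + 1 / real (Suc N)"
        using S(2)[of k] S(2)[of l] by linarith+
      then have "(cmod (S k $$ (i, j) - S l $$ (i, j)))\<^sup>2 \<le> C * (1 / real (Suc N))"
        using entry_small[OF ij S(1) S(1)] by blast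
      also have "\<dots> < e\<^sup>2" using N by simp
      finally show ?thesis using e by (simp add: power2_less_imp_less)
    qed
    then show "\<exists>N. \<forall>k\<ge>N. \<forall>l\<ge>N. cmod (S k $$ (i, j) - S l $$ (i, j)) < e" by blast
  qed
  define H where "H = mat n n (\<lambda>(i, j). lim (\<lambda>k. S k $$ (i, j)))"
  have convS: "conv n n S H"
    using cauchy SM by (auto simp: conv_def H_def Cauchy_convergent_iff convergent_LIMSEQ_iff)
  have HM: "H \<in> M n" by (simp add: H_def)
  have "adj H = H"
  proof (rule mat_eqI[where n = n])
    fix i j assume ij: "i < n" "j < n"
    have "S k $$ (i, j) = cnj (S k $$ (j, i))" for k
    proof -
      have "adj (S k) $$ (i, j) = cnj (S k $$ (j, i))" using SM[of k] ij by (simp add: adj_def)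
      then show ?thesis using S(1)[of k] by (simp add: K_def)
    qed
    then have "(\<lambda>k. S k $$ (i, j)) \<longlonglongrightarrow> cnj (H $$ (j, i))"
      using convS ij by (simp add: conv_def tendsto_cnj)
    moreover have "(\<lambda>k. S k $$ (i, j)) \<longlonglongrightarrow> H $$ (i, j)" using convS ij by (simp add: conv_def)
    ultimately have "H $$ (i, j) = cnj (H $$ (j, i))" by (rule LIMSEQ_unique[rotated])
    then show "adj H $$ (i, j) = H $$ (i, j)" using ij HM by (simp add: adj_def)
  qed (use HM in auto)
  moreover have "adj h * H * h = H" if h: "h \<in> G" for h
  proof (rule mat_eqI[where n = n])
    fix i j assume ij: "i < n" "j < n"
    have "conv n n (\<lambda>k. adj h * S k * h) (adj h * H * h)"
      using GM[OF h] convS by (intro conv_mult conv_const) auto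
    then have l1: "(\<lambda>k. (adj h * S k * h) $$ (i, j)) \<longlonglongrightarrow> (adj h * H * h) $$ (i, j)"
      using ij by (simp add: conv_def)
    have l2: "(\<lambda>k. S k $$ (i, j)) \<longlonglongrightarrow> H $$ (i, j)" using convS ij by (simp add: conv_def)
    have "(\<lambda>k. (cmod (S k $$ (i, j) - (adj h * S k * h) $$ (i, j)))\<^sup>2) \<longlonglongrightarrow> 0"
    proof (rule tendsto_sandwich[OF _ _ tendsto_const])
      show "\<forall>\<^sub>F k in sequentially. 0 \<le> (cmod (S k $$ (i, j) - (adj h * S k * h) $$ (i, j)))\<^sup>2" by simp
      have "(cmod (S k $$ (i, j) - (adj h * S k * h) $$ (i, j)))\<^sup>2 \<le> C * (1 / real (Suc k))" for k
        using S(2)[of k] \<phi>conj[OF h SM[of k]] S(1) conjK[OF h S(1)] ij by (intro entry_small) auto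
      then show "\<forall>\<^sub>F k in sequentially. (cmod (S k $$ (i, j) - (adj h * S k * h) $$ (i, j)))\<^sup>2 \<le> C * (1 / real (Suc k))"
        by simp
      have "(\<lambda>k. C * (1 / real (Suc k))) \<longlonglongrightarrow> C * 0"
        using LIMSEQ_inverse_real_of_nat by (intro tendsto_mult tendsto_const) (simp add: inverse_eq_divide)
      then show "(\<lambda>k. C * (1 / real (Suc k))) \<longlonglongrightarrow> 0" by simp
    qed
    then have "(\<lambda>k. S k $$ (i, j) - (adj h * S k * h) $$ (i, j)) \<longlonglongrightarrow> 0"
      by (simp add: tendsto_norm_zero_iff power_tendsto_0_iff)
    moreover have "(\<lambda>k. S k $$ (i, j) - (adj h * S k * h) $$ (i, j)) \<longlonglongrightarrow> H $$ (i, j) - (adj h * H * h) $$ (i, j)"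
      using l1 l2 by (rule tendsto_diff[rotated])
    ultimately have "H $$ (i, j) - (adj h * H * h) $$ (i, j) = 0" by (rule LIMSEQ_unique[rotated])
    then show "(adj h * H * h) $$ (i, j) = H $$ (i, j)" by simp
  qed (use HM h in auto)
  moreover have "1 / b * nrm2 V \<le> Re (tr (adj V * H * V))" if V: "V \<in> carrier_mat n 1" for V
  proof -
    have "conv 1 1 (\<lambda>k. adj V * S k * V) (adj V * H * V)"
      using V convS by (intro conv_mult[of _ n] conv_const) auto
    then have "(\<lambda>k. Re (tr (adj V * S k * V))) \<longlonglongrightarrow> Re (tr (adj V * H * V))"
      by (intro tendsto_Re conv_tr)
    moreover have "1 / b * nrm2 V \<le> Re (tr (adj V * S k * V))" for k
      using S(1)[of k] G1 V SM[of k] by (auto simp: K_def qf_def dest!: bspec[of G _ "1\<^sub>m n"])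
    ultimately show ?thesis by (intro tendsto_lowerbound) auto
  qed
  ultimately show ?thesis using that[OF HM, of "1 / b"] b(1) by simp
qed

lemma invertible_mat_inverse:
  fixes X :: "complex mat"
  assumes "X \<in> M n" "det X \<noteq> 0"
  obtains Y where "Y \<in> M n" "X * Y = 1\<^sub>m n" "Y * X = 1\<^sub>m n"
proof -
  have "X \<in> carrier (GL n)" using assms by simp
  then show ?thesis
    using that[of "inv\<^bsub>GL n\<^esub> X"] group.inv_closed[OF group_GL[of n], of X] group.r_inv[OF group_GL[of n], of X] group.l_inv[OF group_GL[of n], of X] by simp
qed

text \<open>
  A Cholesky factor of an invariant positive definite form changes the basis to an orthonormal one.
\<close>

theorem bounded_group_unitarizable:
  assumes G: "subgroup G (GL n)" and bd: "\<And>g. g \<in> G \<Longrightarrow> nrm2 g \<le> B"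
  obtains X Y where "X \<in> M n" "Y \<in> M n" "X * Y = 1\<^sub>m n" "Y * X = 1\<^sub>m n"
    "\<And>g. g \<in> G \<Longrightarrow> unitary_mat n (X * g * Y)"
proof -
  obtain H c where H: "H \<in> M n" "adj H = H" "\<And>g. g \<in> G \<Longrightarrow> adj g * H * g = H"
    and c: "c > 0" "\<And>V. V \<in> carrier_mat n 1 \<Longrightarrow> c * nrm2 V \<le> Re (tr (adj V * H * V))"
    using bounded_group_invariant_form[OF G bd] by blast
  have quad: "tr (adj V * H * V) = (\<Sum>i<n. \<Sum>j<n. cnj (V $$ (i, 0)) * H $$ (i, j) * V $$ (j, 0))"
    if V: "V \<in> carrier_mat n 1" for V
  proof -
    have aV: "adj V \<in> carrier_mat 1 n" using V by simp
    have "tr (adj V * H * V) = (adj V * H * V) $$ (0, 0)" using aV V H(1) by (simp add: tr_def)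
    also have "\<dots> = (\<Sum>j<n. (adj V * H) $$ (0, j) * V $$ (j, 0))"
      using aV V H(1) by (simp add: scalar_prod_def lessThan_atLeast0)
    also have "\<dots> = (\<Sum>j<n. (\<Sum>i<n. cnj (V $$ (i, 0)) * H $$ (i, j)) * V $$ (j, 0))"
      using aV V H(1) by (intro sum.cong refl) (simp add: scalar_prod_def lessThan_atLeast0 adj_def)
    also have "\<dots> = (\<Sum>i<n. \<Sum>j<n. cnj (V $$ (i, 0)) * H $$ (i, j) * V $$ (j, 0))"
      by (simp add: sum_distrib_right) (rule sum.swap)
    finally show ?thesis .
  qed
  have "\<exists>X. \<forall>i<n. \<forall>j<n. H $$ (i, j) = (\<Sum>k<n. cnj (X k i) * X k j)"
  proof (rule cholesky)
    show "H $$ (j, i) = cnj (H $$ (i, j))" if "i < n" "j < n" for i j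
    proof -
      have "adj H $$ (j, i) = cnj (H $$ (i, j))" using that H(1) by (simp add: adj_def)
      then show ?thesis using H(2) by simp
    qed
    show "0 < Re (\<Sum>i<n. \<Sum>j<n. cnj (v i) * H $$ (i, j) * v j)" if v: "\<exists>i<n. v i \<noteq> 0" for v :: "nat \<Rightarrow> complex"
    proof -
      define V where "V = mat n 1 (\<lambda>(i, _). v i)"
      have V: "V \<in> carrier_mat n 1" by (simp add: V_def)
      obtain i where i: "i < n" "v i \<noteq> 0" using v by blast
      have "0 < (cmod (V $$ (i, 0)))\<^sup>2" using i by (simp add: V_def)
      also have "\<dots> \<le> nrm2 V" using nrm2_entry[OF V i(1), of 0] by simp
      finally have "0 < c * nrm2 V" using c by simp
      also have "\<dots> \<le> Re (tr (adj V * H * V))" using c V by simp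
      finally show ?thesis unfolding quad[OF V] by (simp add: V_def)
    qed
  qed
  then obtain X' where X': "\<And>i j. i < n \<Longrightarrow> j < n \<Longrightarrow> H $$ (i, j) = (\<Sum>k<n. cnj (X' k i) * X' k j)" by blast
  define X where "X = mat n n (\<lambda>(i, j). X' i j)"
  have X: "X \<in> M n" by (simp add: X_def)
  have HX: "H = adj X * X"
  proof (rule mat_eqI[where n = n])
    fix i j assume ij: "i < n" "j < n"
    have "(adj X * X) $$ (i, j) = (\<Sum>k<n. cnj (X' k i) * X' k j)"
      using mat_mult_entry[of "adj X" n X i j] X ij by (simp add: adj_def X_def)
    then show "H $$ (i, j) = (adj X * X) $$ (i, j)" using X' ij by simp
  qed (use X H in auto)
  have "det X \<noteq> 0"
  proof
    assume "det X = 0"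
    then obtain v where v: "v \<in> carrier_vec n" "v \<noteq> 0\<^sub>v n" "X *\<^sub>v v = 0\<^sub>v n"
      using det_0_iff_vec_prod_zero[OF X] by blast
    define V where "V = mat n 1 (\<lambda>(i, _). v $ i)"
    have V: "V \<in> carrier_mat n 1" by (simp add: V_def)
    have "X * V = 0\<^sub>m n 1"
    proof (rule eq_matI)
      fix i j assume "i < dim_row (0\<^sub>m n 1)" "j < dim_col (0\<^sub>m n 1)"
      then have ij: "i < n" "j = 0" by auto
      have "(X * V) $$ (i, 0) = row X i \<bullet> col V 0" using ij X V by simp
      also have "col V 0 = v" using v by (intro eq_vecI) (auto simp: V_def)
      also have "row X i \<bullet> v = (X *\<^sub>v v) $ i" using ij X by simp
      finally show "(X * V) $$ (i, j) = 0\<^sub>m n 1 $$ (i, j)" using ij v by simp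
    qed (use X V in auto)
    moreover have "adj V * H * V = adj V * (adj X * (X * V))"
    proof -
      have aV: "adj V \<in> carrier_mat 1 n" "adj X \<in> M n" using V X by auto
      have "adj V * H * V = adj V * (H * V)" using aV V H(1) by (simp add: assoc_mult_mat[of _ 1 n _ n _ 1])
      then show ?thesis unfolding HX using aV V X by (simp add: assoc_mult_mat[of _ n n _ n _ 1])
    qed
    ultimately have "tr (adj V * H * V) = 0"
      using V X by (simp add: right_mult_zero_mat[of _ n n] right_mult_zero_mat[of _ 1 n] tr_def)
    then have "c * nrm2 V \<le> 0" using c(2)[OF V] by simp
    then have "nrm2 V = 0" using c(1) nrm2_nonneg[of V] by (simp add: mult_le_0_iff)
    then have "V = 0\<^sub>m n 1" using nrm2_zero[OF V] by simp
    moreover obtain i where "i < n" "v $ i \<noteq> 0" using v by (metis carrier_vecD eq_vecI index_zero_vec)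
    moreover have "V $$ (i, 0) = v $ i" if "i < n" for i using that by (simp add: V_def)
    ultimately show False by (metis index_zero_mat(1) less_numeral_extra(1))
  qed
  then obtain Y where Y: "Y \<in> M n" "X * Y = 1\<^sub>m n" "Y * X = 1\<^sub>m n"
    using invertible_mat_inverse[OF X] by blast
  have "unitary_mat n (X * g * Y)" if g: "g \<in> G" for g
  proof -
    have gM: "g \<in> M n" using subgroup.mem_carrier[OF G g] by simp
    have "adj (X * g * Y) * (X * g * Y) = adj Y * (adj g * (adj X * X) * g) * Y"
      using X Y(1) gM by (simp add: adj_mult[of _ n n _ n] mat_assoc[where n = n])
    also have "\<dots> = adj Y * (adj X * X) * Y" using H(3)[OF g] by (simp add: HX[symmetric])
    also have "\<dots> = adj (X * Y) * (X * Y)"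
      using X Y(1) by (simp add: adj_mult[of _ n n _ n] mat_assoc[where n = n])
    also have "\<dots> = 1\<^sub>m n" by (simp add: Y(2))
    finally show ?thesis using X Y(1) gM by (simp add: unitary_mat_def)
  qed
  then show ?thesis using that X Y by blast
qed

lemma compact_cmod_bounded:
  assumes "compact (K :: complex set)"
  shows "\<exists>b. \<forall>x\<in>K. cmod x \<le> b"
proof (cases "K = {}")
  case False
  have "continuous_on K cmod" by (intro continuous_on_norm continuous_on_id)
  then show ?thesis using continuous_attains_sup[OF assms False] by blast
qed simp

lemma compact_mats_bounded:
  assumes "compactin (mat_topology n) G"
  obtains B where "\<And>g. g \<in> G \<Longrightarrow> nrm2 g \<le> B"
proof -
  let ?I = "{..<n} \<times> {..<n}"
  let ?T = "product_topology (\<lambda>_. euclidean :: complex topology) ?I"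
  let ?f = "\<lambda>A :: complex mat. restrict (\<lambda>ij. A $$ ij) ?I"
  have GM: "G \<subseteq> M n" and cpt: "compactin ?T (?f ` G)"
    using assms by (auto simp: compactin_mat_topology)
  have "\<exists>b. \<forall>g\<in>G. (cmod (g $$ ij))\<^sup>2 \<le> b" if ij: "ij \<in> ?I" for ij
  proof -
    have "compactin euclidean ((\<lambda>x. x ij) ` ?f ` G)"
      using cpt continuous_map_product_projection[OF ij] by (rule image_compactin)
    then have "compact ((\<lambda>x. x ij) ` ?f ` G)" by simp
    then obtain b where "\<forall>x\<in>(\<lambda>x. x ij) ` ?f ` G. cmod x \<le> b"
      using compact_cmod_bounded by blast
    then have "\<forall>g\<in>G. cmod (g $$ ij) \<le> b" using ij by auto
    then have "\<forall>g\<in>G. (cmod (g $$ ij))\<^sup>2 \<le> b\<^sup>2" by (auto intro: power_mono)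
    then show ?thesis by blast
  qed
  then have "\<forall>ij\<in>?I. \<exists>b. \<forall>g\<in>G. (cmod (g $$ ij))\<^sup>2 \<le> b" by blast
  from bchoice[OF this] obtain b where b: "\<forall>ij\<in>?I. \<forall>g\<in>G. (cmod (g $$ ij))\<^sup>2 \<le> b ij" by blast
  have "nrm2 g \<le> (\<Sum>i<n. \<Sum>j<n. b (i, j))" if "g \<in> G" for g
  proof -
    have "nrm2 g = (\<Sum>i<n. \<Sum>j<n. (cmod (g $$ (i, j)))\<^sup>2)" using that GM by (auto simp: nrm2_def)
    also have "\<dots> \<le> (\<Sum>i<n. \<Sum>j<n. b (i, j))" using b that by (intro sum_mono) auto
    finally show ?thesis .
  qed
  then show ?thesis by (rule that)
qed

section \<open>Unitary groups\<close>

lemma zero_M [simp]: "A \<in> M n \<Longrightarrow> A * 0\<^sub>m n n = 0\<^sub>m n n" "A \<in> M n \<Longrightarrow> 0\<^sub>m n n * A = 0\<^sub>m n n"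
  by auto

lemma smult_smult_mat [simp]: "a \<cdot>\<^sub>m (b \<cdot>\<^sub>m A) = (a * b :: complex) \<cdot>\<^sub>m A"
  by (intro eq_matI) auto

lemma one_smult_mat [simp]: "1 \<cdot>\<^sub>m A = (A :: complex mat)"
  by (intro eq_matI) auto

text \<open>
  The entries are rounded to a grid that is fine enough for \<open>\<delta>\<close>; only finitely many rounded
  matrices obey the bound.
\<close>

lemma pigeonhole_close:
  assumes inf: "infinite S" and S: "S \<subseteq> M n" and bd: "\<And>A. A \<in> S \<Longrightarrow> nrm2 A \<le> B" and \<delta>: "\<delta> > 0"
  shows "\<exists>A\<in>S. \<exists>C\<in>S. A \<noteq> C \<and> nrm2 (A - C) < \<delta>"
proof -
  define e where "e = sqrt (\<delta> / (2 * (real n)\<^sup>2 + 1))"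
  have pos: "2 * (real n)\<^sup>2 + 1 > 0" by (simp add: add_nonneg_pos)
  have e: "e > 0" "e\<^sup>2 = \<delta> / (2 * (real n)\<^sup>2 + 1)" using \<delta> pos by (auto simp: e_def)
  define b where "b = 1 + \<bar>B\<bar>"
  have bnd: "\<bar>x\<bar> \<le> b" if "x\<^sup>2 \<le> B" for x :: real
  proof -
    have "x\<^sup>2 \<le> b\<^sup>2"
    proof -
      have "B \<le> 1 + 2 * \<bar>B\<bar> + \<bar>B\<bar>\<^sup>2" by (smt (verit) zero_le_power2)
      then show ?thesis using that by (simp add: b_def power2_sum)
    qed
    then have "\<bar>x\<bar> \<le> \<bar>b\<bar>" by (simp add: abs_le_square_iff)
    then show ?thesis by (simp add: b_def)
  qed
  define I where "I = {..<n} \<times> {..<n}"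
  define K where "K = {\<lfloor>- b / e\<rfloor>..\<lfloor>b / e\<rfloor>}"
  define f where "f A = restrict (\<lambda>ij. (\<lfloor>Re (A $$ ij) / e\<rfloor>, \<lfloor>Im (A $$ ij) / e\<rfloor>)) I" for A
  have "f ` S \<subseteq> PiE I (\<lambda>_. K \<times> K)"
  proof
    fix y assume "y \<in> f ` S"
    then obtain A where A: "A \<in> S" "y = f A" by blast
    have "\<lfloor>Re (A $$ ij) / e\<rfloor> \<in> K \<and> \<lfloor>Im (A $$ ij) / e\<rfloor> \<in> K" if ij: "ij \<in> I" for ij
    proof -
      obtain i j where p: "ij = (i, j)" "i < n" "j < n" using ij by (auto simp: I_def)
      have c: "(cmod (A $$ ij))\<^sup>2 \<le> B"
        using nrm2_entry[of A n n i j] p A S bd[of A] by (auto intro: order_trans)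
      have "(Re (A $$ ij))\<^sup>2 \<le> B" "(Im (A $$ ij))\<^sup>2 \<le> B"
        using c zero_le_power2[of "Re (A $$ ij)"] zero_le_power2[of "Im (A $$ ij)"]
        unfolding cmod_power2 by linarith+
      then have "\<bar>Re (A $$ ij)\<bar> \<le> b" "\<bar>Im (A $$ ij)\<bar> \<le> b" using bnd by auto
      then have "- b \<le> Re (A $$ ij)" "Re (A $$ ij) \<le> b" "- b \<le> Im (A $$ ij)" "Im (A $$ ij) \<le> b" by linarith+
      moreover have "\<lfloor>x / e\<rfloor> \<in> K" if "- b \<le> x" "x \<le> b" for x
        using that e(1) divide_right_mono[of "- b" x e] divide_right_mono[of x b e]
        unfolding K_def by (auto intro: floor_mono)
      ultimately show ?thesis by blast
    qed
    then show "y \<in> PiE I (\<lambda>_. K \<times> K)" unfolding A(2) f_def by (intro restrict_PiE_iff[THEN iffD2]) auto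
  qed
  moreover have "finite (PiE I (\<lambda>_. K \<times> K))"
    by (intro finite_PiE) (auto simp: I_def K_def)
  ultimately have "finite (f ` S)" by (rule finite_subset)
  then have "\<not> inj_on f S" using inf finite_imageD by blast
  then obtain A C where AC: "A \<in> S" "C \<in> S" "A \<noteq> C" "f A = f C" by (auto simp: inj_on_def)
  have ent: "(cmod (A $$ (i, j) - C $$ (i, j)))\<^sup>2 \<le> 2 * e\<^sup>2" if ij: "i < n" "j < n" for i j
  proof -
    have "f A (i, j) = f C (i, j)" by (simp add: AC(4))
    then have fl: "\<lfloor>Re (A $$ (i, j)) / e\<rfloor> = \<lfloor>Re (C $$ (i, j)) / e\<rfloor>" "\<lfloor>Im (A $$ (i, j)) / e\<rfloor> = \<lfloor>Im (C $$ (i, j)) / e\<rfloor>"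
      using ij by (auto simp: f_def I_def)
    have close: "\<bar>x - y\<bar> \<le> e" if "\<lfloor>x / e\<rfloor> = \<lfloor>y / e\<rfloor>" for x y :: real
    proof -
      have "\<bar>x / e - y / e\<bar> \<le> 1" using that by linarith
      then have "\<bar>(x - y) / e\<bar> \<le> 1" by (simp add: diff_divide_distrib)
      then show ?thesis using e(1) by (simp add: abs_divide)
    qed
    have "\<bar>Re (A $$ (i, j)) - Re (C $$ (i, j))\<bar> \<le> \<bar>e\<bar>" "\<bar>Im (A $$ (i, j)) - Im (C $$ (i, j))\<bar> \<le> \<bar>e\<bar>"
      using close[OF fl(1)] close[OF fl(2)] e(1) by auto
    then have "(Re (A $$ (i, j)) - Re (C $$ (i, j)))\<^sup>2 \<le> e\<^sup>2" "(Im (A $$ (i, j)) - Im (C $$ (i, j)))\<^sup>2 \<le> e\<^sup>2"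
      by (simp_all only: abs_le_square_iff)
    then show ?thesis by (simp add: cmod_power2)
  qed
  have AM: "A \<in> M n" "C \<in> M n" using AC S by auto
  have "nrm2 (A - C) = (\<Sum>i<n. \<Sum>j<n. (cmod (A $$ (i, j) - C $$ (i, j)))\<^sup>2)"
    using AM by (simp add: nrm2_def)
  also have "\<dots> \<le> (\<Sum>i<n. \<Sum>j<n. 2 * e\<^sup>2)" using ent by (intro sum_mono) auto
  also have "\<dots> = 2 * (real n)\<^sup>2 * e\<^sup>2" by (simp add: power2_eq_square)
  also have "\<dots> < (2 * (real n)\<^sup>2 + 1) * e\<^sup>2" using e(1) by (simp add: algebra_simps)
  also have "\<dots> = \<delta>" using pos by (simp add: e(2))
  finally show ?thesis using AC by blast
qed

lemma det_adj:
  assumes "A \<in> M n"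
  shows "det (adj A) = cnj (det A)"
proof -
  interpret comm_ring_hom cnj by unfold_locales auto
  have "adj A = transpose_mat (map_mat cnj A)" by (intro eq_matI) (auto simp: adj_def)
  moreover have "map_mat cnj A \<in> M n" using assms by simp
  ultimately show ?thesis using hom_det by (simp add: det_transpose[of _ n])
qed

lemma unit_root_exists:
  assumes "cmod z = 1" "n > 0"
  obtains c where "cmod c = 1" "c ^ n = z"
proof -
  have "z = cis (Arg z)" using assms(1) cis_Arg[of z] by (metis div_by_1 norm_zero of_real_1 sgn_eq zero_neq_one)
  then have "cis (Arg z / n) ^ n = z" using assms(2) by (simp add: Complex.DeMoivre)
  then show ?thesis using that[of "cis (Arg z / n)"] by simp
qed

lemma spectrum_smult:
  assumes X: "X \<in> M n" and c: "c \<noteq> 0" and l: "l \<in> spectrum (c \<cdot>\<^sub>m X)"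
  shows "l / c \<in> spectrum X"
proof -
  obtain v where v: "v \<in> carrier_vec n" "v \<noteq> 0\<^sub>v n" "(c \<cdot>\<^sub>m X) *\<^sub>v v = l \<cdot>\<^sub>v v"
    using l X by (auto simp: spectrum_def eigenvalue_def eigenvector_def)
  have "c \<cdot>\<^sub>v (X *\<^sub>v v) = l \<cdot>\<^sub>v v" using v X by (intro eq_vecI) (auto simp: v(3)[symmetric])
  then have "inverse c \<cdot>\<^sub>v (c \<cdot>\<^sub>v (X *\<^sub>v v)) = inverse c \<cdot>\<^sub>v (l \<cdot>\<^sub>v v)" by simp
  then have "X *\<^sub>v v = (l / c) \<cdot>\<^sub>v v" using c by (simp add: smult_smult_assoc field_simps)
  then show ?thesis using v X by (auto simp: spectrum_def eigenvalue_def eigenvector_def)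
qed

text \<open>
  The columns of \<open>W\<close> play the role of a common eigenvector of two commuting matrices, chosen so
  that \<open>X\<close> does not annihilate it.
\<close>

lemma common_eigenvector:
  assumes e: "e \<in> M n" "e ^\<^sub>m r = 1\<^sub>m n" and f: "f \<in> M n" "f ^\<^sub>m r = 1\<^sub>m n"
    and r: "r > 0" and ef: "e * f = f * e" and X: "X \<in> M n" "X \<noteq> 0\<^sub>m n n"
  obtains W l m where "W \<in> M n" "l ^ r = 1" "m ^ r = (1::complex)" "e * W = l \<cdot>\<^sub>m W" "f * W = m \<cdot>\<^sub>m W" "X * W \<noteq> 0\<^sub>m n n"
proof -
  obtain Q l where Q: "Q \<in> M n" "l ^ r = (1::complex)" "e * Q = l \<cdot>\<^sub>m Q" "X * Q \<noteq> 0\<^sub>m n n"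
    "\<And>B. B \<in> M n \<Longrightarrow> e * B = B * e \<Longrightarrow> B * Q = Q * B"
    using finite_order_eigenprojection[OF e(1) r e(2) X] by blast
  have XQ: "X * Q \<in> M n" using X Q by simp
  obtain R m where R: "R \<in> M n" "m ^ r = (1::complex)" "f * R = m \<cdot>\<^sub>m R" "X * Q * R \<noteq> 0\<^sub>m n n"
    using finite_order_eigenprojection[OF f(1) r f(2) XQ Q(4)] by blast
  have fQ: "f * Q = Q * f" using Q(5)[OF f(1) ef] .
  have "e * (Q * R) = l \<cdot>\<^sub>m (Q * R)"
  proof -
    have "e * (Q * R) = (e * Q) * R" using e(1) Q(1) R(1) by (simp add: mat_assoc[where n = n])
    then show ?thesis using Q(1) R(1) by (simp add: Q(3) mat_smult[where n = n])
  qed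
  moreover have "f * (Q * R) = m \<cdot>\<^sub>m (Q * R)"
  proof -
    have "f * (Q * R) = (f * Q) * R" using f(1) Q(1) R(1) by (simp add: mat_assoc[where n = n])
    also have "\<dots> = Q * (f * R)" unfolding fQ using f(1) Q(1) R(1) by (simp add: mat_assoc[where n = n])
    finally show ?thesis using Q(1) R(1) by (simp add: R(3) mat_smult[where n = n])
  qed
  moreover have "X * (Q * R) \<noteq> 0\<^sub>m n n" using R(4) X(1) Q(1) R(1) by (simp add: mat_assoc[where n = n])
  ultimately show ?thesis using that[of "Q * R" l m] Q(1,2) R(1,2) by simp
qed

lemma diff_eigenvalue:
  assumes "e \<in> M n" "f \<in> M n" "W \<in> M n" "e * W = l \<cdot>\<^sub>m W" "f * W = m \<cdot>\<^sub>m W" "W \<noteq> 0\<^sub>m n n"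
  shows "l - m \<in> spectrum (e - f)"
proof (rule eigen_in_spectrum)
  show "(e - f) * W = (l - m) \<cdot>\<^sub>m W"
    using assms(1-5) by (simp add: mat_distrib[where n = n])
      (rule mat_eqI[where n = n]; simp add: mat_idx[where n = n] left_diff_distrib)
qed (use assms in auto)

locale unitary_group =
  fixes n :: nat and G :: "complex mat set"
  assumes sub: "subgroup G (GL n)" and uni: "\<And>g. g \<in> G \<Longrightarrow> unitary_mat n g"
begin

lemma GM [simp]: "g \<in> G \<Longrightarrow> g \<in> M n"
  using subgroup.mem_carrier[OF sub] by simp

lemma Gdim [simp]: "g \<in> G \<Longrightarrow> dim_row g = n" "g \<in> G \<Longrightarrow> dim_col g = n"
  using carrier_matD[OF GM] by auto

lemma Gmult [simp]: "a \<in> G \<Longrightarrow> b \<in> G \<Longrightarrow> a * b \<in> G"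
  using subgroup.m_closed[OF sub] by simp

lemma Gone [simp]: "1\<^sub>m n \<in> G"
  using subgroup.one_closed[OF sub] by simp

lemma adj_inverse [simp]: "g \<in> G \<Longrightarrow> adj g * g = 1\<^sub>m n" "g \<in> G \<Longrightarrow> g * adj g = 1\<^sub>m n"
  using unitary_matD[OF uni] by auto

lemma inv_eq: "g \<in> G \<Longrightarrow> inv\<^bsub>GL n\<^esub> g = adj g"
proof -
  assume g: "g \<in> G"
  obtain h where h: "h \<in> M n" "g \<in> M n" "h * g = 1\<^sub>m n" "h = inv\<^bsub>GL n\<^esub> g"
    using GL_inverse[OF sub g] by metis
  have "h = h * (g * adj g)" using h(1) g by simp
  also have "\<dots> = (h * g) * adj g" using h(1,2) by (simp add: mat_assoc[where n = n])
  finally show ?thesis using h g by simp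
qed

lemma Gadj [simp]: "g \<in> G \<Longrightarrow> adj g \<in> G"
  using subgroup.m_inv_closed[OF sub, of g] inv_eq by simp

lemma adj_cancel [simp]:
  "g \<in> G \<Longrightarrow> Z \<in> M n \<Longrightarrow> adj g * (g * Z) = Z" "g \<in> G \<Longrightarrow> Z \<in> M n \<Longrightarrow> g * (adj g * Z) = Z"
  by (simp_all add: mat_assoc[where n = n, symmetric] del: assoc_mult_mat)

lemma conj_eq_iff_commute:
  assumes "g \<in> G" "Y \<in> M n" "Z \<in> M n"
  shows "adj g * Y * g = Z \<longleftrightarrow> Y * g = g * Z"
proof
  assume "adj g * Y * g = Z"
  then have "g * (adj g * Y * g) = g * Z" by simp
  then show "Y * g = g * Z" using assms by (simp add: mat_assoc[where n = n])
next
  assume "Y * g = g * Z"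
  then have "adj g * (Y * g) = adj g * (g * Z)" by simp
  then show "adj g * Y * g = Z" using assms by (simp add: mat_assoc[where n = n])
qed

lemma nrm2_G: "g \<in> G \<Longrightarrow> nrm2 g = real n"
proof -
  assume g: "g \<in> G"
  have "complex_of_real (nrm2 g) = of_nat n" using nrm2_eq_tr[of g n n] g by simp
  then show ?thesis by (metis of_real_eq_iff of_real_of_nat_eq)
qed

lemma near_one_central:
  assumes "C \<in> G" "\<And>A. A \<in> G \<Longrightarrow> spectrum (C - adj A * C * A) \<subseteq> \<real>" "nrm2 (C - 1\<^sub>m n) < 1/2" "A \<in> G"
  shows "A * C = C * A"
  using near_one_conjugate_eq[OF uni[OF assms(1)] uni[OF assms(4)] assms(2)[OF assms(4)] assms(3)]
    conj_eq_iff_commute[OF assms(4), of C C] assms(1) by simp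

lemma commutator_conj: "A \<in> G \<Longrightarrow> C \<in> G \<Longrightarrow> A * (adj A * C) - (adj A * C) * A = C - adj A * C * A"
  by simp

lemma det_unit: "g \<in> G \<Longrightarrow> cmod (det g) = 1"
proof -
  assume g: "g \<in> G"
  have "det (adj g) * det g = 1" using det_mult[of "adj g" n g] g by simp
  then have "cnj (det g) * det g = 1" using g by (simp add: det_adj[of _ n])
  then have "(cmod (det g))\<^sup>2 = 1"
    by (metis complex_norm_square mult.commute of_real_1 of_real_eq_iff)
  then show ?thesis using norm_ge_zero[of "det g"] by (auto simp: power2_eq_1_iff)
qed

abbreviation gp :: "complex mat monoid" where "gp \<equiv> GL n\<lparr>carrier := G\<rparr>"

sublocale gp: group gp
  using group.subgroup_imp_group[OF group_GL sub] .

lemma gp_inv [simp]: "g \<in> G \<Longrightarrow> inv\<^bsub>gp\<^esub> g = adj g"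
  using group.m_inv_consistent[OF group_GL sub] inv_eq by simp

lemma gp_pow: "g [^]\<^bsub>gp\<^esub> (k::nat) = g ^\<^sub>m k" if "g \<in> G"
  using that by (induction k) auto

lemma pow_G [simp]: "g \<in> G \<Longrightarrow> g ^\<^sub>m k \<in> G"
  by (induction k) auto

lemma gp_cj: "g \<in> G \<Longrightarrow> d \<in> G \<Longrightarrow> gp.cj d g = adj g * d * g"
  unfolding gp.cj_def by simp

lemma pow_card: "finite G \<Longrightarrow> g \<in> G \<Longrightarrow> g ^\<^sub>m card G = 1\<^sub>m n"
  using gp.pow_order_eq_1[of g] gp_pow[of g] by (simp add: Coset.order_def)

text \<open>
  Two commuting conjugates have a common eigenvector on which they differ, unless they are equal;
  the difference of the two eigenvalues is in the spectrum of the difference and must be \<open>0\<close>.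
\<close>

lemma nilpotent_commutators_abelian:
  assumes fin: "finite G"
    and nil: "\<And>A C. A \<in> G \<Longrightarrow> C \<in> G \<Longrightarrow> spectrum (C - adj A * C * A) \<subseteq> {0}"
    and xy: "x \<in> G" "y \<in> G"
  shows "x * y = y * x"
proof -
  have "x \<otimes>\<^bsub>GL n\<^esub> y = y \<otimes>\<^bsub>GL n\<^esub> x"
  proof (rule group.conj_commute_imp_abelian[OF group_GL sub fin _ xy])
    fix e g assume e: "e \<in> G" and g: "g \<in> G"
      and comm: "e \<otimes>\<^bsub>GL n\<^esub> (inv\<^bsub>GL n\<^esub> g \<otimes>\<^bsub>GL n\<^esub> e \<otimes>\<^bsub>GL n\<^esub> g) = (inv\<^bsub>GL n\<^esub> g \<otimes>\<^bsub>GL n\<^esub> e \<otimes>\<^bsub>GL n\<^esub> g) \<otimes>\<^bsub>GL n\<^esub> e"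
    define f where "f = adj g * e * g"
    have f: "f \<in> G" "e * f = f * e" using e g comm by (auto simp: f_def inv_eq)
    have "e = f"
    proof (rule ccontr)
      assume ne: "e \<noteq> f"
      have X: "e - f \<in> M n" using e f by simp
      have X0: "e - f \<noteq> 0\<^sub>m n n"
      proof
        assume z: "e - f = 0\<^sub>m n n"
        have "e = f"
        proof (rule mat_eqI[where n = n])
          fix i j assume ij: "i < n" "j < n"
          have "(e - f) $$ (i, j) = 0" using ij by (simp add: z)
          then show "e $$ (i, j) = f $$ (i, j)" using ij e f by (simp add: mat_idx[where n = n])
        qed (use e f in auto)
        with ne show False by simp
      qed
      have c0: "card G > 0" using fin e by (auto simp: card_gt_0_iff)
      obtain W l m where W: "W \<in> M n" "l ^ card G = 1" "m ^ card G = 1"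
          "e * W = l \<cdot>\<^sub>m W" "f * W = m \<cdot>\<^sub>m W" "(e - f) * W \<noteq> 0\<^sub>m n n"
        by (rule common_eigenvector[OF GM[OF e] pow_card[OF fin e] GM[OF f(1)] pow_card[OF fin f(1)] c0 f(2) X X0])
      have eq: "(e - f) * W = (l - m) \<cdot>\<^sub>m W"
        using W(1,4,5) e f by (simp add: mat_distrib[where n = n])
          (rule mat_eqI[where n = n]; simp add: mat_idx[where n = n] left_diff_distrib)
      have "W \<noteq> 0\<^sub>m n n" using W(6) X by auto
      then have "l - m \<in> spectrum (e - f)" using diff_eigenvalue[OF _ _ W(1,4,5)] e f by simp
      then have "l - m = 0" using nil[OF g e] by (auto simp: f_def)
      then have "(e - f) * W = 0\<^sub>m n n" using eq W(1) by (auto intro!: eq_matI)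
      with W(6) show False by simp
    qed
    then show "e \<otimes>\<^bsub>GL n\<^esub> g = g \<otimes>\<^bsub>GL n\<^esub> e"
      using conj_eq_iff_commute[OF g, of e e] e by (simp add: f_def)
  qed
  then show ?thesis by simp
qed

end

lemma nrm2_scalar: "nrm2 (c \<cdot>\<^sub>m 1\<^sub>m n - 1\<^sub>m n) = real n * (cmod (c - 1))\<^sup>2"
proof -
  have "(cmod ((c \<cdot>\<^sub>m 1\<^sub>m n - 1\<^sub>m n) $$ (i, j)))\<^sup>2 = (if i = j then (cmod (c - 1))\<^sup>2 else 0)"
    if "i < n" "j < n" for i j using that by auto
  then have "nrm2 (c \<cdot>\<^sub>m 1\<^sub>m n - 1\<^sub>m n) = (\<Sum>i<n. \<Sum>j<n. if i = j then (cmod (c - 1))\<^sup>2 else 0)"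
    by (simp add: nrm2_def)
  then show ?thesis by simp
qed

locale irreducible_unitary_group = unitary_group +
  assumes n1: "n > 1" and irr: "irreducible_mats n G"
begin

lemma commutes_scalar:
  assumes Y: "Y \<in> M n" and comm: "\<And>A. A \<in> G \<Longrightarrow> A * Y = Y * A"
  shows "\<exists>c. Y = c \<cdot>\<^sub>m 1\<^sub>m n"
proof -
  have "G \<subseteq> M n" "n > 0" using GM n1 by auto
  then obtain c where "Y = c \<cdot>\<^sub>m 1\<^sub>m n"
    using irreducible_commute_scalar[OF _ irr _ Y comm] by blast
  then show ?thesis by blast
qed

lemma not_abelian: "\<exists>x\<in>G. \<exists>y\<in>G. x * y \<noteq> y * x"
  using irreducible_not_commutative[OF n1 irr] GM by blast

text \<open>
  Scaling the elements of \<open>G\<close> to determinant \<open>1\<close> keeps irreducibility and nilpotency. The scaled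
  group is finite: near the identity it is central, so it consists there of scalars with
  determinant \<open>1\<close>, and these are roots of unity and isolated. A finite group with nilpotent
  commutators is abelian, but an irreducible one in dimension above \<open>1\<close> is not.
\<close>

lemma not_nilpotent_commutators:
  assumes nil: "\<And>A B. A \<in> G \<Longrightarrow> B \<in> G \<Longrightarrow> spectrum (A * B - B * A) \<subseteq> {0}"
  shows False
proof -
  define S where "S = {A \<in> M n. det A = 1 \<and> (\<exists>c. \<exists>g\<in>G. cmod c = 1 \<and> A = c \<cdot>\<^sub>m g)}"
  have cc: "c * cnj c = 1" if "cmod c = 1" for c using that by (metis complex_norm_square of_real_1 power_one)
  have Suni: "unitary_mat n A" if A: "A \<in> S" for A
  proof -
    obtain c g where "cmod c = 1" "g \<in> G" "A = c \<cdot>\<^sub>m g" using A by (auto simp: S_def)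
    then show ?thesis using cc[of c]
      by (simp add: unitary_mat_def mat_smult[where n = n] smult_smult_mat mult.commute)
  qed
  have SM: "A \<in> M n" "det A = 1" if "A \<in> S" for A using that by (auto simp: S_def)
  have Sadj: "adj A \<in> S" if A: "A \<in> S" for A
  proof -
    obtain c g where cg: "cmod c = 1" "g \<in> G" "A = c \<cdot>\<^sub>m g" using A by (auto simp: S_def)
    have "det (adj A) = 1" using SM[OF A] by (simp add: det_adj[of _ n])
    moreover have "adj A = cnj c \<cdot>\<^sub>m adj g" using cg by simp
    ultimately show ?thesis using cg SM[OF A] Gadj[OF cg(2)] unfolding S_def
      by (auto intro!: exI[of _ "cnj c"] bexI[of _ "adj g"])
  qed
  have Smult: "A * B \<in> S" if AB: "A \<in> S" "B \<in> S" for A B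
  proof -
    obtain c g where cg: "cmod c = 1" "g \<in> G" "A = c \<cdot>\<^sub>m g" using AB by (auto simp: S_def)
    obtain d h where dh: "cmod d = 1" "h \<in> G" "B = d \<cdot>\<^sub>m h" using AB by (auto simp: S_def)
    have "A * B = (c * d) \<cdot>\<^sub>m (g * h)"
      using cg dh by (simp add: mat_smult[where n = n] smult_smult_mat mult.commute)
    moreover have "det (A * B) = 1" using det_mult[of A n B] SM AB by simp
    moreover have "cmod (c * d) = 1" using cg dh by (simp add: norm_mult)
    ultimately show ?thesis using cg(2) dh(2) SM[OF AB(1)] SM[OF AB(2)] Gmult[of g h] unfolding S_def
      by (auto intro!: exI[of _ "c * d"] bexI[of _ "g * h"])
  qed
  have "1\<^sub>m n \<in> S" unfolding S_def by (auto intro!: exI[of _ 1] bexI[of _ "1\<^sub>m n"])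
  have subS: "subgroup S (GL n)"
  proof (rule group.subgroupI[OF group_GL])
    show "S \<subseteq> carrier (GL n)" using SM by auto
    show "S \<noteq> {}" using \<open>1\<^sub>m n \<in> S\<close> by blast
    show "inv\<^bsub>GL n\<^esub> A \<in> S" if A: "A \<in> S" for A
    proof -
      have "adj A * A = 1\<^sub>m n" using unitary_matD[OF Suni[OF A]] by simp
      then have "inv\<^bsub>GL n\<^esub> A = adj A"
        using group.inv_equality[OF group_GL[of n], of "adj A" A] SM[OF A] SM[OF Sadj[OF A]] by simp
      then show ?thesis using Sadj[OF A] by simp
    qed
    show "A \<otimes>\<^bsub>GL n\<^esub> B \<in> S" if "A \<in> S" "B \<in> S" for A B using Smult[OF that] by simp
  qed
  have Sg: "unitary_group n S" by (rule unitary_group.intro[OF subS Suni])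
  note Scancel = unitary_group.adj_cancel[OF Sg]
  have nilS: "spectrum (C - adj A * C * A) \<subseteq> {0}" if AC: "A \<in> S" "C \<in> S" for A C
  proof
    fix l assume l: "l \<in> spectrum (C - adj A * C * A)"
    obtain c g where cg: "cmod c = 1" "g \<in> G" "C = c \<cdot>\<^sub>m g" using AC by (auto simp: S_def)
    obtain d h where dh: "cmod d = 1" "h \<in> G" "A = d \<cdot>\<^sub>m h" using AC by (auto simp: S_def)
    have "adj A * C * A = (cnj d * c * d) \<cdot>\<^sub>m (adj h * g * h)"
      using cg dh by (simp add: mat_smult[where n = n] smult_smult_mat mult_ac)
    also have "cnj d * c * d = c" using cc[OF dh(1)] by (simp add: mult_ac)
    finally have e: "C - adj A * C * A = c \<cdot>\<^sub>m (g - adj h * g * h)"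
      using cg dh by (intro mat_eqI[where n = n]) (auto simp: mat_idx[where n = n] right_diff_distrib)
    have c0: "c \<noteq> 0" using cg(1) by auto
    have "g - adj h * g * h \<in> M n" using cg dh by simp
    then have "l / c \<in> spectrum (g - adj h * g * h)" using l c0 spectrum_smult unfolding e by blast
    then have "l / c = 0" using nil[of h "adj h * g"] commutator_conj[OF dh(2) cg(2)] cg dh by auto
    then show "l \<in> {0}" using c0 by simp
  qed
  have lift: "\<exists>c. cmod c = 1 \<and> c \<cdot>\<^sub>m g \<in> S" if g: "g \<in> G" for g
  proof -
    have di: "cmod (inverse (det g)) = 1" using det_unit[OF g] by (simp add: norm_inverse)
    have n0: "n > 0" using n1 by simp
    obtain c where c: "cmod c = 1" "c ^ n = inverse (det g)" using unit_root_exists[OF di n0] by blast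
    have "det g \<noteq> 0" using det_unit[OF g] by auto
    then have "det (c \<cdot>\<^sub>m g) = 1" using g c by (simp add: det_smult)
    then show ?thesis using c g unfolding S_def by (auto intro!: exI[of _ c])
  qed
  have commG: "A * Y = Y * A" if Y: "Y \<in> M n" "\<And>A. A \<in> S \<Longrightarrow> A * Y = Y * A" and A: "A \<in> G" for A Y
  proof -
    obtain c where c: "cmod c = 1" "c \<cdot>\<^sub>m A \<in> S" using lift[OF A] by blast
    have "c \<cdot>\<^sub>m (A * Y) = c \<cdot>\<^sub>m (Y * A)" using Y(2)[OF c(2)] Y(1) A by (simp add: mat_smult[where n = n])
    then have "inverse c \<cdot>\<^sub>m (c \<cdot>\<^sub>m (A * Y)) = inverse c \<cdot>\<^sub>m (c \<cdot>\<^sub>m (Y * A))" by simp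
    moreover have "c \<noteq> 0" using c by auto
    ultimately show ?thesis by (simp add: smult_smult_mat)
  qed
  have finS: "finite S"
  proof (rule ccontr)
    assume inf: "infinite S"
    define R where "R = {c::complex. c ^ n = 1} - {1}"
    have finR: "finite R" using finite_roots_unity[of n] n1 by (auto simp: R_def)
    \<comment> \<open>Below \<open>1/2\<close> an element is central; below the distance of \<open>1\<close> to the other roots of unity it is \<open>1\<close>.\<close>
    define T where "T = insert (1/2 :: real) ((\<lambda>c. (cmod (c - 1))\<^sup>2) ` R)"
    define \<delta> where "\<delta> = Min T"
    have T: "finite T" "T \<noteq> {}" using finR by (auto simp: T_def)
    have "\<And>t. t \<in> T \<Longrightarrow> t > 0" by (auto simp: T_def R_def)
    then have \<delta>: "\<delta> > 0" using Min_in[OF T] by (simp add: \<delta>_def)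
    have \<delta>le: "\<delta> \<le> 1/2" "\<And>c. c \<in> R \<Longrightarrow> \<delta> \<le> (cmod (c - 1))\<^sup>2"
      unfolding \<delta>_def by (rule Min_le[OF T(1)]; simp add: T_def)+
    obtain A B where AB: "A \<in> S" "B \<in> S" "A \<noteq> B" "nrm2 (A - B) < \<delta>"
      using pigeonhole_close[OF inf _ _ \<delta>, of n "real n"] SM(1) unitary_group.nrm2_G[OF Sg] by auto
    define C where "C = adj B * A"
    have C: "C \<in> S" unfolding C_def using Smult[OF Sadj[OF AB(2)] AB(1)] .
    have C1: "C \<noteq> 1\<^sub>m n"
    proof
      assume "C = 1\<^sub>m n"
      then have "B * (adj B * A) = B" using SM[OF AB(2)] by (simp add: C_def)
      then show False using Scancel(2)[OF AB(2) SM(1)[OF AB(1)]] AB(3) by simp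
    qed
    have "C - 1\<^sub>m n = adj B * (A - B)"
      using SM(1)[OF AB(1)] SM(1)[OF AB(2)] unitary_matD(3)[OF Suni[OF AB(2)]]
      by (simp add: C_def mat_distrib[where n = n])
    then have near: "nrm2 (C - 1\<^sub>m n) < \<delta>"
      using nrm2_unitary_left[OF Suni[OF Sadj[OF AB(2)]], of "A - B" n] AB SM(1)[OF AB(1)] SM(1)[OF AB(2)] by simp
    have "A' * C = C * A'" if A': "A' \<in> S" for A'
    proof (rule unitary_group.near_one_central[OF Sg C _ _ A'])
      show "spectrum (C - adj A * C * A) \<subseteq> \<real>" if "A \<in> S" for A using nilS[OF that C] by auto
      show "nrm2 (C - 1\<^sub>m n) < 1/2" using near \<delta>le(1) by simp
    qed
    then have "A' * C = C * A'" if "A' \<in> G" for A' using commG[OF SM(1)[OF C] _ that] by simp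
    from commutes_scalar[OF SM(1)[OF C] this] obtain c where c: "C = c \<cdot>\<^sub>m 1\<^sub>m n" by blast
    have "c ^ n = 1" using SM(2)[OF C] by (simp add: c det_smult)
    moreover have "c \<noteq> 1" using C1 c by auto
    ultimately have "\<delta> \<le> (cmod (c - 1))\<^sup>2" using \<delta>le(2) by (simp add: R_def)
    also have "\<dots> \<le> real n * (cmod (c - 1))\<^sup>2" using n1 by (simp add: mult_le_cancel_right1)
    also have "\<dots> = nrm2 (C - 1\<^sub>m n)" by (simp add: c nrm2_scalar)
    finally show False using near by simp
  qed
  have "A * B = B * A" if "A \<in> G" "B \<in> G" for A B
  proof (rule commG[OF _ _ that(1)])
    show "B \<in> M n" using that by simp
    show "A * B = B * A" if A: "A \<in> S" for A
    proof -
      have "B * A = A * B"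
      proof (rule commG[OF _ _ \<open>B \<in> G\<close>])
        show "A \<in> M n" using A SM by simp
        show "C * A = A * C" if "C \<in> S" for C
          using unitary_group.nilpotent_commutators_abelian[OF Sg finS nilS that A] by simp
      qed
      then show ?thesis by simp
    qed
  qed
  then show False using not_abelian by blast
qed

end

section \<open>Finiteness and involutions\<close>

text \<open>
  An eigenvector of \<open>K q\<close> for a nonzero eigenvalue lies in the range of the projection \<open>q\<close>, where
  \<open>K q\<close> and \<open>K\<close> agree.
\<close>

lemma block_spectrum_real:
  assumes M: "K \<in> M n" and q: "q \<in> M n" "q * q = q" "K * q = q * K" and real: "spectrum K \<subseteq> \<real>"
  shows "spectrum (K * q) \<subseteq> \<real>"
proof
  fix l assume "l \<in> spectrum (K * q)"
  then obtain v where v: "v \<in> carrier_vec n" "v \<noteq> 0\<^sub>v n" "(K * q) *\<^sub>v v = l \<cdot>\<^sub>v v"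
    using M q by (auto simp: spectrum_def eigenvalue_def eigenvector_def)
  show "l \<in> \<real>"
  proof (cases "l = 0")
    case False
    have "q * (K * q) = (q * K) * q" using M q(1) by (simp add: mat_assoc[where n = n])
    also have "\<dots> = K * (q * q)" unfolding q(3)[symmetric] using M q(1) by (simp add: mat_assoc[where n = n])
    finally have qKq: "q * (K * q) = K * q" by (simp add: q(2))
    have "l \<cdot>\<^sub>v (q *\<^sub>v v) = q *\<^sub>v (l \<cdot>\<^sub>v v)" using q(1) v(1) by (simp add: mult_mat_vec[of q n n])
    also have "\<dots> = (q * (K * q)) *\<^sub>v v" unfolding v(3)[symmetric]
      using M q(1) v(1) by (simp add: assoc_mult_mat_vec[of _ n n _ n])
    also have "\<dots> = l \<cdot>\<^sub>v v" unfolding qKq by (rule v(3))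
    finally have "inverse l \<cdot>\<^sub>v (l \<cdot>\<^sub>v (q *\<^sub>v v)) = inverse l \<cdot>\<^sub>v (l \<cdot>\<^sub>v v)" by simp
    then have "q *\<^sub>v v = v" using False by (simp add: smult_smult_assoc)
    then have "K *\<^sub>v v = l \<cdot>\<^sub>v v" using v M q(1) by (simp add: assoc_mult_mat_vec[of _ n n _ n])
    then have "l \<in> spectrum K" using v M by (auto simp: spectrum_def eigenvalue_def eigenvector_def)
    with real show ?thesis by blast
  qed simp
qed

lemma minus_eq_zeroD:
  assumes "A - B = 0\<^sub>m n n" "A \<in> M n" "B \<in> M n" shows "A = B"
proof (rule mat_eqI[where n = n])
  fix i j assume ij: "i < n" "j < n"
  have "(A - B) $$ (i, j) = 0" using ij by (simp add: assms(1))
  then show "A $$ (i, j) = B $$ (i, j)" using mat_idx(2)[OF assms(2,3) ij] by simp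
qed (use assms in auto)

text \<open>
  Two points of the unit circle at the same height are equal or mirror images in the imaginary
  axis.
\<close>

lemma unimodular_diff_real:
  assumes l: "cmod l = 1" and m: "cmod m = 1" and r: "l - m \<in> \<real>"
  shows "l = m \<or> l * m = -1"
proof -
  have c: "cnj l * l = 1" "cnj m * m = 1"
    using l m by (metis complex_norm_square mult.commute of_real_1 power_one)+
  have "cnj l - cnj m = l - m" using r by (metis Reals_cnj_iff complex_cnj_diff)
  then have "(l - m) * (l * m) = (cnj l - cnj m) * (l * m)" by simp
  also have "\<dots> = (cnj l * l) * m - (cnj m * m) * l" by (simp add: algebra_simps)
  also have "\<dots> = m - l" by (simp only: c mult_1)
  finally have "(l - m) * (l * m + 1) = 0" by (simp add: algebra_simps)
  then show ?thesis by (auto simp: eq_neg_iff_add_eq_0)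
qed

locale real_commutator_group = irreducible_unitary_group +
  assumes real: "\<And>A B. A \<in> G \<Longrightarrow> B \<in> G \<Longrightarrow> spectrum (A * B - B * A) \<subseteq> \<real>"
begin

lemma real_conj: "A \<in> G \<Longrightarrow> C \<in> G \<Longrightarrow> spectrum (C - adj A * C * A) \<subseteq> \<real>"
  using real[of A "adj A * C"] commutator_conj[of A C] by simp

text \<open>
  If \<open>c\<close> is in the group, then both a commutator and \<open>c\<close> times it have real spectrum, so
  for nonreal \<open>c\<close> the commutator is nilpotent.
\<close>

lemma scalar_sign:
  assumes c: "c \<cdot>\<^sub>m 1\<^sub>m n \<in> G"
  shows "c = 1 \<or> c = -1"
proof (rule ccontr)
  assume no: "\<not> (c = 1 \<or> c = -1)"
  have "(cmod c)\<^sup>2 * real n = real n" using nrm2_G[OF c] nrm2_G[OF Gone] by (simp add: nrm2_smult)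
  then have c1: "cmod c = 1" using n1 norm_ge_zero[of c] by (auto simp: power2_eq_1_iff)
  have nr: "c \<notin> \<real>"
  proof
    assume "c \<in> \<real>"
    then obtain r where "c = of_real r" by (auto simp: Reals_def)
    then show False using no c1 by (auto simp: abs_if split: if_splits)
  qed
  have c0: "c \<noteq> 0" using c1 by auto
  show False
  proof (rule not_nilpotent_commutators)
    fix A B assume AB: "A \<in> G" "B \<in> G"
    show "spectrum (A * B - B * A) \<subseteq> {0}"
    proof
      fix l assume l: "l \<in> spectrum (A * B - B * A)"
      have "c \<cdot>\<^sub>m A \<in> G" using Gmult[OF c AB(1)] AB by (simp add: mat_smult[where n = n])
      then have "spectrum ((c \<cdot>\<^sub>m A) * B - B * (c \<cdot>\<^sub>m A)) \<subseteq> \<real>" using real AB by blast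
      moreover have "(c \<cdot>\<^sub>m A) * B - B * (c \<cdot>\<^sub>m A) = c \<cdot>\<^sub>m (A * B - B * A)"
        using AB by (simp add: mat_smult[where n = n])
          (rule mat_eqI[where n = n]; simp add: mat_idx[where n = n] smult_idx[where n = n] right_diff_distrib del: index_mult_mat(1))
      ultimately have r: "spectrum (c \<cdot>\<^sub>m (A * B - B * A)) \<subseteq> \<real>" by simp
      have "l \<in> spectrum (inverse c \<cdot>\<^sub>m (c \<cdot>\<^sub>m (A * B - B * A)))" using l c0 by simp
      then have "l / inverse c \<in> spectrum (c \<cdot>\<^sub>m (A * B - B * A))"
        using AB c0 by (intro spectrum_smult[of _ n]) auto
      then have "c * l \<in> \<real>" using r by (auto simp: divide_inverse mult.commute)
      moreover have "l \<in> \<real>" using l real[OF AB] by blast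
      ultimately have "l \<noteq> 0 \<Longrightarrow> c \<in> \<real>" using Reals_divide[of "c * l" l] by simp
      then show "l \<in> {0}" using nr by auto
    qed
  qed
qed

text \<open>
  In an infinite group of unitary matrices there are two close elements, and their quotient is
  near the identity without being the identity. It is central, hence \<open>-1\<close>, which is not near \<open>1\<close>.
\<close>

theorem finite_G: "finite G"
proof (rule ccontr)
  assume inf: "infinite G"
  have "G \<subseteq> M n" by auto
  then obtain A B where AB: "A \<in> G" "B \<in> G" "A \<noteq> B" "nrm2 (A - B) < 1/2"
    using pigeonhole_close[OF inf, of n "real n" "1/2"] nrm2_G by auto
  define C where "C = adj B * A"
  have C: "C \<in> G" using AB by (simp add: C_def)
  have C1: "C \<noteq> 1\<^sub>m n"
  proof
    assume "C = 1\<^sub>m n"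
    then have "B * (adj B * A) = B" using AB by (simp add: C_def)
    then show False using AB by simp
  qed
  have "C - 1\<^sub>m n = adj B * (A - B)" using AB by (simp add: C_def mat_distrib[where n = n])
  then have near: "nrm2 (C - 1\<^sub>m n) < 1/2"
    using nrm2_unitary_left[OF uni[OF Gadj[OF AB(2)]], of "A - B" n] AB by simp
  have "A' * C = C * A'" if A': "A' \<in> G" for A'
    using near_one_central[OF C real_conj[OF _ C] near A'] .
  from commutes_scalar[OF GM[OF C] this] obtain c where c: "C = c \<cdot>\<^sub>m 1\<^sub>m n" by blast
  have "c = 1 \<or> c = -1" using scalar_sign[of c] C c by simp
  moreover have "c \<noteq> 1" using C1 c by auto
  ultimately have "c = -1" by simp
  then have "nrm2 (C - 1\<^sub>m n) = real n * (cmod (- 1 - 1))\<^sup>2" using c nrm2_scalar[of "-1" n] by simp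
  then show False using near n1 by simp
qed

definition N :: nat where "N = card G"

lemma N_pos: "N > 0"
  unfolding N_def card_gt_0_iff using finite_G Gone by blast

lemma pow_N [simp]: "g \<in> G \<Longrightarrow> g ^\<^sub>m N = 1\<^sub>m n"
  unfolding N_def by (rule pow_card[OF finite_G])

lemma root_unimodular: "l ^ N = 1 \<Longrightarrow> cmod (l :: complex) = 1"
  using N_pos by (metis norm_one norm_power power_eq_1_iff gr_implies_not0 norm_ge_zero)

lemma root_real_sq: "l ^ N = 1 \<Longrightarrow> l \<in> \<real> \<Longrightarrow> l * l = (1::complex)"
proof -
  assume "l ^ N = 1" "l \<in> \<real>"
  then obtain r where "l = of_real r" "\<bar>r\<bar> = 1" using root_unimodular[of l] by (auto simp: Reals_def)
  then show ?thesis by (auto simp: abs_if split: if_splits)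
qed

text \<open>
  On a common eigenvector the elements have unimodular eigenvalues \<open>l\<close> and \<open>m\<close> such that
  \<open>l - m\<close> and \<open>l\<^sup>2 - m\<^sup>2\<close> are real. The first condition gives \<open>l = m\<close> or \<open>l m = -1\<close>, and the
  second one excludes \<open>l\<^sup>2 \<noteq> m\<^sup>2\<close> because \<open>l\<^sup>2 m\<^sup>2 = 1\<close>.
\<close>

lemma commuting_conjugate_sq:
  assumes e: "e \<in> G" and g: "g \<in> G" and comm: "e * (adj g * e * g) = (adj g * e * g) * e"
  shows "e * e = (adj g * e * g) * (adj g * e * g)"
proof (rule ccontr)
  define f where "f = adj g * e * g"
  have f: "f \<in> G" using e g by (simp add: f_def)
  assume "e * e \<noteq> (adj g * e * g) * (adj g * e * g)"
  then have "e * e - f * f \<noteq> 0\<^sub>m n n" using minus_eq_zeroD[of "e * e" "f * f" n] e f by (auto simp: f_def)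
  moreover have "e * e - f * f \<in> M n" using e f by simp
  ultimately obtain W l m where W: "W \<in> M n" "l ^ N = 1" "m ^ N = 1" "e * W = l \<cdot>\<^sub>m W" "f * W = m \<cdot>\<^sub>m W"
      "(e * e - f * f) * W \<noteq> 0\<^sub>m n n"
    using common_eigenvector[OF GM[OF e] pow_N[OF e] GM[OF f] pow_N[OF f] N_pos comm[folded f_def]] by metis
  have W0: "W \<noteq> 0\<^sub>m n n" using W(6) e f by auto
  have eeW: "(e * e) * W = (l * l) \<cdot>\<^sub>m W" "(f * f) * W = (m * m) \<cdot>\<^sub>m W"
    using W(1,4,5) e f by (simp_all add: mat_assoc[where n = n] mat_smult[where n = n])
  have "l - m \<in> \<real>"
    using diff_eigenvalue[OF _ _ W(1,4,5) W0] real_conj[OF g e] e f by (auto simp: f_def)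
  then have 1: "l = m \<or> l * m = -1"
    using unimodular_diff_real root_unimodular W(2,3) by blast
  have ff: "f * f = adj g * (e * e) * g"
    using e g by (simp add: f_def mat_assoc[where n = n])
  have "l * l - m * m \<in> \<real>"
  proof -
    have "l * l - m * m \<in> spectrum (e * e - f * f)" using diff_eigenvalue[OF _ _ W(1) eeW W0] e f by simp
    moreover have "spectrum (e * e - f * f) \<subseteq> \<real>" using real_conj[OF g, of "e * e"] e unfolding ff by simp
    ultimately show ?thesis by blast
  qed
  then have 2: "l * l = m * m \<or> (l * l) * (m * m) = -1"
    using root_unimodular W(2,3) by (intro unimodular_diff_real) (auto simp: norm_mult)
  have "l * l = m * m"
  proof (cases "l = m")
    case False
    then have "(l * m) * (l * m) = 1" using 1 by auto
    then have "(l * l) * (m * m) = 1" by (simp add: mult_ac)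
    then show ?thesis using 2 by auto
  qed simp
  then have "(e * e - f * f) * W = 0\<^sub>m n n"
    using eeW W(1) e f by (simp add: mat_distrib[where n = n])
  with W(6) show False by simp
qed

lemma involution_adj: "d \<in> G \<Longrightarrow> d * d = 1\<^sub>m n \<Longrightarrow> adj d = d"
proof -
  assume d: "d \<in> G" "d * d = 1\<^sub>m n"
  have "adj d * (d * d) = d" using d(1) by simp
  then show ?thesis using d by simp
qed

text \<open>
  Involutions are hermitian, so their commutator is skew-hermitian.
\<close>

lemma involutions_commute:
  assumes a: "a \<in> G" "a * a = 1\<^sub>m n" and b: "b \<in> G" "b * b = 1\<^sub>m n"
  shows "a * b = b * a"
proof -
  have "adj (a * b - b * a) = (-1) \<cdot>\<^sub>m (a * b - b * a)"
    using a b by (simp add: adj_minus[of _ n] adj_mult[of _ n n _ n] involution_adj)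
      (rule mat_eqI[where n = n]; simp add: mat_idx[where n = n] smult_idx[where n = n] del: index_mult_mat(1))
  then have "a * b - b * a = 0\<^sub>m n n"
    using skew_real_spectrum_zero[of "a * b - b * a" n] real a b by simp
  then show ?thesis using minus_eq_zeroD a b by simp
qed

text \<open>
  Conjugation by \<open>v\<close> swaps \<open>d\<close> and \<open>d' = v d v\<inverse>\<close>. On the part where \<open>P = d d'\<close> is \<open>-1\<close>, these
  are opposite, so the commutators of \<open>d\<close> with \<open>d v\<close> and with \<open>v\<close> are there, up to sign, twice
  \<open>v\<close> and twice \<open>d v\<close>. These have real spectrum and finite order, so \<open>v\<^sup>2\<close> and \<open>(d v)\<^sup>2\<close> are
  \<open>1\<close> there, which contradicts \<open>(d v)\<^sup>2 = P v\<^sup>2\<close>.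
\<close>

lemma involution_commutes_if_square_does:
  assumes d: "d \<in> G" "d * d = 1\<^sub>m n" and v: "v \<in> G" and vvd: "(v * v) * d = d * (v * v)"
  shows "v * d = d * v"
proof (rule ccontr)
  assume ne: "v * d \<noteq> d * v"
  define d' where "d' = v * d * adj v"
  have d'G: "d' \<in> G" using d v by (simp add: d'_def)
  have vd: "v * d = d' * v" using d v by (simp add: d'_def mat_assoc[where n = n])
  have d'd': "d' * d' = 1\<^sub>m n"
  proof -
    have "d' * d' = v * (d * d) * adj v" using d(1) v by (simp add: d'_def mat_assoc[where n = n])
    then show ?thesis using v by (simp add: d(2))
  qed
  have dd': "d' * d = d * d'" using involutions_commute[OF d'G d'd' d] .
  have vd': "v * d' = d * v"
  proof -
    have "v * d' = ((v * v) * d) * adj v" using d(1) v by (simp add: d'_def mat_assoc[where n = n])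
    then show ?thesis unfolding vvd using d(1) v by (simp add: mat_assoc[where n = n])
  qed
  define P where "P = d * d'"
  have PG: "P \<in> G" using d d'G by (simp add: P_def)
  have Pd: "P * d = d'" "d * P = d'" "d' * P = d" "P * d' = d" "P * P = 1\<^sub>m n"
  proof -
    show dP: "d * P = d'" unfolding P_def using d d'G by (simp add: mat_assoc[where n = n, symmetric] del: assoc_mult_mat)
    show "P * d = d'"
      using d d'G dP by (simp add: P_def dd' mat_assoc[where n = n])
    show Pd': "P * d' = d" using d'd' d d'G by (simp add: P_def mat_assoc[where n = n])
    show "d' * P = d" unfolding P_def dd'[symmetric] using d'd' d d'G
      by (simp add: mat_assoc[where n = n, symmetric] del: assoc_mult_mat)
    have "P * P = (P * d) * d'" using d(1) d'G PG by (simp add: P_def mat_assoc[where n = n])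
    then show "P * P = 1\<^sub>m n" using \<open>P * d = d'\<close> d'd' by simp
  qed
  have vP: "v * P = P * v"
  proof -
    have "v * P = (v * d) * d'" using d(1) d'G v by (simp add: P_def mat_assoc[where n = n])
    also have "\<dots> = d' * (v * d')" unfolding vd using d'G v by (simp add: mat_assoc[where n = n])
    also have "\<dots> = (d' * d) * v" unfolding vd' using d(1) d'G v by (simp add: mat_assoc[where n = n])
    finally show ?thesis by (simp add: dd' P_def)
  qed
  define Y where "Y = 1\<^sub>m n - P"
  have YM: "Y \<in> M n" using PG by (simp add: Y_def)
  have PY: "P * Y = (-1) \<cdot>\<^sub>m Y"
    using PG by (simp add: Y_def mat_distrib[where n = n] Pd)
      (rule mat_eqI[where n = n]; simp add: mat_idx[where n = n] smult_idx[where n = n])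
  have Y0: "Y \<noteq> 0\<^sub>m n n"
  proof
    assume "Y = 0\<^sub>m n n"
    then have "1\<^sub>m n = P" using minus_eq_zeroD[of "1\<^sub>m n" P n] PG by (simp add: Y_def)
    then have "P * d = 1\<^sub>m n * d" by simp
    then have "d' = d" using Pd(1) d by simp
    then show False using vd ne by simp
  qed
  have vY: "v * Y = Y * v" using v PG by (simp add: Y_def mat_distrib[where n = n] vP)
  define w where "w = d * v"
  have wG: "w \<in> G" using d v by (simp add: w_def)
  have wY: "w * Y = Y * w"
  proof -
    have "w * P = P * w"
    proof -
      have "w * P = d * (P * v)" using d(1) v PG vP by (simp add: w_def mat_assoc[where n = n])
      also have "\<dots> = (d * P) * v" using d(1) v PG by (simp add: mat_assoc[where n = n])
      also have "\<dots> = (P * d) * v" by (simp add: Pd)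
      finally show ?thesis using d(1) v PG by (simp add: w_def mat_assoc[where n = n])
    qed
    then show ?thesis using wG PG by (simp add: Y_def mat_distrib[where n = n])
  qed
  have sq1: "l * l = 1"
    if W: "W \<in> M n" "W \<noteq> 0\<^sub>m n n" "P * W = (-1) \<cdot>\<^sub>m W" "x * W = l \<cdot>\<^sub>m W" "l ^ N = 1" "x \<in> G"
      and sp: "spectrum (P * x - x) \<subseteq> \<real> \<or> spectrum (x - P * x) \<subseteq> \<real>" for W l x
  proof -
    have PxW: "(P * x) * W = (- l) \<cdot>\<^sub>m W"
      using W PG by (simp add: mat_assoc[where n = n] mat_smult[where n = n])
    have 1: "- l - l \<in> spectrum (P * x - x)"
      using W PG PxW by (intro diff_eigenvalue[of _ n]) auto
    have 2: "l - (- l) \<in> spectrum (x - P * x)"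
      using W PG PxW by (intro diff_eigenvalue[of _ n]) auto
    have "2 * l \<in> \<real>" using sp
    proof
      assume "spectrum (P * x - x) \<subseteq> \<real>"
      then have "- (- l - l) \<in> \<real>" using 1 by (intro Reals_minus) blast
      then show ?thesis by simp
    next
      assume "spectrum (x - P * x) \<subseteq> \<real>"
      then have "l - (- l) \<in> \<real>" using 2 by blast
      then show ?thesis by simp
    qed
    then have "2 * l / 2 \<in> \<real>" by (intro Reals_divide) auto
    then show ?thesis using root_real_sq W(5) by simp
  qed
  have sv: "spectrum (P * v - v) \<subseteq> \<real>"
  proof -
    have "w * d = P * v" using d d'G v PG vd by (simp add: w_def P_def mat_assoc[where n = n])
    moreover have "d * w = v" using d v by (simp add: w_def mat_assoc[where n = n, symmetric] del: assoc_mult_mat)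
    ultimately show ?thesis using real[OF wG d(1)] by simp
  qed
  have sw: "spectrum (w - P * w) \<subseteq> \<real>"
  proof -
    have "P * w = v * d" using d(1) v PG Pd by (simp add: w_def vd mat_assoc[where n = n, symmetric] del: assoc_mult_mat)
    then show ?thesis using real[OF d(1) v] by (simp add: w_def)
  qed
  have vvY: "v * (v * Y) = Y"
  proof (rule ccontr)
    assume "v * (v * Y) \<noteq> Y"
    then have X0: "v * (v * Y) - Y \<noteq> 0\<^sub>m n n" using minus_eq_zeroD v YM by auto
    have XM: "v * (v * Y) - Y \<in> M n" using v YM by simp
    obtain Q l where Q: "Q \<in> M n" "l ^ N = 1" "v * Q = l \<cdot>\<^sub>m Q" "(v * (v * Y) - Y) * Q \<noteq> 0\<^sub>m n n"
      "\<And>B. B \<in> M n \<Longrightarrow> v * B = B * v \<Longrightarrow> B * Q = Q * B"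
      using finite_order_eigenprojection[OF GM[OF v] N_pos pow_N[OF v] XM X0] by blast
    define W where "W = Y * Q"
    have WM: "W \<in> M n" using YM Q by (simp add: W_def)
    have vW: "v * W = l \<cdot>\<^sub>m W"
    proof -
      have "v * W = (v * Y) * Q" using v YM Q(1) by (simp add: W_def mat_assoc[where n = n])
      also have "\<dots> = Y * (v * Q)" unfolding vY using v YM Q(1) by (simp add: mat_assoc[where n = n])
      finally show ?thesis using YM Q by (simp add: W_def mat_smult[where n = n])
    qed
    have PW: "P * W = (-1) \<cdot>\<^sub>m W"
    proof -
      have "P * W = (P * Y) * Q" using PG YM Q(1) by (simp add: W_def mat_assoc[where n = n])
      then show ?thesis using YM Q by (simp add: PY W_def mat_smult[where n = n])
    qed
    have XQ: "(v * (v * Y) - Y) * Q = v * (v * W) - W"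
      using v YM Q(1) by (simp add: W_def mat_distrib[where n = n] mat_assoc[where n = n])
    have "W \<noteq> 0\<^sub>m n n" using Q(4) v unfolding XQ by auto
    then have "l * l = 1" using sq1[OF WM _ PW vW Q(2) v] sv by simp
    then have "v * (v * W) = W" using v WM by (simp add: vW mat_smult[where n = n])
    then show False using Q(4) WM unfolding XQ by simp
  qed
  obtain Q l where Q: "Q \<in> M n" "l ^ N = 1" "w * Q = l \<cdot>\<^sub>m Q" "Y * Q \<noteq> 0\<^sub>m n n"
    "\<And>B. B \<in> M n \<Longrightarrow> w * B = B * w \<Longrightarrow> B * Q = Q * B"
    using finite_order_eigenprojection[OF GM[OF wG] N_pos pow_N[OF wG] YM Y0] by blast
  define W where "W = Y * Q"
  have WM: "W \<in> M n" using YM Q by (simp add: W_def)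
  have wW: "w * W = l \<cdot>\<^sub>m W"
  proof -
    have "w * W = (w * Y) * Q" using wG YM Q(1) by (simp add: W_def mat_assoc[where n = n])
    also have "\<dots> = Y * (w * Q)" unfolding wY using wG YM Q(1) by (simp add: mat_assoc[where n = n])
    finally show ?thesis using YM Q by (simp add: W_def mat_smult[where n = n])
  qed
  have PW: "P * W = (-1) \<cdot>\<^sub>m W"
  proof -
    have "P * W = (P * Y) * Q" using PG YM Q(1) by (simp add: W_def mat_assoc[where n = n])
    then show ?thesis using YM Q by (simp add: PY W_def mat_smult[where n = n])
  qed
  have W0: "W \<noteq> 0\<^sub>m n n" using Q(4) by (simp add: W_def)
  have "l * l = 1" using sq1[OF WM W0 PW wW Q(2) wG] sw by simp
  then have "w * (w * W) = W" using wG WM by (simp add: wW mat_smult[where n = n])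
  moreover have "w * (w * W) = P * (v * (v * W))"
  proof -
    have "w * (w * W) = d * ((v * d) * (v * W))" using d(1) v WM by (simp add: w_def mat_assoc[where n = n])
    then show ?thesis unfolding vd using d(1) d'G v WM by (simp add: P_def mat_assoc[where n = n])
  qed
  moreover have "v * (v * W) = W"
  proof -
    have "v * (v * W) = (v * (v * Y)) * Q" using v YM Q(1) by (simp add: W_def mat_assoc[where n = n])
    then show ?thesis by (simp add: vvY W_def)
  qed
  ultimately have "W = (-1) \<cdot>\<^sub>m W" using PW by simp
  then have WW: "W = (-1) \<cdot>\<^sub>m W" .
  have "W = 0\<^sub>m n n"
  proof (rule mat_eqI[where n = n])
    fix i j assume ij: "i < n" "j < n"
    have "W $$ (i, j) = ((-1) \<cdot>\<^sub>m W) $$ (i, j)" using WW by simp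
    also have "\<dots> = - (W $$ (i, j))" using smult_idx[OF WM ij, of "-1"] by simp
    finally show "W $$ (i, j) = 0\<^sub>m n n $$ (i, j)" using ij by simp
  qed (use WM in auto)
  with W0 show False by simp
qed

end

section \<open>Elements of order four\<close>

lemma comm_mult: "\<lbrakk>A * B = B * A; A * C = C * A; A \<in> M n; B \<in> M n; C \<in> M n\<rbrakk> \<Longrightarrow> A * (B * C) = (B * C) * A"
proof -
  assume a: "A * B = B * A" "A * C = C * A" "A \<in> M n" "B \<in> M n" "C \<in> M n"
  have "A * (B * C) = (A * B) * C" using a(3-5) by (simp add: mat_assoc[where n = n])
  also have "\<dots> = B * (A * C)" unfolding a(1) using a(3-5) by (simp add: mat_assoc[where n = n])
  also have "\<dots> = (B * C) * A" unfolding a(2) using a(3-5) by (simp add: mat_assoc[where n = n])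
  finally show ?thesis .
qed

lemma comm_minus: "\<lbrakk>A * B = B * A; A * C = C * A; A \<in> M n; B \<in> M n; C \<in> M n\<rbrakk> \<Longrightarrow> A * (B - C) = (B - C) * A"
  by (simp add: mat_distrib[where n = n])

lemma comm_add: "\<lbrakk>A * B = B * A; A * C = C * A; A \<in> M n; B \<in> M n; C \<in> M n\<rbrakk> \<Longrightarrow> A * (B + C) = (B + C) * A"
  by (simp add: mat_distrib[where n = n])

lemma comm_smult: "\<lbrakk>A * B = B * A; A \<in> M n; B \<in> M n\<rbrakk> \<Longrightarrow> A * (c \<cdot>\<^sub>m B) = (c \<cdot>\<^sub>m B) * A"
  by (simp add: mat_smult[where n = n])

text \<open>
  The projections \<open>(1 - z) / 2\<close> and \<open>(1 + z) / 2\<close> to the eigenspaces of an involution \<open>z\<close>.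
\<close>

definition half_minus :: "nat \<Rightarrow> complex mat \<Rightarrow> complex mat" where
  "half_minus n z = (1/2) \<cdot>\<^sub>m (1\<^sub>m n - z)"

definition half_plus :: "nat \<Rightarrow> complex mat \<Rightarrow> complex mat" where
  "half_plus n z = (1/2) \<cdot>\<^sub>m (1\<^sub>m n + z)"

lemma half_props:
  assumes z: "z \<in> M n" "z * z = 1\<^sub>m n"
  shows "half_minus n z \<in> M n" "half_plus n z \<in> M n"
    "half_minus n z * half_minus n z = half_minus n z" "half_plus n z * half_plus n z = half_plus n z"
    "half_minus n z + half_plus n z = 1\<^sub>m n"
    "z * half_minus n z = (-1) \<cdot>\<^sub>m half_minus n z" "z * half_plus n z = half_plus n z"
proof -
  show M: "half_minus n z \<in> M n" "half_plus n z \<in> M n" using z by (auto simp: half_minus_def half_plus_def)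
  show "half_minus n z + half_plus n z = 1\<^sub>m n"
    using z by (intro mat_eqI[where n = n]) (auto simp: half_minus_def half_plus_def mat_idx[where n = n] field_simps)
  show m: "z * half_minus n z = (-1) \<cdot>\<^sub>m half_minus n z"
    using z(1) by (simp add: half_minus_def mat_smult[where n = n] mat_distrib[where n = n] z(2))
      (rule mat_eqI[where n = n]; simp add: mat_idx[where n = n] field_simps)
  show p: "z * half_plus n z = half_plus n z"
    using z(1) by (simp add: half_plus_def mat_smult[where n = n] mat_distrib[where n = n] z(2))
      (rule mat_eqI[where n = n]; simp add: mat_idx[where n = n] add.commute)
  have "half_minus n z * half_minus n z = (1/2) \<cdot>\<^sub>m (half_minus n z - z * half_minus n z)"
    using z(1) M by (subst half_minus_def) (simp add: mat_smult[where n = n] mat_distrib[where n = n])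
  also have "\<dots> = half_minus n z" unfolding m using M
    by (intro mat_eqI[where n = n]) (auto simp: mat_idx[where n = n] field_simps)
  finally show "half_minus n z * half_minus n z = half_minus n z" .
  have "half_plus n z * half_plus n z = (1/2) \<cdot>\<^sub>m (half_plus n z + z * half_plus n z)"
    using z(1) M by (subst half_plus_def) (simp add: mat_smult[where n = n] mat_distrib[where n = n])
  also have "\<dots> = half_plus n z" unfolding p using M
    by (intro mat_eqI[where n = n]) (auto simp: mat_idx[where n = n] field_simps)
  finally show "half_plus n z * half_plus n z = half_plus n z" .
qed

lemma half_comm:
  assumes "A * z = z * A" "A \<in> M n" "z \<in> M n"
  shows "A * half_minus n z = half_minus n z * A" "A * half_plus n z = half_plus n z * A"
  using assms by (auto simp: half_minus_def half_plus_def intro!: comm_smult[of _ _ n] comm_minus[of _ _ _ n] comm_add[of _ _ _ n])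

lemma half_adj:
  assumes "adj z = z" "z \<in> M n"
  shows "adj (half_minus n z) = half_minus n z" "adj (half_plus n z) = half_plus n z"
  using assms by (auto simp: half_minus_def half_plus_def adj_minus[of _ n] adj_add[of _ n])

context real_commutator_group begin

definition order4 :: "complex mat \<Rightarrow> bool" where
  "order4 w \<longleftrightarrow> w \<in> G \<and> (w * w) * (w * w) = 1\<^sub>m n"

lemma order4_commutes:
  assumes "order4 w" "d \<in> G" "d * d = 1\<^sub>m n"
  shows "w * d = d * w"
  using assms involution_commutes_if_square_does[OF assms(2,3), of w]
    involutions_commute[of "w * w" d] by (auto simp: order4_def)

lemma order4_sq: "order4 w \<Longrightarrow> w * w \<in> G" "order4 w \<Longrightarrow> (w * w) * (w * w) = 1\<^sub>m n"
  by (auto simp: order4_def)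

lemma order4_adj:
  assumes "order4 w" shows "adj w = (w * w) * w"
proof -
  have w: "w \<in> G" using assms by (simp add: order4_def)
  have "adj w = adj w * ((w * w) * (w * w))" using order4_sq(2)[OF assms] w by simp
  also have "\<dots> = (adj w * w) * (w * (w * w))" using w by (simp only: mat_assoc[where n = n] GM mult_M Gadj)
  finally show ?thesis using w by (simp add: mat_assoc[where n = n])
qed

lemma order4_conj:
  assumes "order4 w" "x \<in> G" shows "order4 (adj x * w * x)" "(adj x * w * x) * (adj x * w * x) = adj x * (w * w) * x"
proof -
  have w: "w \<in> G" using assms by (simp add: order4_def)
  show 1: "(adj x * w * x) * (adj x * w * x) = adj x * (w * w) * x"
    using w assms(2) by (simp add: mat_assoc[where n = n])
  have "(adj x * (w * w) * x) * (adj x * (w * w) * x) = adj x * ((w * w) * (w * w)) * x"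
    using w assms(2) by (simp add: mat_assoc[where n = n])
  also have "\<dots> = 1\<^sub>m n" using assms order4_sq(2) by simp
  finally show "order4 (adj x * w * x)" unfolding order4_def 1 using w assms(2) by simp
qed

text \<open>
  On the part where \<open>w\<^sup>2 = -1\<close>, the element \<open>w\<close> and its conjugate by \<open>x\<close> are both
  skew-hermitian, so their difference, which has real spectrum, vanishes there.
\<close>

lemma order4_commute_half:
  assumes w: "order4 w" and x: "order4 x"
  shows "(x * w - w * x) * half_minus n (w * w) = 0\<^sub>m n n"
proof -
  have wG: "w \<in> G" "x \<in> G" using w x by (auto simp: order4_def)
  define z where "z = w * w"
  have z: "z \<in> G" "z * z = 1\<^sub>m n" using order4_sq[OF w] by (auto simp: z_def)
  define q where "q = half_minus n z"
  have q: "q \<in> M n" "q * q = q" "z * q = (-1) \<cdot>\<^sub>m q" using half_props[OF GM[OF z(1)] z(2)] by (auto simp: q_def)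
  define y where "y = adj x * w * x"
  have y: "order4 y" "y \<in> G" "y * y = adj x * z * x"
    using order4_conj[OF w wG(2)] by (auto simp: y_def z_def order4_def)
  have xz: "x * z = z * x" using order4_commutes[OF x z] .
  have yy: "y * y = z" unfolding y(3) using conj_eq_iff_commute[OF wG(2) GM[OF z(1)] GM[OF z(1)]] xz by simp
  have wz: "w * z = z * w" and yz: "y * z = z * y" using order4_commutes[OF w z] order4_commutes[OF y(1) z] by auto
  have Kq: "(w - y) * q = q * (w - y)"
  proof -
    have "z * (w - y) = (w - y) * z" using wz yz wG y z by (intro comm_minus[of _ _ _ n]) auto
    then show ?thesis unfolding q_def using wG y z by (intro half_comm) auto
  qed
  have "spectrum (w - y) \<subseteq> \<real>" using real_conj[OF wG(2,1)] by (simp add: y_def)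
  then have r: "spectrum ((w - y) * q) \<subseteq> \<real>" using block_spectrum_real[OF _ q(1,2) Kq] wG y by simp
  have qz: "q * z = (-1) \<cdot>\<^sub>m q"
    using half_comm(1)[of z z n] z q(3) by (simp add: q_def)
  have "adj ((w - y) * q) = q * (z * w - z * y)"
    using wG y q half_adj(1)[OF involution_adj[OF z] GM[OF z(1)]] order4_adj[OF w] order4_adj[OF y(1)] yy
    by (simp add: adj_mult[of _ n n _ n] adj_minus[of _ n] q_def z_def)
  also have "\<dots> = (q * z) * (w - y)" using wG y q z by (simp add: mat_distrib[where n = n] mat_assoc[where n = n])
  also have "\<dots> = (-1) \<cdot>\<^sub>m ((w - y) * q)" unfolding qz Kq using wG y q by (simp add: mat_smult[where n = n])
  finally have "(w - y) * q = 0\<^sub>m n n" using r wG y q by (intro skew_real_spectrum_zero) auto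
  then have "w * q - y * q = 0\<^sub>m n n" using wG y q by (simp add: mat_distrib[where n = n])
  then have wq: "w * q = y * q" using minus_eq_zeroD wG y q by simp
  have "(x * w) * q = x * (y * q)" using wG q wq by (simp add: mat_assoc[where n = n])
  also have "\<dots> = (w * x) * q" using wG q by (simp add: y_def mat_assoc[where n = n])
  finally have "(x * w - w * x) * q = (w * x) * q - (w * x) * q" using wG q by (simp add: mat_distrib[where n = n])
  then show ?thesis using wG q by (simp add: q_def z_def)
qed

text \<open>
  The commutator vanishes where \<open>w\<^sup>2\<close> or \<open>x\<^sup>2\<close> is \<open>-1\<close> by the preceding lemma. On the
  remaining part both elements are hermitian, so the commutator is skew-hermitian.
\<close>

lemma order4_commute:
  assumes w: "order4 w" and x: "order4 x"
  shows "x * w = w * x"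
proof -
  have wG: "w \<in> G" "x \<in> G" using w x by (auto simp: order4_def)
  define z where "z = w * w"
  define y where "y = x * x"
  have z: "z \<in> G" "z * z = 1\<^sub>m n" and y: "y \<in> G" "y * y = 1\<^sub>m n"
    using order4_sq w x by (auto simp: z_def y_def)
  have comms: "w * z = z * w" "w * y = y * w" "x * z = z * x" "x * y = y * x" "z * y = y * z"
    using order4_commutes[OF w z] order4_commutes[OF w y] order4_commutes[OF x z] order4_commutes[OF x y]
      involutions_commute[OF z y] by auto
  define T where "T = x * w - w * x"
  have T: "T \<in> M n" using wG by (simp add: T_def)
  have zT: "z * T = T * z" "y * T = T * y"
    unfolding T_def using comms wG z y by (auto intro!: comm_minus[of _ _ _ n] comm_mult[of _ _ _ n])
  let ?p = "half_plus n z" and ?p' = "half_plus n y" and ?q = "half_minus n z" and ?q' = "half_minus n y"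
  note hz = half_props[OF GM[OF z(1)] z(2)] and hy = half_props[OF GM[OF y(1)] y(2)]
  have Tq: "T * ?q = 0\<^sub>m n n" using order4_commute_half[OF w x] by (simp add: T_def z_def)
  have Tq': "T * ?q' = 0\<^sub>m n n"
  proof -
    have "T = (-1) \<cdot>\<^sub>m (w * x - x * w)"
      unfolding T_def using wG by (intro mat_eqI[where n = n]) (auto simp: mat_idx[where n = n] simp del: index_mult_mat(1))
    then show ?thesis using order4_commute_half[OF x w] wG hy(1) by (simp add: y_def mat_smult[where n = n])
  qed
  have Tp: "T * ?p = ?p * T" "T * ?p' = ?p' * T"
    using half_comm(2)[of T z n] half_comm(2)[of T y n] zT T z y by auto
  have Tq'c: "T * ?q' = ?q' * T" using half_comm(1)[of T y n] zT T y by auto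
  have pp': "?p * ?p' = ?p' * ?p" "?p * ?q' = ?q' * ?p"
  proof -
    have "y * ?p = ?p * y" using half_comm(2)[of y z n] comms z y by auto
    then show "?p * ?p' = ?p' * ?p" "?p * ?q' = ?q' * ?p" using half_comm[of ?p y n] hz(2) y by auto
  qed
  define R where "R = ?p * ?p'"
  have R: "R \<in> M n" using hz(2) hy(2) by (simp add: R_def)
  have RR: "R * R = R"
  proof -
    have "R * R = ?p * (?p' * ?p) * ?p'" using hz(2) hy(2) by (simp add: R_def mat_assoc[where n = n])
    also have "\<dots> = (?p * ?p) * (?p' * ?p')" unfolding pp'(1)[symmetric] using hz(2) hy(2) by (simp only: mat_assoc[where n = n] mult_M)
    finally show ?thesis by (simp add: hz(4) hy(4) R_def)
  qed
  have TR: "T * R = R * T" unfolding R_def using Tp T hz(2) hy(2) by (intro comm_mult[of _ _ _ n]) auto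
  have zyR: "(z * y) * R = R" "z * y * R = R"
  proof -
    have "(z * y) * R = z * (y * (?p' * ?p))" using z y hz(2) hy(2) by (simp add: R_def pp'(1) mat_assoc[where n = n])
    also have "\<dots> = z * ((y * ?p') * ?p)" using z y hz(2) hy(2) by (simp only: mat_assoc[where n = n] mult_M GM)
    also have "\<dots> = z * (?p * ?p')" by (simp add: hy(7) pp'(1))
    also have "\<dots> = (z * ?p) * ?p'" using z hz(2) hy(2) by (simp only: mat_assoc[where n = n] mult_M GM)
    finally show "(z * y) * R = R" "z * y * R = R" by (simp_all add: hz(7) R_def)
  qed
  have Rzy: "R * (z * y) = R"
  proof -
    have "z * R = R * z" "y * R = R * y" unfolding R_def
      using half_comm(2)[of z z n] half_comm(2)[of z y n] half_comm(2)[of y z n] half_comm(2)[of y y n] comms z y hz(2) hy(2)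
      by (auto intro!: comm_mult[of _ _ _ n])
    then have "R * (z * y) = (z * y) * R" using R z y by (intro comm_mult[of _ _ _ n]) auto
    then show ?thesis using zyR by simp
  qed
  have Radj: "adj R = R"
    using half_adj(2)[OF involution_adj[OF z] GM[OF z(1)]] half_adj(2)[OF involution_adj[OF y] GM[OF y(1)]] hz(2) hy(2)
    by (simp add: R_def adj_mult[of _ n n _ n] pp'(1))
  have adjT: "adj T = (-1) \<cdot>\<^sub>m ((z * y) * T)"
  proof -
    have aw: "adj w = z * w" "adj x = y * x" using order4_adj[OF w] order4_adj[OF x] by (simp_all add: z_def y_def)
    have "adj T = adj w * adj x - adj x * adj w" using wG by (simp add: T_def adj_minus[of _ n] adj_mult[of _ n n _ n])
    also have "adj w * adj x = z * ((w * y) * x)" unfolding aw using wG z y by (simp add: mat_assoc[where n = n])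
    also have "\<dots> = (z * y) * (w * x)" unfolding comms(2) using wG z y by (simp add: mat_assoc[where n = n])
    also have "adj x * adj w = y * ((x * z) * w)" unfolding aw using wG z y by (simp add: mat_assoc[where n = n])
    also have "\<dots> = (y * z) * (x * w)" unfolding comms(3) using wG z y by (simp add: mat_assoc[where n = n])
    also have "\<dots> = (z * y) * (x * w)" by (simp add: comms(5))
    finally have "adj T = (z * y) * (w * x) - (z * y) * (x * w)" .
    also have "\<dots> = (-1) \<cdot>\<^sub>m ((z * y) * T)"
    proof -
      have zy: "z * y \<in> G" using z y by simp
      define S where "S = z * y"
      have "S * (w * x) - S * (x * w) = (-1) \<cdot>\<^sub>m (S * (x * w) - S * (w * x))"
        using zy wG unfolding S_def[symmetric]
        by (intro mat_eqI[where n = n]) (auto simp: mat_idx[where n = n] simp del: index_mult_mat(1))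
      also have "S * (x * w) - S * (w * x) = S * T" using zy wG by (simp add: T_def S_def mat_distrib[where n = n])
      finally show ?thesis by (simp add: S_def)
    qed
    finally show ?thesis .
  qed
  have "adj (T * R) = R * adj T" using T R by (simp add: adj_mult[of _ n n _ n] Radj)
  also have "\<dots> = (-1) \<cdot>\<^sub>m ((R * (z * y)) * T)"
    unfolding adjT using R T z y by (simp add: mat_smult[where n = n] mat_assoc[where n = n])
  also have "\<dots> = (-1) \<cdot>\<^sub>m (T * R)" by (simp add: Rzy TR)
  finally have skew: "adj (T * R) = (-1) \<cdot>\<^sub>m (T * R)" .
  have "spectrum T \<subseteq> \<real>" using real wG by (simp add: T_def)
  then have "spectrum (T * R) \<subseteq> \<real>" using block_spectrum_real[OF T R RR TR] by simp
  then have TR0: "T * R = 0\<^sub>m n n" using skew T R by (intro skew_real_spectrum_zero) auto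
  have "T = T * (?q + ?p)" using T by (simp add: hz(5))
  also have "\<dots> = T * ?q + T * ?p" using T hz(1,2) by (simp add: mat_distrib[where n = n])
  also have "\<dots> = T * ?p" using T hz(2) by (simp add: Tq)
  finally have Tpp: "T = T * ?p" .
  have "T = (T * ?p) * (?q' + ?p')" using T hz(2) by (simp add: hy(5) Tpp[symmetric])
  also have "\<dots> = (T * ?p) * ?q' + T * R" using T hz(2) hy(1,2) by (simp add: mat_distrib[where n = n] R_def mat_assoc[where n = n])
  also have "(T * ?p) * ?q' = (T * ?q') * ?p" using T hz(2) hy(1) by (simp add: mat_assoc[where n = n] pp'(2))
  also have "\<dots> = 0\<^sub>m n n" using hz(2) by (simp add: Tq')
  finally have "T = 0\<^sub>m n n" by (simp add: TR0)
  then show ?thesis using minus_eq_zeroD[of "x * w" "w * x" n] wG by (simp add: T_def)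
qed

text \<open>
  Such a \<open>w\<close> commutes with its conjugates, so its square is equal to the squares of these and thus
  central, hence \<open>-1\<close>. So \<open>w\<close> and its conjugates are skew-hermitian, their differences vanish, and
  \<open>w\<close> is a scalar.
\<close>

theorem no_order_four:
  assumes w: "order4 w" shows "w * w = 1\<^sub>m n"
proof (rule ccontr)
  assume ne: "w * w \<noteq> 1\<^sub>m n"
  have wG: "w \<in> G" using w by (simp add: order4_def)
  have "A * (w * w) = (w * w) * A" if A: "A \<in> G" for A
  proof -
    have "w * (adj A * w * A) = (adj A * w * A) * w" using order4_commute[OF order4_conj(1)[OF w A] w] .
    from commuting_conjugate_sq[OF wG A this] have "w * w = adj A * (w * w) * A" using order4_conj(2)[OF w A] by simp
    then show ?thesis using conj_eq_iff_commute[OF A, of "w * w" "w * w"] wG by simp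
  qed
  then obtain c where c: "w * w = c \<cdot>\<^sub>m 1\<^sub>m n" using commutes_scalar[of "w * w"] wG by auto
  then have "c = 1 \<or> c = -1" using scalar_sign[of c] wG by (metis Gmult)
  then have c1: "w * w = (-1) \<cdot>\<^sub>m 1\<^sub>m n" using c ne by auto
  then have aw: "adj w = (-1) \<cdot>\<^sub>m w" using order4_adj[OF w] wG by (simp add: mat_smult[where n = n])
  have "A * w = w * A" if A: "A \<in> G" for A
  proof -
    have "adj (w - adj A * w * A) = (-1) \<cdot>\<^sub>m (w - adj A * w * A)"
      using A wG by (simp add: adj_minus[of _ n] adj_mult[of _ n n _ n] aw mat_smult[where n = n] mat_assoc[where n = n])
        (rule mat_eqI[where n = n]; simp add: mat_idx[where n = n] smult_idx[where n = n] del: index_mult_mat(1))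
    then have "w - adj A * w * A = 0\<^sub>m n n" using real_conj[OF A wG] A wG by (intro skew_real_spectrum_zero) auto
    then have "adj A * w * A = w" using minus_eq_zeroD[of w "adj A * w * A" n] A wG by simp
    then show ?thesis using conj_eq_iff_commute[OF A, of w w] wG by simp
  qed
  then obtain b where b: "w = b \<cdot>\<^sub>m 1\<^sub>m n" using commutes_scalar[of w] wG by auto
  then have "b = 1 \<or> b = -1" using scalar_sign[of b] wG by simp
  then have "w * w = 1\<^sub>m n" using b by (auto simp: mat_smult[where n = n])
  with ne show False by simp
qed

lemma pow_add_mat: "g \<in> G \<Longrightarrow> g ^\<^sub>m (i + j) = g ^\<^sub>m i * g ^\<^sub>m j"
  using gp.nat_pow_mult[of g i j] gp_pow[of g] by simp

lemma pow_mult_mat: "g \<in> G \<Longrightarrow> (g ^\<^sub>m i) ^\<^sub>m j = g ^\<^sub>m (i * j)"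
  using gp.nat_pow_pow[of g i j] gp_pow[of g] gp_pow[of "g ^\<^sub>m i"] by simp

text \<open>
  Otherwise some power would have order four.
\<close>

lemma two_elements_involutions:
  assumes "g \<in> G" "g ^\<^sub>m (2 ^ k) = 1\<^sub>m n"
  shows "g * g = 1\<^sub>m n"
  using assms
proof (induction k)
  case 0
  then show ?case by simp
next
  case (Suc k)
  show ?case
  proof (cases k)
    case 0
    then have "g ^\<^sub>m (1 + 1) = 1\<^sub>m n" using Suc.prems by (simp add: numeral_2_eq_2)
    then show ?thesis using Suc.prems(1) pow_add_mat[of g 1 1] by simp
  next
    case (Suc j)
    define x where "x = g ^\<^sub>m (2 ^ j)"
    have x: "x \<in> G" using Suc.prems by (simp add: x_def)
    have xx: "x * x = g ^\<^sub>m (2 ^ k)" using Suc.prems(1) by (simp add: x_def pow_add_mat[symmetric] Suc mult_2)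
    have "(x * x) * (x * x) = g ^\<^sub>m (2 ^ Suc k)" unfolding xx using Suc.prems(1) by (simp add: pow_add_mat[symmetric] mult_2)
    then have "order4 x" using x Suc.prems by (simp add: order4_def)
    then have "g ^\<^sub>m (2 ^ k) = 1\<^sub>m n" using no_order_four xx by simp
    then show ?thesis using Suc.IH Suc.prems(1) by simp
  qed
qed

definition D :: "complex mat set" where "D = {d \<in> G. d * d = 1\<^sub>m n}"

lemma DI: "d \<in> G \<Longrightarrow> d * d = 1\<^sub>m n \<Longrightarrow> d \<in> D"
  by (simp add: D_def)

lemma DG [simp]: "d \<in> D \<Longrightarrow> d \<in> G" and D_sq [simp]: "d \<in> D \<Longrightarrow> d * d = 1\<^sub>m n"
  by (auto simp: D_def)

lemma D_comm: "a \<in> D \<Longrightarrow> b \<in> D \<Longrightarrow> a * b = b * a"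
  by (rule involutions_commute) simp_all

lemma D_adj [simp]: "d \<in> D \<Longrightarrow> adj d = d"
  by (rule involution_adj) simp_all

lemma D_one [simp]: "1\<^sub>m n \<in> D"
  by (rule DI) simp_all

lemma D_mult [simp]: "a \<in> D \<Longrightarrow> b \<in> D \<Longrightarrow> a * b \<in> D"
proof -
  assume a: "a \<in> D" "b \<in> D"
  have M: "a \<in> M n" "b \<in> M n" using a by auto
  have "(a * b) * (a * b) = (b * a) * (a * b)" using D_comm[OF a] by simp
  also have "\<dots> = b * ((a * a) * b)" using M by (simp add: mat_assoc[where n = n])
  also have "\<dots> = 1\<^sub>m n" using a M by simp
  finally show ?thesis using a by (intro DI) simp_all
qed

lemma D_conj [simp]: "d \<in> D \<Longrightarrow> g \<in> G \<Longrightarrow> adj g * d * g \<in> D"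
proof -
  assume d: "d \<in> D" "g \<in> G"
  have "(adj g * d * g) * (adj g * d * g) = adj g * (d * d) * g"
    using d(2) DG[OF d(1)] by (simp add: mat_assoc[where n = n] del: D_sq)
  then show ?thesis using d by (intro DI) simp_all
qed

lemma D_normal: "normal_involutions gp D"
proof (rule normal_involutions.intro[OF gp.is_group], unfold_locales)
  show "D \<subseteq> carrier gp" by auto
  show "a \<otimes>\<^bsub>gp\<^esub> b \<in> D" if "a \<in> D" "b \<in> D" for a b using that by simp
  show "\<one>\<^bsub>gp\<^esub> \<in> D" by simp
  show "inv\<^bsub>gp\<^esub> a \<in> D" if "a \<in> D" for a using that by simp
  show "gp.cj d g \<in> D" if "d \<in> D" "g \<in> carrier gp" for d g using that by (simp add: gp_cj)
  show "a \<otimes>\<^bsub>gp\<^esub> b = b \<otimes>\<^bsub>gp\<^esub> a" if "a \<in> D" "b \<in> D" for a b using D_comm[OF that] by simp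
  show "d \<otimes>\<^bsub>gp\<^esub> d = \<one>\<^bsub>gp\<^esub>" if "d \<in> D" for d using that by simp
qed

text \<open>
  By the preceding lemma all elements of a Sylow 2-subgroup are in \<open>D\<close>, so its index is odd.
\<close>

theorem complement:
  obtains L where "subgroup L gp" "L \<inter> D = {1\<^sub>m n}" "\<And>g. g \<in> G \<Longrightarrow> \<exists>l\<in>L. \<exists>d\<in>D. g = l * d"
proof -
  interpret ND: normal_involutions gp D by (rule D_normal)
  have fin: "finite (carrier gp)" using finite_G by simp
  have "odd (card (rcosets\<^bsub>gp\<^esub> D))"
  proof (rule gp.odd_index_if_two_elements[OF fin ND.D])
    fix g k assume g: "g \<in> carrier gp" "g [^]\<^bsub>gp\<^esub> ((2::nat) ^ k) = \<one>\<^bsub>gp\<^esub>"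
    then show "g \<in> D" using two_elements_involutions[of g k] gp_pow[of g "2 ^ k"] by (intro DI) simp_all
  qed
  from ND.complement_exists[OF fin this]
  obtain L where "subgroup L gp" "L \<inter> D = {\<one>\<^bsub>gp\<^esub>}" "\<forall>g\<in>carrier gp. \<exists>l\<in>L. \<exists>d\<in>D. g = l \<otimes>\<^bsub>gp\<^esub> d"
    by blast
  then show ?thesis using that by simp
qed

end

section \<open>The complement of the involutions\<close>

lemma mult_vec_add: "A \<in> M n \<Longrightarrow> v \<in> carrier_vec n \<Longrightarrow> w \<in> carrier_vec n \<Longrightarrow> A *\<^sub>v (v + w) = A *\<^sub>v v + A *\<^sub>v w"
  by (rule mult_add_distrib_mat_vec)

lemma mult_vec_smult: "A \<in> M n \<Longrightarrow> v \<in> carrier_vec n \<Longrightarrow> A *\<^sub>v (c \<cdot>\<^sub>v v) = c \<cdot>\<^sub>v (A *\<^sub>v v)" for A :: "complex mat"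
  by (rule mult_mat_vec)

lemma mult_vec_assoc: "A \<in> M n \<Longrightarrow> B \<in> M n \<Longrightarrow> v \<in> carrier_vec n \<Longrightarrow> (A * B) *\<^sub>v v = A *\<^sub>v (B *\<^sub>v v)"
  by (rule assoc_mult_mat_vec)

lemma nonzero_column:
  assumes "X \<in> M n" "X \<noteq> 0\<^sub>m n n"
  obtains v where "v \<in> carrier_vec n" "X *\<^sub>v v \<noteq> 0\<^sub>v n"
proof -
  obtain i j where ij: "i < n" "j < n" "X $$ (i, j) \<noteq> 0"
    using assms by (metis carrier_matD eq_matI index_zero_mat)
  have "(X *\<^sub>v unit_vec n j) $ i = X $$ (i, j)" using ij assms(1) by (simp add: scalar_prod_right_unit)
  then have "X *\<^sub>v unit_vec n j \<noteq> 0\<^sub>v n" using ij by auto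
  then show ?thesis using that[of "unit_vec n j"] by simp
qed

locale split_real_group = real_commutator_group +
  fixes L
  assumes L: "subgroup L (GL n\<lparr>carrier := G\<rparr>)" and LD: "L \<inter> D = {1\<^sub>m n}"
    and split: "\<And>g. g \<in> G \<Longrightarrow> \<exists>l\<in>L. \<exists>d\<in>D. g = l * d"
begin

lemmas mult_vec_linear [simp] = mult_vec_add[where n = n] mult_vec_smult[where n = n] mult_mat_vec_carrier[of _ n n]

lemma LG [simp]: "l \<in> L \<Longrightarrow> l \<in> G"
  using subgroup.mem_carrier[OF L] by simp

lemma Lmult [simp]: "a \<in> L \<Longrightarrow> b \<in> L \<Longrightarrow> a * b \<in> L"
  using subgroup.m_closed[OF L] by simp

lemma Lone [simp]: "1\<^sub>m n \<in> L"
  using subgroup.one_closed[OF L] by simp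

lemma Ladj [simp]: "a \<in> L \<Longrightarrow> adj a \<in> L"
  using subgroup.m_inv_closed[OF L, of a] gp_inv[of a] by simp

lemma Lpow [simp]: "a \<in> L \<Longrightarrow> a ^\<^sub>m k \<in> L"
  by (induction k) auto

lemma finite_L: "finite L"
  using finite_G by (rule finite_subset[rotated]) auto

lemma L_sq: "x \<in> L \<Longrightarrow> x * x = 1\<^sub>m n \<Longrightarrow> x = 1\<^sub>m n"
  using LD DI[of x] LG[of x] by blast

lemma L_odd:
  obtains r where "odd r" "r dvd N" "\<And>l. l \<in> L \<Longrightarrow> l ^\<^sub>m r = 1\<^sub>m n"
proof -
  have N0: "N \<noteq> 0" "\<not> is_unit (2::nat)" using N_pos by auto
  have "\<exists>k r. N = 2 ^ k * r \<and> \<not> 2 dvd r"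
    by (rule multiplicity_decompose'[OF N0], intro exI conjI)
  then obtain k r where r: "N = 2 ^ k * r" "\<not> 2 dvd r" by blast
  have "l ^\<^sub>m r = 1\<^sub>m n" if l: "l \<in> L" for l
  proof -
    have "(l ^\<^sub>m r) ^\<^sub>m (2 ^ k) = l ^\<^sub>m (r * 2 ^ k)" by (rule pow_mult_mat[OF LG[OF l]])
    also have "r * 2 ^ k = N" unfolding r(1) by (rule mult.commute)
    finally have "(l ^\<^sub>m r) ^\<^sub>m (2 ^ k) = 1\<^sub>m n" using pow_N[OF LG[OF l]] by (rule trans)
    from two_elements_involutions[OF LG[OF Lpow[OF l]] this]
    show ?thesis by (rule L_sq[rotated]) (rule Lpow[OF l])
  qed
  moreover have "r dvd N" unfolding r(1) by simp
  ultimately show ?thesis using that r(2) by blast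
qed

text \<open>
  In \<open>L\<close>, two commuting conjugates have equal squares, so their quotient squares to the identity
  and is trivial because \<open>L\<close> contains no involutions.
\<close>

lemma L_comm: "x \<in> L \<Longrightarrow> y \<in> L \<Longrightarrow> x * y = y * x"
proof -
  assume xy: "x \<in> L" "y \<in> L"
  have "x \<otimes>\<^bsub>gp\<^esub> y = y \<otimes>\<^bsub>gp\<^esub> x"
  proof (rule gp.conj_commute_imp_abelian[OF L finite_L _ xy])
    fix x g assume x: "x \<in> L" and g: "g \<in> L"
      and c: "x \<otimes>\<^bsub>gp\<^esub> (inv\<^bsub>gp\<^esub> g \<otimes>\<^bsub>gp\<^esub> x \<otimes>\<^bsub>gp\<^esub> g) = (inv\<^bsub>gp\<^esub> g \<otimes>\<^bsub>gp\<^esub> x \<otimes>\<^bsub>gp\<^esub> g) \<otimes>\<^bsub>gp\<^esub> x"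
    define f where "f = adj g * x * g"
    have f: "f \<in> L" using x g by (simp add: f_def)
    have xf: "x * f = f * x" using c x g by (simp add: f_def)
    have sq: "x * x = f * f" using commuting_conjugate_sq[of x g] xf x g by (simp add: f_def)
    have fx: "f * adj x = adj x * f"
    proof -
      have "adj x * (x * f) * adj x = adj x * (f * x) * adj x" by (simp add: xf)
      moreover have "adj x * (x * f) * adj x = f * adj x" using x f by simp
      moreover have "adj x * (f * x) * adj x = adj x * f"
        using x f by (simp add: mat_assoc[where n = n])
      ultimately show ?thesis by simp
    qed
    have "(adj x * f) * (adj x * f) = adj x * ((f * adj x) * f)" using x f by (simp add: mat_assoc[where n = n])
    also have "\<dots> = adj x * (adj x * (f * f))" unfolding fx using x f by (simp add: mat_assoc[where n = n])
    also have "\<dots> = 1\<^sub>m n" unfolding sq[symmetric] using x by simp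
    finally have "adj x * f = 1\<^sub>m n" by (rule L_sq[rotated]) (use x f in simp)
    then have "x * (adj x * f) = x" using x by simp
    then have "f = x" using x f by simp
    then show "x \<otimes>\<^bsub>gp\<^esub> g = g \<otimes>\<^bsub>gp\<^esub> x"
      using conj_eq_iff_commute[of g x x] x g by (simp add: f_def)
  qed
  then show ?thesis by simp
qed

lemma invariant_all:
  assumes W: "W \<subseteq> carrier_vec n" "0\<^sub>v n \<in> W" "\<And>v w. v \<in> W \<Longrightarrow> w \<in> W \<Longrightarrow> v + w \<in> W"
      "\<And>c v. v \<in> W \<Longrightarrow> c \<cdot>\<^sub>v v \<in> W"
    and inv: "\<And>l v. l \<in> L \<Longrightarrow> v \<in> W \<Longrightarrow> l *\<^sub>v v \<in> W" "\<And>d v. d \<in> D \<Longrightarrow> v \<in> W \<Longrightarrow> d *\<^sub>v v \<in> W"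
    and nz: "u \<in> W" "u \<noteq> 0\<^sub>v n"
  shows "W = carrier_vec n"
proof (rule irreducible_invariant[OF irr W _ nz])
  fix A v assume A: "A \<in> G" and v: "v \<in> W"
  obtain l d where ld: "l \<in> L" "d \<in> D" "A = l * d" using split[OF A] by blast
  have "A *\<^sub>v v = l *\<^sub>v (d *\<^sub>v v)" using ld v W(1) by (auto simp: mult_vec_assoc[of _ n])
  then show "A *\<^sub>v v \<in> W" using inv ld v by simp
qed

lemma commutes_G:
  assumes "Y \<in> M n" "\<And>l. l \<in> L \<Longrightarrow> Y * l = l * Y" "\<And>d. d \<in> D \<Longrightarrow> Y * d = d * Y"
  shows "\<exists>c. Y = c \<cdot>\<^sub>m 1\<^sub>m n"
proof (rule commutes_scalar[OF assms(1)])
  fix A assume A: "A \<in> G"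
  obtain l d where ld: "l \<in> L" "d \<in> D" "A = l * d" using split[OF A] by blast
  have "Y * (l * d) = (l * d) * Y" using ld assms by (intro comm_mult[of _ _ _ n]) auto
  then show "A * Y = Y * A" by (simp add: ld)
qed

lemma conj_move: "d \<in> D \<Longrightarrow> l \<in> G \<Longrightarrow> v \<in> carrier_vec n \<Longrightarrow> d *\<^sub>v (l *\<^sub>v v) = l *\<^sub>v ((adj l * d * l) *\<^sub>v v)"
proof -
  assume a: "d \<in> D" "l \<in> G" "v \<in> carrier_vec n"
  have "l *\<^sub>v ((adj l * d * l) *\<^sub>v v) = (l * (adj l * d * l)) *\<^sub>v v" using a by (simp add: mult_vec_assoc[of _ n])
  also have "l * (adj l * d * l) = d * l" using a by (simp add: mat_assoc[where n = n])
  finally show ?thesis using a by (simp add: mult_vec_assoc[of _ n])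
qed

text \<open>
  If \<open>u\<close> were not invariant under some \<open>h\<close> in \<open>L\<close>, put \<open>X = u - h\<inverse> u h\<close>. The eigenvalues
  of \<open>X\<close> are \<open>0\<close>, \<open>2\<close> and \<open>-2\<close>, and \<open>g X\<close> is again a difference of conjugates, so it has real
  spectrum. As \<open>g\<close> has odd order, its real eigenvalues are \<open>1\<close>, so \<open>g X = X\<close>. Then the vectors \<open>v\<close> for
  which \<open>g\<close> fixes all \<open>d v\<close> with \<open>d\<close> in \<open>D\<close> form a nonzero invariant subspace, and \<open>g\<close> would
  be the identity. So \<open>u\<close> commutes with \<open>L\<close> and with \<open>D\<close>.
\<close>

lemma fixed_by_nontrivial_scalar:
  assumes u: "u \<in> D" and g: "g \<in> L" "g \<noteq> 1\<^sub>m n" and ug: "u * g = g * u"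
  shows "\<exists>c. u = c \<cdot>\<^sub>m 1\<^sub>m n"
proof -
  obtain r where r: "odd r" "r dvd N" "\<And>l. l \<in> L \<Longrightarrow> l ^\<^sub>m r = 1\<^sub>m n" using L_odd by blast
  have r0: "r > 0" using r(1) by (cases r) auto
  have "adj h * u * h = u" if h: "h \<in> L" for h
  proof (rule ccontr)
    assume ne: "adj h * u * h \<noteq> u"
    define x where "x = adj h * u * h"
    have x: "x \<in> D" using u h by (simp add: x_def)
    have ux: "u * x = x * u" using D_comm u x .
    have gx: "g * x = x * g"
    proof -
      have "g * adj h = adj h * g" "g * h = h * g" using L_comm g h by auto
      then show ?thesis unfolding x_def using ug g h u by (intro comm_mult[of _ _ _ n]) auto
    qed
    define X where "X = u - x"
    have XM: "X \<in> M n" using u x by (simp add: X_def)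
    have X0: "X \<noteq> 0\<^sub>m n n" using ne minus_eq_zeroD[of u x n] u x by (auto simp: X_def x_def)
    have gX: "g * X = X * g" unfolding X_def using ug gx g u x by (intro comm_minus[of _ _ _ n]) auto
    have dX: "d * X = X * d" if "d \<in> D" for d
      unfolding X_def using D_comm[OF that u] D_comm[OF that x] that u x by (intro comm_minus[of _ _ _ n]) auto
    \<comment> \<open>The eigenvalues of \<open>X\<close> are \<open>0\<close>, \<open>2\<close> and \<open>-2\<close>.\<close>
    have XXX: "X * (X * X) = 4 \<cdot>\<^sub>m X"
    proof -
      have uux: "u * (u * x) = x" "x * (x * u) = u" "x * (u * x) = u" "u * (x * u) = x"
      proof -
        show "u * (u * x) = x" using u x by (simp add: mat_assoc[where n = n, symmetric] del: assoc_mult_mat)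
        then show "u * (x * u) = x" by (simp add: ux)
        show "x * (x * u) = u" using u x by (simp add: mat_assoc[where n = n, symmetric] del: assoc_mult_mat)
        then show "x * (u * x) = u" by (simp add: ux)
      qed
      have ex: "X * X = 1\<^sub>m n - x * u - (u * x - 1\<^sub>m n)" unfolding X_def using u x by (simp add: mat_distrib[where n = n])
      have "X * (X * X) = u * (X * X) - x * (X * X)" using u x XM by (subst X_def) (simp add: mat_distrib[where n = n])
      also have "u * (X * X) = u - x - (x - u)" unfolding ex using u x by (simp add: mat_distrib[where n = n] uux)
      also have "x * (X * X) = x - u - (u - x)" unfolding ex using u x by (simp add: mat_distrib[where n = n] uux)
      finally show ?thesis using u x unfolding X_def
        by (simp) (rule mat_eqI[where n = n]; simp add: mat_idx[where n = n] smult_idx[where n = n])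
    qed
    have sp: "spectrum (g * X) \<subseteq> \<real>"
    proof -
      have "adj h * (g * u) * h = g * x"
      proof -
        have "adj h * (g * u) * h = (adj h * g) * (u * h)" using g h u by (simp add: mat_assoc[where n = n])
        also have "adj h * g = g * adj h" using L_comm g h by simp
        finally show ?thesis using g h u by (simp add: x_def mat_assoc[where n = n])
      qed
      then have "g * u - adj h * (g * u) * h = g * X" using g u x by (simp add: X_def mat_distrib[where n = n])
      then show ?thesis using real_conj[of h "g * u"] g h u by simp
    qed
    have gXX: "g * X = X"
    proof (rule ccontr)
      assume "g * X \<noteq> X"
      then have Y0: "g * X - X \<noteq> 0\<^sub>m n n" using minus_eq_zeroD[of "g * X" X n] XM g by auto
      have YM: "g * X - X \<in> M n" using XM g by simp
      have gM: "g \<in> M n" using g by simp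
      obtain Q l where Q: "Q \<in> M n" "l ^ r = (1::complex)" "g * Q = l \<cdot>\<^sub>m Q" "(g * X - X) * Q \<noteq> 0\<^sub>m n n"
        using finite_order_eigenprojection[OF gM r0 r(3)[OF g(1)] YM Y0] by blast
      define V where "V = X * Q"
      have VM: "V \<in> M n" using XM Q by (simp add: V_def)
      have gV: "g * V = l \<cdot>\<^sub>m V"
      proof -
        have "g * V = (g * X) * Q" using gM XM Q(1) by (simp add: V_def mat_assoc[where n = n])
        also have "\<dots> = X * (g * Q)" unfolding gX using gM XM Q(1) by (simp add: mat_assoc[where n = n])
        finally show ?thesis using XM Q by (simp add: V_def mat_smult[where n = n])
      qed
      have YQ: "(g * X - X) * Q = l \<cdot>\<^sub>m V - V"
      proof -
        have "(g * X - X) * Q = g * V - V" using gM XM Q(1) by (simp add: V_def mat_distrib[where n = n] mat_assoc[where n = n])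
        then show ?thesis by (simp add: gV)
      qed
      have V0: "V \<noteq> 0\<^sub>m n n" and l1: "l \<noteq> 1" using Q(4) VM unfolding YQ by auto
      have XXV: "X * (X * V) = 4 \<cdot>\<^sub>m V"
      proof -
        have "X * (X * V) = (X * (X * X)) * Q" using XM Q(1) by (simp add: V_def mat_assoc[where n = n])
        then show ?thesis using XM Q(1) by (simp add: XXX V_def mat_smult[where n = n])
      qed
      have key: "e * l \<in> \<real>" if e: "X * E = e \<cdot>\<^sub>m E" "E \<in> M n" "E \<noteq> 0\<^sub>m n n" "g * E = l \<cdot>\<^sub>m E" for e E
      proof -
        have "(g * X) * E = g * (X * E)" using gM XM e(2) by (simp add: mat_assoc[where n = n])
        also have "\<dots> = (e * l) \<cdot>\<^sub>m E" using gM e by (simp add: mat_smult[where n = n])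
        finally have "e * l \<in> spectrum (g * X)" using eigen_in_spectrum[of "g * X" n E] gM XM e by simp
        then show ?thesis using sp by blast
      qed
      have gXV: "g * (X * V) = l \<cdot>\<^sub>m (X * V)"
      proof -
        have "g * (X * V) = (g * X) * V" using gM XM VM by (simp add: mat_assoc[where n = n])
        also have "\<dots> = X * (g * V)" unfolding gX using gM XM VM by (simp add: mat_assoc[where n = n])
        finally show ?thesis using XM VM by (simp add: gV mat_smult[where n = n])
      qed
      \<comment> \<open>The components of \<open>V\<close> in the eigenspaces of \<open>X\<close> for \<open>2\<close> and \<open>-2\<close>, up to a factor.\<close>
      define V1 where "V1 = X * V + 2 \<cdot>\<^sub>m V"
      define V2 where "V2 = X * V - 2 \<cdot>\<^sub>m V"
      have VV: "V1 \<in> M n" "V2 \<in> M n" using XM VM by (auto simp: V1_def V2_def)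
      have XV: "X * V \<in> M n" using XM VM by simp
      have e1: "X * V1 = 2 \<cdot>\<^sub>m V1" unfolding V1_def using XM VM
        by (simp add: mat_distrib[where n = n] mat_smult[where n = n] XXV)
          (rule mat_eqI[where n = n]; simp add: mat_idx[where n = n] smult_idx[where n = n] algebra_simps del: index_mult_mat(1))
      have e2: "X * V2 = (-2) \<cdot>\<^sub>m V2" unfolding V2_def using XM VM
        by (simp add: mat_distrib[where n = n] mat_smult[where n = n] XXV)
          (rule mat_eqI[where n = n]; simp add: mat_idx[where n = n] smult_idx[where n = n] algebra_simps del: index_mult_mat(1))
      have g1: "g * V1 = l \<cdot>\<^sub>m V1" unfolding V1_def using XM VM gM
        by (simp add: mat_distrib[where n = n] mat_smult[where n = n] gXV gV)
          (rule mat_eqI[where n = n]; simp add: mat_idx[where n = n] smult_idx[where n = n] algebra_simps del: index_mult_mat(1))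
      have g2: "g * V2 = l \<cdot>\<^sub>m V2" unfolding V2_def using XM VM gM
        by (simp add: mat_distrib[where n = n] mat_smult[where n = n] gXV gV)
          (rule mat_eqI[where n = n]; simp add: mat_idx[where n = n] smult_idx[where n = n] algebra_simps del: index_mult_mat(1))
      have "V1 \<noteq> 0\<^sub>m n n \<or> V2 \<noteq> 0\<^sub>m n n"
      proof (rule ccontr)
        assume "\<not> ?thesis"
        then have z: "V1 = 0\<^sub>m n n" "V2 = 0\<^sub>m n n" by auto
        have "V = 0\<^sub>m n n"
        proof (rule mat_eqI[where n = n])
          fix i j assume ij: "i < n" "j < n"
          have "V1 $$ (i, j) = 0" "V2 $$ (i, j) = 0" using ij z by auto
          then show "V $$ (i, j) = 0\<^sub>m n n $$ (i, j)" using ij VM XV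
            by (simp add: V1_def V2_def mat_idx[where n = n] smult_idx[where n = n] del: index_mult_mat(1))
        qed (use VM in auto)
        with V0 show False by simp
      qed
      then have "2 * l \<in> \<real>"
      proof
        assume "V1 \<noteq> 0\<^sub>m n n"
        then show ?thesis using key[OF e1 VV(1) _ g1] by simp
      next
        assume "V2 \<noteq> 0\<^sub>m n n"
        then have "- (-2 * l) \<in> \<real>" using key[OF e2 VV(2) _ g2] by (intro Reals_minus) simp
        then show ?thesis by simp
      qed
      then have "2 * l / 2 \<in> \<real>" by (intro Reals_divide) auto
      moreover have "l ^ N = 1" using Q(2) r(2) by (auto simp: power_mult elim!: dvdE)
      ultimately have ll: "l * l = 1" using root_real_sq by simp
      obtain k where k: "r = 2 * k + 1" using r(1) by (auto elim: oddE)
      have "l ^ r = (l * l) ^ k * l" by (simp add: k power_mult power2_eq_square)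
      then show False using Q(2) ll l1 by simp
    qed
    define W where "W = {v \<in> carrier_vec n. \<forall>d\<in>D. g *\<^sub>v (d *\<^sub>v v) = d *\<^sub>v v}"
    obtain v0 where v0: "v0 \<in> carrier_vec n" "X *\<^sub>v v0 \<noteq> 0\<^sub>v n" using nonzero_column[OF XM X0] by blast
    have "W = carrier_vec n"
    proof (rule invariant_all)
      show "W \<subseteq> carrier_vec n" by (auto simp: W_def)
      show "0\<^sub>v n \<in> W" using g by (auto simp: W_def)
      show "v + w \<in> W" if "v \<in> W" "w \<in> W" for v w
        using that g by (auto simp: W_def)
      show "c \<cdot>\<^sub>v v \<in> W" if "v \<in> W" for c v using that g by (auto simp: W_def)
      show "X *\<^sub>v v0 \<noteq> 0\<^sub>v n" by (rule v0)
      show "X *\<^sub>v v0 \<in> W"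
      proof -
        have "g *\<^sub>v (d *\<^sub>v (X *\<^sub>v v0)) = d *\<^sub>v (X *\<^sub>v v0)" if d: "d \<in> D" for d
        proof -
          have "d *\<^sub>v (X *\<^sub>v v0) = (X * d) *\<^sub>v v0" using d XM v0(1) by (simp add: mult_vec_assoc[of _ n, symmetric] dX[OF d])
          then have "d *\<^sub>v (X *\<^sub>v v0) = X *\<^sub>v (d *\<^sub>v v0)" using d XM v0(1) by (simp add: mult_vec_assoc[of _ n])
          moreover have "g *\<^sub>v (X *\<^sub>v (d *\<^sub>v v0)) = (g * X) *\<^sub>v (d *\<^sub>v v0)" using d g XM v0(1) by (simp add: mult_vec_assoc[of _ n])
          ultimately show ?thesis by (simp add: gXX)
        qed
        then show ?thesis using XM v0(1) by (auto simp: W_def)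
      qed
      show "d *\<^sub>v v \<in> W" if d: "d \<in> D" and v: "v \<in> W" for d v
      proof -
        have vc: "v \<in> carrier_vec n" using v by (simp add: W_def)
        have "g *\<^sub>v (e *\<^sub>v (d *\<^sub>v v)) = e *\<^sub>v (d *\<^sub>v v)" if e: "e \<in> D" for e
        proof -
          have "g *\<^sub>v ((e * d) *\<^sub>v v) = (e * d) *\<^sub>v v" using v D_mult[OF e d] by (simp add: W_def)
          then show ?thesis using e d vc by (simp add: mult_vec_assoc[of _ n])
        qed
        then show ?thesis using vc d by (simp add: W_def)
      qed
      show "l *\<^sub>v v \<in> W" if l: "l \<in> L" and v: "v \<in> W" for l v
      proof -
        have vc: "v \<in> carrier_vec n" using v by (simp add: W_def)
        have "g *\<^sub>v (d *\<^sub>v (l *\<^sub>v v)) = d *\<^sub>v (l *\<^sub>v v)" if d: "d \<in> D" for d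
        proof -
          define w where "w = (adj l * d * l) *\<^sub>v v"
          have w: "w \<in> carrier_vec n" "g *\<^sub>v w = w" using v vc l d by (auto simp: W_def w_def)
          have "d *\<^sub>v (l *\<^sub>v v) = l *\<^sub>v w" using conj_move[OF d LG[OF l] vc] by (simp add: w_def)
          moreover have "g *\<^sub>v (l *\<^sub>v w) = (l * g) *\<^sub>v w" using g l w(1) L_comm[OF g(1) l] by (simp add: mult_vec_assoc[of _ n, symmetric])
          moreover have "(l * g) *\<^sub>v w = l *\<^sub>v w" using g l w by (simp add: mult_vec_assoc[of _ n])
          ultimately show ?thesis by simp
        qed
        then show ?thesis using vc l by (simp add: W_def)
      qed
    qed
    then have gv: "g *\<^sub>v v = 1 \<cdot>\<^sub>v v" if v: "v \<in> carrier_vec n" for v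
    proof -
      have "v \<in> W" using v \<open>W = carrier_vec n\<close> by simp
      then have "g *\<^sub>v (1\<^sub>m n *\<^sub>v v) = 1\<^sub>m n *\<^sub>v v" using D_one unfolding W_def by blast
      then show ?thesis using v by simp
    qed
    have "g = 1 \<cdot>\<^sub>m 1\<^sub>m n" using g(1) gv by (intro mat_eq_smult_one) auto
    with g(2) show False by simp
  qed
  then have "u * h = h * u" if "h \<in> L" for h using conj_eq_iff_commute[of h u u] that u by simp
  then show ?thesis using commutes_G[of u] D_comm u by auto
qed

definition Z :: "complex mat set" where "Z = {z \<in> D. \<exists>c. z = c \<cdot>\<^sub>m 1\<^sub>m n}"

lemma nonscalar_D: "\<exists>d\<in>D. \<forall>c. d \<noteq> c \<cdot>\<^sub>m 1\<^sub>m n"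
proof (rule ccontr)
  assume "\<not> ?thesis"
  then have sc: "\<exists>c. d = c \<cdot>\<^sub>m 1\<^sub>m n" if "d \<in> D" for d using that by blast
  have dl: "A * d = d * A" if d: "d \<in> D" and A: "A \<in> M n" for d A
  proof -
    obtain c where "d = c \<cdot>\<^sub>m 1\<^sub>m n" using sc[OF d] by blast
    then show ?thesis using A by (simp add: mat_smult[where n = n])
  qed
  have "A * B = B * A" if AB: "A \<in> G" "B \<in> G" for A B
  proof -
    obtain l d where ld: "l \<in> L" "d \<in> D" "A = l * d" using split[OF AB(1)] by blast
    obtain l' d' where ld': "l' \<in> L" "d' \<in> D" "B = l' * d'" using split[OF AB(2)] by blast
    have "l' * (l * d) = (l * d) * l'"
      using ld ld' L_comm[OF ld'(1) ld(1)] dl[OF ld(2), of l'] by (intro comm_mult[of _ _ _ n]) auto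
    then have "(l * d) * (l' * d') = (l' * d') * (l * d)"
      using ld ld' dl[OF ld'(2), of "l * d"] by (intro comm_mult[of _ _ _ n]) auto
    then show ?thesis by (simp add: ld ld')
  qed
  then show False using not_abelian by blast
qed

lemma free_action: "free_abelian_action gp D L Z"
proof -
  interpret ND: normal_involutions gp D by (rule D_normal)
  show ?thesis
  proof (rule free_abelian_action.intro[OF D_normal], unfold_locales)
    show "L \<subseteq> carrier gp" by auto
    show "a \<otimes>\<^bsub>gp\<^esub> b \<in> L" if "a \<in> L" "b \<in> L" for a b using that by simp
    show "\<one>\<^bsub>gp\<^esub> \<in> L" by simp
    show "inv\<^bsub>gp\<^esub> a \<in> L" if "a \<in> L" for a using that by simp
    show "finite L" by (rule finite_L)
    show "x \<otimes>\<^bsub>gp\<^esub> y = y \<otimes>\<^bsub>gp\<^esub> x" if "x \<in> L" "y \<in> L" for x y using L_comm[OF that] by simp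
    show "x = \<one>\<^bsub>gp\<^esub>" if "x \<in> L" "x \<otimes>\<^bsub>gp\<^esub> x = \<one>\<^bsub>gp\<^esub>" for x using L_sq[OF that(1)] that(2) by simp
    show "Z \<subseteq> carrier gp" by (auto simp: Z_def)
    show "\<one>\<^bsub>gp\<^esub> \<in> Z" by (auto simp: Z_def intro: exI[of _ 1])
    show "a \<otimes>\<^bsub>gp\<^esub> b \<in> Z" if ab: "a \<in> Z" "b \<in> Z" for a b
    proof -
      obtain c e where "a = c \<cdot>\<^sub>m 1\<^sub>m n" "b = e \<cdot>\<^sub>m 1\<^sub>m n" using ab unfolding Z_def by blast
      then have "a * b = (c * e) \<cdot>\<^sub>m 1\<^sub>m n" by (simp add: mat_smult[where n = n] mult.commute)
      moreover have "a * b \<in> D" using ab by (intro D_mult) (auto simp: Z_def)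
      ultimately show ?thesis unfolding Z_def by auto
    qed
    show "inv\<^bsub>gp\<^esub> a \<in> Z" if "a \<in> Z" for a using that by (auto simp: Z_def)
    show "Z \<subset> D" using nonscalar_D by (auto simp: Z_def)
    show "gp.cj z g = z" if z: "z \<in> Z" and g: "g \<in> L" for z g
    proof -
      obtain c where c: "z = c \<cdot>\<^sub>m 1\<^sub>m n" using z by (auto simp: Z_def)
      have "z \<in> G" using z by (auto simp: Z_def)
      then have "gp.cj z g = adj g * z * g" using g by (simp add: gp_cj)
      also have "\<dots> = z" unfolding c using g by (simp add: mat_smult[where n = n])
      finally show ?thesis .
    qed
    show "u \<in> Z" if "g \<in> L" "g \<noteq> \<one>\<^bsub>gp\<^esub>" "u \<in> D" "gp.cj u g = u" for g u
    proof -
      have "adj g * u * g = u" using that by (simp add: gp_cj)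
      then have "u * g = g * u" using conj_eq_iff_commute[of g u u] that by simp
      then show ?thesis using fixed_by_nontrivial_scalar[of u g] that by (simp add: Z_def)
    qed
  qed
qed

lemma L_cyclic:
  obtains c where "c \<in> L" "\<And>x. x \<in> L \<Longrightarrow> \<exists>k. x = c ^\<^sub>m k"
proof -
  interpret FA: free_abelian_action gp D L Z by (rule free_action)
  obtain c where "c \<in> L" "\<forall>x\<in>L. \<exists>k::nat. x = c [^]\<^bsub>gp\<^esub> k" using FA.cyclic by blast
  then show ?thesis using that[of c] gp_pow[of c] by auto
qed

lemma common_eigenprojection:
  assumes "finite E" "E \<subseteq> D"
  shows "\<exists>Q\<in>M n. Q \<noteq> 0\<^sub>m n n \<and> (\<forall>d\<in>E. \<exists>c. d * Q = c \<cdot>\<^sub>m Q) \<and>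
    (\<forall>B\<in>M n. (\<forall>d\<in>D. d * B = B * d) \<longrightarrow> B * Q = Q * B)"
  using assms
proof (induction E rule: finite_induct)
  case empty
  have "(1\<^sub>m n :: complex mat) \<noteq> 0\<^sub>m n n"
  proof
    assume "(1\<^sub>m n :: complex mat) = 0\<^sub>m n n"
    then have "(1\<^sub>m n :: complex mat) $$ (0, 0) = 0\<^sub>m n n $$ (0, 0)" by simp
    then show False using n1 by simp
  qed
  then show ?case by (intro bexI[of _ "1\<^sub>m n"]) auto
next
  case (insert e E)
  then obtain Q where Q: "Q \<in> M n" "Q \<noteq> 0\<^sub>m n n" "\<forall>d\<in>E. \<exists>c. d * Q = c \<cdot>\<^sub>m Q"
    "\<forall>B\<in>M n. (\<forall>d\<in>D. d * B = B * d) \<longrightarrow> B * Q = Q * B" by auto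
  have e: "e \<in> D" "e \<in> M n" using insert by auto
  obtain R l where R: "R \<in> M n" "e * R = l \<cdot>\<^sub>m R" "Q * R \<noteq> 0\<^sub>m n n"
    "\<And>B. B \<in> M n \<Longrightarrow> e * B = B * e \<Longrightarrow> B * R = R * B"
    using finite_order_eigenprojection[OF e(2) N_pos pow_N[OF DG[OF e(1)]] Q(1,2)] by blast
  have eQ: "e * Q = Q * e" using Q(4) e D_comm[OF _ e(1)] by blast
  have "\<exists>c. d * (Q * R) = c \<cdot>\<^sub>m (Q * R)" if d: "d \<in> insert e E" for d
  proof (cases "d = e")
    case True
    have "e * (Q * R) = (e * Q) * R" using e Q(1) R(1) by (simp add: mat_assoc[where n = n])
    also have "\<dots> = Q * (e * R)" unfolding eQ using e Q(1) R(1) by (simp add: mat_assoc[where n = n])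
    finally show ?thesis using Q(1) R True by (auto simp: mat_smult[where n = n])
  next
    case False
    then obtain c where "d * Q = c \<cdot>\<^sub>m Q" using d Q(3) by auto
    moreover have "d \<in> M n" using d insert.prems by auto
    then have "d * (Q * R) = (d * Q) * R" using Q(1) R(1) by (simp add: mat_assoc[where n = n])
    ultimately show ?thesis using Q(1) R(1) by (auto simp: mat_smult[where n = n])
  qed
  moreover have "B * (Q * R) = (Q * R) * B" if B: "B \<in> M n" "\<forall>d\<in>D. d * B = B * d" for B
    using Q(4) R(4)[OF B(1)] B e Q(1) R(1) by (intro comm_mult[of _ _ _ n]) auto
  ultimately show ?case using Q(1) R(1,3) by (intro bexI[of _ "Q * R"]) auto
qed

lemma D_eigenvector:
  obtains u \<psi> where "u \<in> carrier_vec n" "u \<noteq> 0\<^sub>v n" "\<And>d. d \<in> D \<Longrightarrow> d *\<^sub>v u = \<psi> d \<cdot>\<^sub>v u"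
    "\<And>d. d \<in> D \<Longrightarrow> \<psi> d = 1 \<or> \<psi> d = (-1::complex)"
proof -
  have finD: "finite D" using finite_G by (rule finite_subset[rotated]) auto
  obtain Q where Q: "Q \<in> M n" "Q \<noteq> 0\<^sub>m n n" "\<forall>d\<in>D. \<exists>c. d * Q = c \<cdot>\<^sub>m Q"
    using common_eigenprojection[OF finD] by blast
  from bchoice[OF Q(3)] obtain \<psi> where \<psi>: "\<And>d. d \<in> D \<Longrightarrow> d * Q = \<psi> d \<cdot>\<^sub>m Q" by blast
  obtain v where v: "v \<in> carrier_vec n" "Q *\<^sub>v v \<noteq> 0\<^sub>v n" using nonzero_column[OF Q(1,2)] by blast
  define u where "u = Q *\<^sub>v v"
  have u: "u \<in> carrier_vec n" "u \<noteq> 0\<^sub>v n" using v Q(1) by (auto simp: u_def)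
  have du: "d *\<^sub>v u = \<psi> d \<cdot>\<^sub>v u" if d: "d \<in> D" for d
  proof -
    have "d *\<^sub>v u = (d * Q) *\<^sub>v v" using d Q(1) v by (simp add: u_def mult_vec_assoc[of _ n])
    then show ?thesis unfolding \<psi>[OF d] u_def using Q(1) v by (intro eq_vecI) auto
  qed
  have "\<psi> d = 1 \<or> \<psi> d = -1" if d: "d \<in> D" for d
  proof -
    have "u = (d * d) *\<^sub>v u" using d u by simp
    also have "\<dots> = d *\<^sub>v (d *\<^sub>v u)" using d u by (simp add: mult_vec_assoc[of _ n] del: D_sq)
    also have "\<dots> = (\<psi> d * \<psi> d) \<cdot>\<^sub>v u" using d u by (simp add: du smult_smult_assoc)
    finally have e: "u = (\<psi> d * \<psi> d) \<cdot>\<^sub>v u" .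
    obtain i where i: "i < n" "u $ i \<noteq> 0" using u by (metis carrier_vecD eq_vecI index_zero_vec)
    have "u $ i = ((\<psi> d * \<psi> d) \<cdot>\<^sub>v u) $ i" by (rule arg_cong[OF e])
    also have "\<dots> = (\<psi> d * \<psi> d) * u $ i" using i u by simp
    finally have "1 * u $ i = (\<psi> d * \<psi> d) * u $ i" by (simp only: mult_1)
    then have "\<psi> d * \<psi> d = 1" by (subst (asm) mult_right_cancel[OF i(2)]) (rule sym)
    then show ?thesis by (simp add: square_eq_1_iff)
  qed
  then show ?thesis using that u du by blast
qed

text \<open>
  The vectors on which every \<open>d\<close> agrees with its conjugate \<open>l d l\<inverse>\<close> form an invariant subspace,
  and it contains \<open>u\<close>. So \<open>l\<close> commutes with \<open>D\<close>; being in the abelian group \<open>L\<close>, it is a scalar,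
  and the only scalar in \<open>L\<close> is the identity.
\<close>

lemma character_stabilizer_trivial:
  assumes u: "u \<in> carrier_vec n" "u \<noteq> 0\<^sub>v n" and \<psi>: "\<And>d. d \<in> D \<Longrightarrow> d *\<^sub>v u = \<psi> d \<cdot>\<^sub>v u"
    and l: "l \<in> L" and st: "\<And>d. d \<in> D \<Longrightarrow> \<psi> (adj l * d * l) = \<psi> d"
  shows "l = 1\<^sub>m n"
proof -
  define cl where "cl d = l * d * adj l" for d
  have clD: "cl d \<in> D" if "d \<in> D" for d using D_conj[OF that, of "adj l"] l by (simp add: cl_def)
  define W where "W = {v \<in> carrier_vec n. \<forall>d\<in>D. cl d *\<^sub>v v = d *\<^sub>v v}"
  have "W = carrier_vec n"
  proof (rule invariant_all)
    show "W \<subseteq> carrier_vec n" by (auto simp: W_def)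
    show "0\<^sub>v n \<in> W" using clD by (auto simp: W_def)
    show "v + w \<in> W" if "v \<in> W" "w \<in> W" for v w using that clD by (auto simp: W_def)
    show "c \<cdot>\<^sub>v v \<in> W" if "v \<in> W" for c v using that clD by (auto simp: W_def)
    show "u \<noteq> 0\<^sub>v n" by (rule u)
    show "u \<in> W"
    proof -
      have "\<psi> (cl d) = \<psi> d" if d: "d \<in> D" for d
      proof -
        have "adj l * cl d * l = d" using l d by (simp add: cl_def mat_assoc[where n = n])
        then show ?thesis using st[OF clD[OF d]] by simp
      qed
      then show ?thesis using u \<psi> clD by (simp add: W_def)
    qed
    show "d *\<^sub>v v \<in> W" if d: "d \<in> D" and v: "v \<in> W" for d v
    proof -
      have vc: "v \<in> carrier_vec n" using v by (simp add: W_def)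
      have "cl e *\<^sub>v (d *\<^sub>v v) = e *\<^sub>v (d *\<^sub>v v)" if e: "e \<in> D" for e
      proof -
        have "cl e *\<^sub>v (d *\<^sub>v v) = (d * cl e) *\<^sub>v v"
          using d clD[OF e] vc D_comm[OF clD[OF e] d] by (simp add: mult_vec_assoc[of _ n, symmetric])
        also have "\<dots> = d *\<^sub>v (e *\<^sub>v v)" using d e clD[OF e] v vc by (simp add: mult_vec_assoc[of _ n] W_def)
        also have "\<dots> = e *\<^sub>v (d *\<^sub>v v)"
          using d e vc D_comm[OF d e] by (simp add: mult_vec_assoc[of _ n, symmetric])
        finally show ?thesis .
      qed
      then show ?thesis using vc d by (simp add: W_def)
    qed
    show "h *\<^sub>v v \<in> W" if h: "h \<in> L" and v: "v \<in> W" for h v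
    proof -
      have vc: "v \<in> carrier_vec n" using v by (simp add: W_def)
      have "cl d *\<^sub>v (h *\<^sub>v v) = d *\<^sub>v (h *\<^sub>v v)" if d: "d \<in> D" for d
      proof -
        have e: "adj h * d * h \<in> D" using d h by simp
        have "adj h * cl d * h = cl (adj h * d * h)"
        proof -
          have "adj h * cl d * h = (adj h * l) * d * (adj l * h)" using d h l by (simp add: cl_def mat_assoc[where n = n])
          also have "\<dots> = (l * adj h) * d * (h * adj l)" using L_comm[of "adj h" l] L_comm[of "adj l" h] h l by simp
          finally show ?thesis using d h l by (simp add: cl_def mat_assoc[where n = n])
        qed
        then have "cl d *\<^sub>v (h *\<^sub>v v) = h *\<^sub>v (cl (adj h * d * h) *\<^sub>v v)"
          using conj_move[OF clD[OF d] LG[OF h] vc] by simp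
        also have "\<dots> = h *\<^sub>v ((adj h * d * h) *\<^sub>v v)" using v e by (simp add: W_def)
        also have "\<dots> = d *\<^sub>v (h *\<^sub>v v)" using conj_move[OF d LG[OF h] vc] by simp
        finally show ?thesis .
      qed
      then show ?thesis using vc h by (simp add: W_def)
    qed
  qed
  then have cv: "cl d *\<^sub>v v = d *\<^sub>v v" if "d \<in> D" "v \<in> carrier_vec n" for d v using that by (auto simp: W_def)
  have "cl d = d" if d: "d \<in> D" for d
  proof (rule mat_eqI[where n = n])
    fix i j assume ij: "i < n" "j < n"
    have "(cl d *\<^sub>v unit_vec n j) $ i = (d *\<^sub>v unit_vec n j) $ i" using cv[OF d] by simp
    then show "cl d $$ (i, j) = d $$ (i, j)" using ij d DG[OF clD[OF d]] by (simp add: scalar_prod_right_unit)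
  qed (use d clD in auto)
  then have "l * d = d * l" if d: "d \<in> D" for d
  proof -
    have "cl d * l = d * l" using \<open>\<And>d. d \<in> D \<Longrightarrow> cl d = d\<close> d by simp
    then show ?thesis using d l by (simp add: cl_def mat_assoc[where n = n])
  qed
  then obtain c where c: "l = c \<cdot>\<^sub>m 1\<^sub>m n" using commutes_G[of l] L_comm l by auto
  then have "c = 1 \<or> c = -1" using scalar_sign[of c] l LG[of l] by simp
  then have "l * l = 1\<^sub>m n" using c by (auto simp: mat_smult[where n = n])
  then show ?thesis by (rule L_sq[rotated]) (rule l)
qed

end

section \<open>Weighted cyclic shifts\<close>

text \<open>
  The cyclic shift by \<open>s\<close> places with weights \<open>f\<close>: the basis vector \<open>e\<^sub>j\<close> goes to \<open>f j\<close> times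
  \<open>e\<^sub>j\<^sub>+\<^sub>s\<close>. Both the powers of the cycle matrix and the diagonal matrices are of this form, and
  so are all products and commutators that occur.
\<close>

definition shift_mat :: "nat \<Rightarrow> nat \<Rightarrow> (nat \<Rightarrow> complex) \<Rightarrow> complex mat" where
  "shift_mat n s f = mat n n (\<lambda>(i, j). if i = (j + s) mod n then f j else 0)"

lemma shift_mat_M [simp]: "shift_mat n s f \<in> M n"
  by (simp add: shift_mat_def)

lemma shift_mat_entry: "i < n \<Longrightarrow> j < n \<Longrightarrow> shift_mat n s f $$ (i, j) = (if i = (j + s) mod n then f j else 0)"
  by (simp add: shift_mat_def)

lemma mult_shift_mat_entry:
  assumes "A \<in> carrier_mat r n" "i < r" "j < n"
  shows "(A * shift_mat n s f) $$ (i, j) = A $$ (i, (j + s) mod n) * f j"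
proof -
  have "(A * shift_mat n s f) $$ (i, j) = (\<Sum>l<n. A $$ (i, l) * shift_mat n s f $$ (l, j))"
    using assms by (simp add: shift_mat_def scalar_prod_def lessThan_atLeast0)
  also have "\<dots> = (\<Sum>l<n. if (j + s) mod n = l then A $$ (i, l) * f j else 0)"
    using assms by (intro sum.cong) (auto simp: shift_mat_entry)
  finally show ?thesis using assms by simp
qed

lemma shift_mat_mult: "shift_mat n s f * shift_mat n t g = shift_mat n (s + t) (\<lambda>j. f ((j + t) mod n) * g j)"
proof (rule mat_eqI[where n = n])
  fix i j assume ij: "i < n" "j < n"
  then show "(shift_mat n s f * shift_mat n t g) $$ (i, j) = shift_mat n (s + t) (\<lambda>j. f ((j + t) mod n) * g j) $$ (i, j)"
    by (simp add: mult_shift_mat_entry[of _ n] shift_mat_entry mod_add_left_eq add.assoc add.commute[of t s])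
qed auto

lemma shift_mat_mod: "shift_mat n (s mod n) f = shift_mat n s f"
  by (simp add: shift_mat_def mod_add_right_eq)

lemma shift_mat_cong: "s mod n = t mod n \<Longrightarrow> (\<And>j. j < n \<Longrightarrow> f j = g j) \<Longrightarrow> shift_mat n s f = shift_mat n t g"
  unfolding shift_mat_mod[of n s, symmetric] shift_mat_mod[of n t, symmetric] by (auto simp: shift_mat_def)

lemma shift_mat_one: "shift_mat n 0 (\<lambda>_. 1) = 1\<^sub>m n"
  by (rule mat_eqI[where n = n]) (auto simp: shift_mat_entry)

lemma shift_mat_minus: "shift_mat n s f - shift_mat n s g = shift_mat n s (\<lambda>j. f j - g j)"
  by (rule mat_eqI[where n = n]) (auto simp: shift_mat_def)

lemma cycle_mat_power_shift_mat: "cycle_mat n ^\<^sub>m k = shift_mat n k (\<lambda>_. 1)"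
  by (simp add: cycle_mat_power shift_mat_def)

lemma cycle_mat_M [simp]: "cycle_mat n \<in> M n"
  by (simp add: cycle_mat_def)

lemma sign_diag_shift_mat: "J \<in> sign_diag n \<Longrightarrow> J = shift_mat n 0 (\<lambda>j. J $$ (j, j))"
  by (rule mat_eqI[where n = n]) (auto simp: sign_diag_def shift_mat_entry diagonal_mat_def)

lemma cycle_power_GL: "n > 0 \<Longrightarrow> cycle_mat n ^\<^sub>m k \<in> carrier (GL n)"
  and GL_cycle_pow: "n > 0 \<Longrightarrow> cycle_mat n [^]\<^bsub>GL n\<^esub> k = cycle_mat n ^\<^sub>m k"
proof -
  assume n: "n > 0"
  interpret group "GL n" by (rule group_GL)
  show p: "cycle_mat n [^]\<^bsub>GL n\<^esub> k = cycle_mat n ^\<^sub>m k" by (induction k) (auto simp: carrier_matD[OF cycle_mat_M])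
  show "cycle_mat n ^\<^sub>m k \<in> carrier (GL n)"
    unfolding p[symmetric] by (rule nat_pow_closed[OF cycle_mat_in_GL[OF n]])
qed

lemma cycle_power_eq_one_iff:
  assumes "n > 0" shows "cycle_mat n ^\<^sub>m k = 1\<^sub>m n \<longleftrightarrow> n dvd k"
proof -
  interpret group "GL n" by (rule group_GL)
  show ?thesis
    using pow_eq_id[OF cycle_mat_in_GL[OF assms], of k] ord_cycle_mat[OF assms] GL_cycle_pow[OF assms, of k] by simp
qed

lemma inv_GL_eq:
  assumes "A \<in> M n" "B \<in> M n" "A * B = 1\<^sub>m n" "B * A = 1\<^sub>m n"
  shows "inv\<^bsub>GL n\<^esub> B = A" "A \<in> carrier (GL n)" "B \<in> carrier (GL n)"
proof -
  interpret group "GL n" by (rule group_GL)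
  have "det A * det B = 1" using assms det_mult[of A n B] by simp
  then show G: "A \<in> carrier (GL n)" "B \<in> carrier (GL n)" using assms by auto
  show "inv\<^bsub>GL n\<^esub> B = A" using G assms by (intro inv_equality) auto
qed

text \<open>
  The exponent is \<open>- k\<close> modulo \<open>n\<close>, written as a natural number.
\<close>

lemma inv_cycle_power:
  assumes n: "n > 0"
  shows "inv\<^bsub>GL n\<^esub> (cycle_mat n ^\<^sub>m k) = shift_mat n (n * k - k) (\<lambda>_. 1)"
proof -
  have e: "n * k - k + k = n * k" "k + (n * k - k) = n * k" using n by (cases n; simp)+
  have "shift_mat n (n * k) (\<lambda>_. 1 :: complex) = 1\<^sub>m n" unfolding shift_mat_one[symmetric] by (rule shift_mat_cong) auto
  then show ?thesis
    by (intro inv_GL_eq) (auto simp: cycle_mat_power_shift_mat shift_mat_mult e)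
qed

lemma cycle_group_eq:
  assumes n: "n > 0" shows "cycle_group n = range (\<lambda>k. cycle_mat n ^\<^sub>m k)"
proof -
  interpret group "GL n" by (rule group_GL)
  have e: "cycle_group n = {cycle_mat n [^]\<^bsub>GL n\<^esub> k | k. k \<in> (UNIV :: int set)}"
    unfolding cycle_group_def by (rule generate_pow[OF cycle_mat_in_GL[OF n]])
  have nn: "cycle_mat n [^]\<^bsub>GL n\<^esub> k \<in> range (\<lambda>k. cycle_mat n ^\<^sub>m k)" for k :: int
  proof (cases "k < 0")
    case True
    then have "cycle_mat n [^]\<^bsub>GL n\<^esub> k = cycle_mat n ^\<^sub>m (n * nat (- k) - nat (- k))"
      using inv_cycle_power[OF n, of "nat (- k)"]
      by (simp add: int_pow_def2 GL_cycle_pow[OF n] cycle_mat_power_shift_mat)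
    then show ?thesis by simp
  next
    case False
    then show ?thesis by (simp add: int_pow_def2 GL_cycle_pow[OF n])
  qed
  have "cycle_mat n ^\<^sub>m k = cycle_mat n [^]\<^bsub>GL n\<^esub> int k" for k
    by (simp add: int_pow_int GL_cycle_pow[OF n])
  then show ?thesis unfolding e using nn by blast
qed

lemma conj_by_cycle:
  assumes n: "n > 0"
  shows "conj_by n (cycle_mat n ^\<^sub>m k) (shift_mat n 0 f) = shift_mat n 0 (\<lambda>j. f ((j + k) mod n))"
proof -
  have "n * k - k + k = n * k" using n by (cases n; simp)
  then show ?thesis
    unfolding conj_by_def inv_cycle_power[OF n] unfolding cycle_mat_power_shift_mat shift_mat_mult
    by (intro shift_mat_cong) auto
qed

lemma foldr_shift_mat:
  "foldr (*) (map (\<lambda>k. shift_mat n 0 (f k)) xs) (1\<^sub>m n) = shift_mat n 0 (\<lambda>j. prod_list (map (\<lambda>k. f k j) xs))"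
proof (induction xs)
  case Nil
  then show ?case by (simp add: shift_mat_one)
next
  case (Cons x xs)
  then show ?case by (simp add: shift_mat_mult) (rule shift_mat_cong; simp)
qed

lemma ord_cycle_power:
  assumes n: "n > 0"
  shows "group.ord (GL n) (cycle_mat n ^\<^sub>m s) dvd n" "group.ord (GL n) (cycle_mat n ^\<^sub>m s) > 0"
    "(cycle_mat n ^\<^sub>m s) ^\<^sub>m t = cycle_mat n ^\<^sub>m (s * t)"
proof -
  interpret group "GL n" by (rule group_GL)
  have gp: "(cycle_mat n ^\<^sub>m s) [^]\<^bsub>GL n\<^esub> (t::nat) = cycle_mat n ^\<^sub>m (s * t)" for t
    unfolding GL_cycle_pow[OF n, symmetric] by (rule nat_pow_pow[OF cycle_mat_in_GL[OF n]])
  have p: "(cycle_mat n ^\<^sub>m s) [^]\<^bsub>GL n\<^esub> t = (cycle_mat n ^\<^sub>m s) ^\<^sub>m t" for t :: nat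
    by (induction t) (auto simp: carrier_matD[OF cycle_mat_M])
  show "(cycle_mat n ^\<^sub>m s) ^\<^sub>m t = cycle_mat n ^\<^sub>m (s * t)" using gp p by simp
  have "(cycle_mat n ^\<^sub>m s) [^]\<^bsub>GL n\<^esub> n = \<one>\<^bsub>GL n\<^esub>"
    unfolding gp using cycle_power_eq_one_iff[OF n, of "s * n"] by simp
  then show d: "group.ord (GL n) (cycle_mat n ^\<^sub>m s) dvd n"
    using pow_eq_id[OF cycle_power_GL[OF n]] by blast
  then show "group.ord (GL n) (cycle_mat n ^\<^sub>m s) > 0" using n by (metis dvd_0_left gr0I)
qed

text \<open>
  The diagonal entries of the average are the products of the entries of \<open>J\<close> along the orbits of
  the shift.
\<close>

lemma J_set_orbit:
  assumes n: "n > 0" and J: "J \<in> J_set n" and s: "\<not> n dvd s" and i: "i < n"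
  shows "(\<Prod>t<group.ord (GL n) (cycle_mat n ^\<^sub>m s). J $$ ((i + s * t) mod n, (i + s * t) mod n)) = det J"
proof -
  define m where "m = group.ord (GL n) (cycle_mat n ^\<^sub>m s)"
  define f where "f j = J $$ (j, j)" for j
  have Js: "J = shift_mat n 0 f" using J sign_diag_shift_mat[of J n] unfolding J_set_def f_def by blast
  have "cycle_mat n ^\<^sub>m s \<in> cycle_group n - {1\<^sub>m n}"
    using s cycle_power_eq_one_iff[OF n] by (auto simp: cycle_group_eq[OF n])
  then have "avg n (cycle_mat n ^\<^sub>m s) J = det J \<cdot>\<^sub>m 1\<^sub>m n" using J by (auto simp: J_set_def)
  also have "avg n (cycle_mat n ^\<^sub>m s) J =
      foldr (*) (map (\<lambda>t. shift_mat n 0 (\<lambda>j. f ((j + s * t) mod n))) [0..<m]) (1\<^sub>m n)"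
    unfolding avg_def m_def[symmetric] ord_cycle_power(3)[OF n]
    by (subst Js) (simp only: conj_by_cycle[OF n])
  also have "\<dots> = shift_mat n 0 (\<lambda>j. prod_list (map (\<lambda>t. f ((j + s * t) mod n)) [0..<m]))"
    by (rule foldr_shift_mat)
  finally have "shift_mat n 0 (\<lambda>j. prod_list (map (\<lambda>t. f ((j + s * t) mod n)) [0..<m])) $$ (i, i) = (det J \<cdot>\<^sub>m 1\<^sub>m n) $$ (i, i)"
    by simp
  then have "prod_list (map (\<lambda>t. f ((i + s * t) mod n)) [0..<m]) = det J"
    using i by (simp add: shift_mat_entry)
  then show ?thesis
    by (simp add: prod.distinct_set_conv_list[symmetric] m_def[symmetric] f_def[symmetric] lessThan_atLeast0)
qed

lemma sign_diag_entry: "J \<in> sign_diag n \<Longrightarrow> i < n \<Longrightarrow> J $$ (i, i) = 1 \<or> J $$ (i, i) = -1"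
  by (auto simp: sign_diag_def)

text \<open>
  For an eigenvector with nonzero eigenvalue, a zero weight forces the next entry along the orbit
  of the shift to vanish, and then all further entries; as the orbit closes up, the whole orbit
  vanishes.
\<close>

lemma shift_mat_real_spectrum:
  assumes n: "n > 0" and fr: "\<And>j. j < n \<Longrightarrow> f j \<in> \<real>"
    and zero: "\<And>j. \<not> n dvd s \<Longrightarrow> j < n \<Longrightarrow> \<exists>t. f ((j + s * t) mod n) = 0"
  shows "spectrum (shift_mat n s f) \<subseteq> \<real>"
proof
  fix l assume "l \<in> spectrum (shift_mat n s f)"
  then obtain v where v: "v \<in> carrier_vec n" "v \<noteq> 0\<^sub>v n" "shift_mat n s f *\<^sub>v v = l \<cdot>\<^sub>v v"
    by (auto simp: spectrum_def eigenvalue_def eigenvector_def shift_mat_def)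
  have step: "l * v $ ((j + s) mod n) = f j * v $ j" if j: "j < n" for j
  proof -
    define i where "i = (j + s) mod n"
    have i: "i < n" using n by (simp add: i_def)
    have inj: "j' = j" if "j' < n" "i = (j' + s) mod n" for j'
    proof -
      have "[j' + s = j + s] (mod n)" using that by (simp add: i_def cong_def)
      then have "[j' = j] (mod n)" by (rule cong_add_rcancel_nat[THEN iffD1])
      then show ?thesis using that j by (simp add: cong_def)
    qed
    have "l * v $ i = (shift_mat n s f *\<^sub>v v) $ i" using i v by simp
    also have "\<dots> = (\<Sum>j'<n. shift_mat n s f $$ (i, j') * v $ j')"
      using i v(1) by (simp add: scalar_prod_def shift_mat_def lessThan_atLeast0)
    also have "\<dots> = (\<Sum>j'<n. if j' = j then f j * v $ j else 0)"
      using i inj by (intro sum.cong) (auto simp: shift_mat_entry i_def)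
    finally show ?thesis using j by (simp add: i_def)
  qed
  obtain j where j: "j < n" "v $ j \<noteq> 0" using v by (metis carrier_vecD eq_vecI index_zero_vec)
  show "l \<in> \<real>"
  proof (cases "n dvd s")
    case True
    then have "(j + s) mod n = j" using j by (auto elim!: dvdE)
    then have "l * v $ j = f j * v $ j" using step[OF j(1)] by simp
    then show ?thesis using j fr by simp
  next
    case False
    show ?thesis
    proof (cases "l = 0")
      case True
      then show ?thesis by simp
    next
      case l: False
      obtain t where t: "f ((j + s * t) mod n) = 0" using zero[OF False j(1)] by blast
      have z: "v $ ((j + s * (t + 1 + k)) mod n) = 0" for k
      proof (induction k)
        case 0
        have "l * v $ (((j + s * t) mod n + s) mod n) = 0" using step[of "(j + s * t) mod n"] n t by simp
        then show ?case using l by (simp add: mod_add_left_eq add.assoc add.commute[of s])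
      next
        case (Suc k)
        have "l * v $ (((j + s * (t + 1 + k)) mod n + s) mod n) = 0"
          using step[of "(j + s * (t + 1 + k)) mod n"] n Suc by simp
        moreover have "((j + s * (t + 1 + k)) mod n + s) mod n = (j + s * (t + 1 + Suc k)) mod n"
          by (simp add: mod_add_left_eq) (simp add: algebra_simps)
        ultimately show ?case using l by simp
      qed
      \<comment> \<open>After \<open>n (t + 1)\<close> steps the orbit is back at \<open>j\<close>.\<close>
      have e: "t + 1 + (n * (t + 1) - (t + 1)) = n * (t + 1)" using n by (cases n) auto
      then have "v $ ((j + s * (n * (t + 1))) mod n) = 0" using z[of "n * (t + 1) - (t + 1)"] by (simp only: e)
      moreover have "(j + s * (n * (t + 1))) mod n = j"
        using j(1) by (simp add: mult.left_commute[of s n] del: mult_Suc mult_Suc_right)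
      ultimately show ?thesis using j by simp
    qed
  qed
qed

text \<open>
  Suppose that along an orbit no weight \<open>D\<^sub>j\<^sub>+\<^sub>b E\<^sub>j - E\<^sub>j\<^sub>+\<^sub>a D\<^sub>j\<close> of the commutator vanishes. As all
  entries are signs, both terms are then opposite, and multiplying along the orbit, whose
  length is odd, gives \<open>det D det E = - det E det D\<close>.
\<close>

lemma cycle_J_commutator_real:
  assumes n: "odd n" and D: "D \<in> J_set n" and E: "E \<in> J_set n"
  shows "spectrum ((cycle_mat n ^\<^sub>m a * D) * (cycle_mat n ^\<^sub>m b * E) -
    (cycle_mat n ^\<^sub>m b * E) * (cycle_mat n ^\<^sub>m a * D)) \<subseteq> \<real>"
proof -
  have n0: "n > 0" using n by (cases n) auto
  define d e where "d j = D $$ (j, j)" and "e j = E $$ (j, j)" for j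
  have DE: "D = shift_mat n 0 d" "E = shift_mat n 0 e"
    using D E sign_diag_shift_mat[of D n] sign_diag_shift_mat[of E n] unfolding J_set_def d_def e_def by blast+
  have pm: "d j = 1 \<or> d j = -1" "e j = 1 \<or> e j = -1" if "j < n" for j
    using that D E sign_diag_entry by (auto simp: J_set_def d_def e_def)
  define f where "f j = d ((j + b) mod n) * e j - e ((j + a) mod n) * d j" for j
  have fr: "f j \<in> \<real>" if "j < n" for j
    using pm[OF that] pm[of "(j + a) mod n"] pm[of "(j + b) mod n"] n0 by (auto simp: f_def)
  have eq: "(cycle_mat n ^\<^sub>m a * D) * (cycle_mat n ^\<^sub>m b * E) - (cycle_mat n ^\<^sub>m b * E) * (cycle_mat n ^\<^sub>m a * D)
      = shift_mat n (a + b) f"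
  proof -
    have "(cycle_mat n ^\<^sub>m a * D) * (cycle_mat n ^\<^sub>m b * E) = shift_mat n (a + b) (\<lambda>j. d ((j + b) mod n) * e j)"
      unfolding DE cycle_mat_power_shift_mat shift_mat_mult by (intro shift_mat_cong) auto
    moreover have "(cycle_mat n ^\<^sub>m b * E) * (cycle_mat n ^\<^sub>m a * D) = shift_mat n (a + b) (\<lambda>j. e ((j + a) mod n) * d j)"
      unfolding DE cycle_mat_power_shift_mat shift_mat_mult by (intro shift_mat_cong) (auto simp: add.commute)
    ultimately show ?thesis unfolding f_def by (simp only: shift_mat_minus)
  qed
  have "\<exists>t. f ((j + (a + b) * t) mod n) = 0" if s: "\<not> n dvd a + b" and j: "j < n" for j
  proof (rule ccontr)
    assume no: "\<nexists>t. f ((j + (a + b) * t) mod n) = 0"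
    define s where "s = a + b"
    define m where "m = group.ord (GL n) (cycle_mat n ^\<^sub>m s)"
    have "m dvd n" unfolding m_def by (rule ord_cycle_power(1)[OF n0])
    then have m: "odd m" using n dvd_trans by blast
    define k where "k t = (j + s * t) mod n" for t
    have k: "k t < n" for t using n0 by (simp add: k_def)
    have sgn: "d ((k t + b) mod n) * e (k t) = - (e ((k t + a) mod n) * d (k t))" for t
    proof -
      have "f (k t) \<noteq> 0" using no by (auto simp: k_def s_def)
      then show ?thesis
        using pm[OF k[of t]] pm[of "(k t + a) mod n"] pm[of "(k t + b) mod n"] n0 by (auto simp: f_def)
    qed
    have shift: "(k t + c) mod n = ((j + c) mod n + s * t) mod n" for t c
      by (simp add: k_def mod_add_left_eq add.assoc add.commute[of c])
    have orb: "(\<Prod>t<m. d ((k t + c) mod n)) = det D" "(\<Prod>t<m. e ((k t + c) mod n)) = det E" for c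
      unfolding shift d_def e_def m_def using s n0
      by (auto intro!: J_set_orbit D E simp: s_def)
    have k0: "(k t + 0) mod n = k t" for t using k[of t] by simp
    have nz: "d (k t) \<noteq> 0" "e (k t) \<noteq> 0" for t using pm[OF k[of t]] by auto
    have "det D * det E = (\<Prod>t<m. d ((k t + b) mod n) * e (k t))"
      using orb(1)[of b] orb(2)[of 0] by (simp only: k0 prod.distrib)
    also have "\<dots> = (\<Prod>t<m. (-1) * (e ((k t + a) mod n) * d (k t)))"
      by (intro prod.cong) (auto simp: sgn)
    also have "\<dots> = (-1) ^ m * (det E * det D)"
      using orb(2)[of a] orb(1)[of 0] by (simp only: k0 prod.distrib prod_constant card_lessThan)
    finally have "det D * det E = 0" using m by simp
    moreover have "det D \<noteq> 0"
      unfolding orb(1)[of 0, symmetric] k0 using nz by (auto simp: prod_zero_iff)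
    moreover have "det E \<noteq> 0"
      unfolding orb(2)[of 0, symmetric] k0 using nz by (auto simp: prod_zero_iff)
    ultimately show False by simp
  qed
  then show ?thesis unfolding eq using fr by (intro shift_mat_real_spectrum[OF n0]) auto
qed

lemma spectrum_conjugate:
  assumes "X \<in> M n" "Y \<in> M n" "X * Y = 1\<^sub>m n" "Y * X = 1\<^sub>m n" "A \<in> M n"
  shows "spectrum (Y * A * X) = spectrum A"
proof -
  have "similar_mat (Y * A * X) A"
    unfolding similar_mat_def similar_mat_wit_def
    using assms by (intro exI[of _ Y] exI[of _ X]) (auto simp: Let_def)
  then have "char_poly (Y * A * X) = char_poly A" by (rule char_poly_similar)
  then show ?thesis
    using assms spectrum_root_char_poly[of "Y * A * X" n] spectrum_root_char_poly[of A n] by simp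
qed

section \<open>The monomial form\<close>

lemma adj_mult_entry:
  assumes "A \<in> carrier_mat n m" "i < m" "j < m"
  shows "(adj A * A) $$ (i, j) = (\<Sum>l<n. cnj (A $$ (l, i)) * A $$ (l, j))"
  using assms by (simp add: adj_def scalar_prod_def lessThan_atLeast0)

text \<open>
  Conjugation by the unitary \<open>g\<close> takes \<open>B B\<^sup>*\<close> to \<open>(g B) (g B)\<^sup>* = B U U\<^sup>* B\<^sup>* = B B\<^sup>*\<close>.
\<close>

lemma commute_if_intertwines:
  assumes g: "g \<in> M n" "h \<in> M n" "h * g = 1\<^sub>m n" "adj g = h" and B: "B \<in> carrier_mat n m" and U: "U \<in> M m" "U * adj U = 1\<^sub>m m"
    and gB: "g * B = B * U"
  shows "(B * adj B) * g = g * (B * adj B)"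
proof -
  have aB: "adj B \<in> carrier_mat m n" using B by simp
  have aBh: "adj B * h \<in> carrier_mat m n" using aB g(2) by (rule mult_carrier_mat)
  have "g * (B * adj B) * h = (g * B) * (adj B * h)"
    using g(1,2) B aB aBh by (simp add: assoc_mult_mat[of _ n n _ m _ n] assoc_mult_mat[of _ n m _ n _ n] assoc_mult_mat[of _ n n _ n _ n])
  also have "adj B * h = adj (g * B)" using g B by (simp add: adj_mult[of _ n n _ m])
  also have "\<dots> = adj U * adj B" unfolding gB using B U by (simp add: adj_mult[of _ n m _ m])
  also have "(g * B) * (adj U * adj B) = B * ((U * adj U) * adj B)"
    unfolding gB using B aB U(1) mult_carrier_mat[OF adj_carrier[OF U(1)] aB] by (simp add: assoc_mult_mat[of _ n m _ m _ n] assoc_mult_mat[of _ m m _ m _ n])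
  also have "\<dots> = B * adj B" unfolding U(2) left_mult_one_mat[OF aB] ..
  finally have e: "g * (B * adj B) * h = B * adj B" .
  have "(B * adj B) * g = g * (B * adj B) * h * g" by (simp only: e)
  also have "\<dots> = g * (B * adj B) * (h * g)"
    using g(1,2) B aB by (intro assoc_mult_mat[of _ n n _ n _ n]) auto
  also have "\<dots> = g * (B * adj B)" unfolding g(3) using g(1) B aB by (intro right_mult_one_mat[of _ n]) auto
  finally show ?thesis .
qed

lemma adj_shift_unitary:
  assumes n: "n > 0" and f: "\<And>j. j < n \<Longrightarrow> f j * cnj (f j) = 1"
  shows "shift_mat n s f * adj (shift_mat n s f) = 1\<^sub>m n"
proof -
  have "adj (shift_mat n s f) * shift_mat n s f = 1\<^sub>m n"
  proof (rule mat_eqI[where n = n])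
    fix i j assume ij: "i < n" "j < n"
    have inj: "i = j" if "(i + s) mod n = (j + s) mod n"
    proof -
      have "[i + s = j + s] (mod n)" using that by (simp add: cong_def)
      then have "[i = j] (mod n)" by (rule cong_add_rcancel_nat[THEN iffD1])
      then show ?thesis using ij by (simp add: cong_def)
    qed
    have "(adj (shift_mat n s f) * shift_mat n s f) $$ (i, j) = adj (shift_mat n s f) $$ (i, (j + s) mod n) * f j"
      using ij by (intro mult_shift_mat_entry[of _ n]) auto
    also have "\<dots> = (if i = j then 1 else 0)"
      using ij n f[of j] inj by (auto simp: adj_def shift_mat_def mult.commute)
    finally show "(adj (shift_mat n s f) * shift_mat n s f) $$ (i, j) = 1\<^sub>m n $$ (i, j)" using ij by simp
  qed auto
  then show ?thesis by (rule mat_mult_left_right_inverse[rotated 2]) auto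
qed

context split_real_group begin

text \<open>
  The columns of \<open>B\<close> are the vectors \<open>c\<^sup>j u\<close>, where \<open>j\<close> runs below the order \<open>m\<close> of \<open>c\<close>. The Gram
  matrix \<open>B\<^sup>* B\<close> is diagonal because the columns belong to different characters of \<open>D\<close>, and
  its diagonal is constant because \<open>c\<close> is unitary. The matrix \<open>B B\<^sup>*\<close> commutes with the group,
  hence is scalar too. So both are multiples of the identity by the same nonzero number, and
  comparing their traces gives \<open>m = n\<close>.
\<close>

theorem monomial_basis:
  obtains B Y c \<chi> where "B \<in> M n" "Y \<in> M n" "Y * B = 1\<^sub>m n" "B * Y = 1\<^sub>m n" "odd n"
    "c \<in> L" "\<And>x. x \<in> L \<Longrightarrow> \<exists>k. x = c ^\<^sub>m k" "\<And>k. c ^\<^sub>m k * B = B * cycle_mat n ^\<^sub>m k"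
    "\<And>d. d \<in> D \<Longrightarrow> d * B = B * shift_mat n 0 (\<chi> d)"
    "\<And>d i. d \<in> D \<Longrightarrow> \<chi> d i = 1 \<or> \<chi> d i = (-1::complex)"
proof -
  obtain c where c: "c \<in> L" "\<And>x. x \<in> L \<Longrightarrow> \<exists>k. x = c ^\<^sub>m k" using L_cyclic by blast
  obtain u \<psi> where u: "u \<in> carrier_vec n" "u \<noteq> 0\<^sub>v n" and du: "\<And>d. d \<in> D \<Longrightarrow> d *\<^sub>v u = \<psi> d \<cdot>\<^sub>v u"
    and \<psi>: "\<And>d. d \<in> D \<Longrightarrow> \<psi> d = 1 \<or> \<psi> d = (-1::complex)" by (rule D_eigenvector) blast
  obtain r where r: "odd r" "r dvd N" "\<And>l. l \<in> L \<Longrightarrow> l ^\<^sub>m r = 1\<^sub>m n" by (rule L_odd) blast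
  have cG: "c \<in> carrier gp" using c by simp
  have cM: "c ^\<^sub>m k \<in> G" for k using c by simp
  define m where "m = gp.ord c"
  have "m dvd N" using gp.pow_eq_id[OF cG, of N] gp_pow[of c N] c by (simp add: m_def)
  then have m0: "m > 0" by (rule dvd_pos_nat[OF N_pos])
  have cm: "c ^\<^sub>m k = 1\<^sub>m n \<longleftrightarrow> m dvd k" for k
    using gp.pow_eq_id[OF cG, of k] gp_pow[of c k] c by (simp add: m_def)
  have cmod: "c ^\<^sub>m (k mod m) = c ^\<^sub>m k" for k
  proof -
    have "c ^\<^sub>m k = c ^\<^sub>m (m * (k div m)) * c ^\<^sub>m (k mod m)"
      using pow_add_mat[of c "m * (k div m)" "k mod m"] c by simp
    then show ?thesis using cm[of "m * (k div m)"] GM[OF cM] by simp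
  qed
  define b where "b j = c ^\<^sub>m j *\<^sub>v u" for j
  have b: "b j \<in> carrier_vec n" for j using c u by (simp add: b_def)
  define \<chi> where "\<chi> d j = \<psi> (adj (c ^\<^sub>m j) * d * c ^\<^sub>m j)" for d j
  have \<chi>: "\<chi> d j = 1 \<or> \<chi> d j = -1" if "d \<in> D" for d j
    unfolding \<chi>_def using that cM by (intro \<psi>) simp
  define B where "B = mat n m (\<lambda>(i, j). b j $ i)"
  have B: "B \<in> carrier_mat n m" by (simp add: B_def)
  have aB: "adj B \<in> carrier_mat m n" using B by simp
  have colB: "col B j = b j" if "j < m" for j
    using that b by (intro eq_vecI) (auto simp: B_def carrier_vecD[OF b])
  have Bentry: "B $$ (i, j) = b j $ i" if "i < n" "j < m" for i j using that by (simp add: B_def)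
  have gB: "(g * B) $$ (i, j) = (g *\<^sub>v b j) $ i" if "i < n" "j < m" "g \<in> G" for g i j
  proof -
    have "(g * B) $$ (i, j) = row g i \<bullet> col B j" using that B by (intro index_mult_mat(1)) auto
    then show ?thesis using that colB by simp
  qed
  have cB: "c ^\<^sub>m k * B = B * shift_mat m k (\<lambda>_. 1)" for k
  proof (rule eq_matI)
    fix i j assume "i < dim_row (B * shift_mat m k (\<lambda>_. 1))" "j < dim_col (B * shift_mat m k (\<lambda>_. 1))"
    then have ij: "i < n" "j < m" using B by (auto simp: shift_mat_def)
    have "c ^\<^sub>m k *\<^sub>v b j = b (j + k)"
      unfolding b_def using c u pow_add_mat[of c k j] by (simp add: mult_vec_assoc[of _ n] add.commute)
    moreover have "b ((j + k) mod m) = b (j + k)" by (simp add: b_def cmod)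
    moreover have "(B * shift_mat m k (\<lambda>_. 1)) $$ (i, j) = b ((j + k) mod m) $ i"
      using mult_shift_mat_entry[OF B ij, of k "\<lambda>_. 1"] Bentry[OF ij(1), of "(j + k) mod m"] m0 by simp
    ultimately show "(c ^\<^sub>m k * B) $$ (i, j) = (B * shift_mat m k (\<lambda>_. 1)) $$ (i, j)" using gB[OF ij cM] by simp
  qed (use B Gdim[OF cM] in \<open>auto simp: shift_mat_def\<close>)
  have dB: "d * B = B * shift_mat m 0 (\<chi> d)" if d: "d \<in> D" for d
  proof (rule eq_matI)
    fix i j assume "i < dim_row (B * shift_mat m 0 (\<chi> d))" "j < dim_col (B * shift_mat m 0 (\<chi> d))"
    then have ij: "i < n" "j < m" using B by (auto simp: shift_mat_def)
    have e: "adj (c ^\<^sub>m j) * d * c ^\<^sub>m j \<in> D" using d cM by simp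
    have "d *\<^sub>v b j = \<chi> d j \<cdot>\<^sub>v b j"
      unfolding b_def conj_move[OF d cM u(1)] du[OF e] \<chi>_def[symmetric] using u cM by simp
    then have "(d * B) $$ (i, j) = \<chi> d j * b j $ i" using gB[OF ij, of d] d ij b by (simp add: carrier_vecD[OF b])
    also have "\<dots> = (B * shift_mat m 0 (\<chi> d)) $$ (i, j)"
      using mult_shift_mat_entry[OF B ij, of 0 "\<chi> d"] Bentry[OF ij] ij by simp
    finally show "(d * B) $$ (i, j) = (B * shift_mat m 0 (\<chi> d)) $$ (i, j)" .
  qed (use B Gdim[OF DG[OF d]] in \<open>auto simp: shift_mat_def\<close>)
  define T where "T = adj B * B"
  have T: "T \<in> M m" unfolding T_def by (rule mult_carrier_mat[OF aB B])
  have T_off: "T $$ (i, j) = 0" if ij: "i < m" "j < m" "i < j" for i j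
  proof -
    obtain d where d: "d \<in> D" "\<chi> d i \<noteq> \<chi> d j"
    proof (rule ccontr)
      assume no: "\<not> thesis"
      have eq: "\<chi> d i = \<chi> d j" if "d \<in> D" for d
        by (rule ccontr) (use that no \<open>\<And>d. d \<in> D \<Longrightarrow> \<chi> d i \<noteq> \<chi> d j \<Longrightarrow> thesis\<close> in blast)
      have lL: "c ^\<^sub>m (j - i) \<in> L" using c by simp
      have "c ^\<^sub>m (j - i) = 1\<^sub>m n"
      proof (rule character_stabilizer_trivial[OF u du lL])
        fix d assume d: "d \<in> D"
        define g where "g = c ^\<^sub>m i"
        define l where "l = c ^\<^sub>m (j - i)"
        have gl: "g \<in> G" "l \<in> G" using cM by (simp_all add: g_def l_def)
        have cj: "c ^\<^sub>m j = g * l" using pow_add_mat[of c i "j - i"] c ij by (simp add: g_def l_def)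
        have e: "g * d * adj g \<in> D" using D_conj[OF d, of "adj g"] gl by simp
        have "adj g * (g * d * adj g) * g = d" using gl d by (simp add: mat_assoc[where n = n])
        then have "\<chi> (g * d * adj g) i = \<psi> d" by (simp add: \<chi>_def g_def[symmetric])
        moreover have "adj (g * l) * (g * d * adj g) * (g * l) = adj l * d * l"
          using gl d by (simp add: mat_assoc[where n = n] adj_mult[of _ n n _ n])
        then have "\<chi> (g * d * adj g) j = \<psi> (adj l * d * l)" by (simp add: \<chi>_def cj)
        ultimately show "\<psi> (adj (c ^\<^sub>m (j - i)) * d * c ^\<^sub>m (j - i)) = \<psi> d"
          using eq[OF e] by (simp add: l_def)
      qed
      then have "m dvd j - i" by (simp add: cm)
      then show False using ij by (auto dest: dvd_imp_le)
    qed
    define \<Delta> where "\<Delta> = shift_mat m 0 (\<chi> d)"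
    have \<Delta>: "\<Delta> \<in> M m" by (simp add: \<Delta>_def)
    have cnj: "cnj (\<chi> d i) = \<chi> d i" for i using \<chi>[OF d(1), of i] by auto
    have adj\<Delta>: "adj \<Delta> = \<Delta>"
      by (rule mat_eqI[where n = m]) (auto simp: \<Delta>_def adj_def shift_mat_def cnj)
    have dM: "d \<in> M n" using d by simp
    have "T * \<Delta> = adj B * (d * B)" unfolding dB[OF d(1)] \<Delta>_def[symmetric] T_def
      using B aB \<Delta> by (intro assoc_mult_mat[of _ m n _ m _ m]) auto
    also have "\<dots> = adj (d * B) * B"
      using B aB dM d by (simp add: adj_mult[of _ n n _ m] assoc_mult_mat[of _ m n _ n _ m])
    also have "\<dots> = \<Delta> * T" unfolding dB[OF d(1)] \<Delta>_def[symmetric] T_def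
      using B aB \<Delta> by (simp add: adj_mult[of _ n m _ m] adj\<Delta> assoc_mult_mat[of _ m m _ n _ m])
    finally have eq: "T * \<Delta> = \<Delta> * T" .
    have e1: "(T * \<Delta>) $$ (i, j) = T $$ (i, j) * \<chi> d j"
      using mult_shift_mat_entry[OF T ij(1,2), of 0 "\<chi> d"] ij by (simp add: \<Delta>_def)
    have e2: "(\<Delta> * T) $$ (i, j) = \<chi> d i * T $$ (i, j)"
    proof -
      have "(\<Delta> * T) $$ (i, j) = (\<Sum>l<m. \<Delta> $$ (i, l) * T $$ (l, j))" using T \<Delta> ij by (intro mat_mult_entry) auto
      also have "\<dots> = (\<Sum>l<m. if i = l then \<chi> d l * T $$ (l, j) else 0)"
        using ij by (intro sum.cong) (auto simp: \<Delta>_def shift_mat_entry)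
      finally show ?thesis using ij by simp
    qed
    have e3: "(T * \<Delta>) $$ (i, j) = (\<Delta> * T) $$ (i, j)" by (rule arg_cong[OF eq])
    have "T $$ (i, j) * \<chi> d j = \<chi> d i * T $$ (i, j)" by (rule trans[OF trans[OF e1[symmetric] e3] e2])
    from this mult.commute have e4: "T $$ (i, j) * \<chi> d j = T $$ (i, j) * \<chi> d i" by (rule trans)
    show ?thesis
    proof (rule ccontr)
      assume nz: "T $$ (i, j) \<noteq> 0"
      from d(2) mult_left_cancel[OF nz, THEN iffD1, OF e4, symmetric] show False by (rule notE)
    qed
  qed
  have T_sym: "T $$ (j, i) = cnj (T $$ (i, j))" if "i < m" "j < m" for i j
    using that unfolding T_def by (simp add: adj_mult_entry[OF B] mult.commute)
  define s where "s = T $$ (0, 0)"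
  have T_diag: "T $$ (k, k) = s" if k: "k < m" for k
  proof -
    have cb: "c ^\<^sub>m k * B \<in> carrier_mat n m" by (rule mult_carrier_mat[OF GM[OF cM] B])
    have ent: "(c ^\<^sub>m k * B) $$ (l, 0) = B $$ (l, k)" if "l < n" for l
      unfolding cB using mult_shift_mat_entry[OF B that m0, of k "\<lambda>_. 1"] k by simp
    have "T $$ (k, k) = (\<Sum>l<n. cnj ((c ^\<^sub>m k * B) $$ (l, 0)) * (c ^\<^sub>m k * B) $$ (l, 0))"
      unfolding T_def adj_mult_entry[OF B k k] by (intro sum.cong) (auto simp: ent)
    also have "\<dots> = (adj (c ^\<^sub>m k * B) * (c ^\<^sub>m k * B)) $$ (0, 0)"
      using adj_mult_entry[OF cb m0 m0] by simp
    also have "adj (c ^\<^sub>m k * B) * (c ^\<^sub>m k * B) = adj B * ((adj (c ^\<^sub>m k) * c ^\<^sub>m k) * B)"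
      using B aB cb GM[OF cM[of k]] by (simp add: adj_mult[of _ n n _ m] assoc_mult_mat[of _ m n _ n _ m] assoc_mult_mat[of _ n n _ n _ m] del: adj_inverse)
    also have "\<dots> = T" using B cM by (simp add: T_def)
    finally show ?thesis by (simp add: s_def)
  qed
  have Ts: "T = s \<cdot>\<^sub>m 1\<^sub>m m"
  proof (rule mat_eqI[where n = m])
    fix i j assume ij: "i < m" "j < m"
    consider "i < j" | "j < i" | "i = j" by linarith
    then show "T $$ (i, j) = (s \<cdot>\<^sub>m 1\<^sub>m m) $$ (i, j)"
      using ij T_off[of i j] T_off[of j i] T_sym[of j i] T_diag[of i] by cases auto
  qed (use T in auto)
  have B0: "B \<noteq> 0\<^sub>m n m"
  proof
    assume z: "B = 0\<^sub>m n m"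
    have "u = b 0" using u c by (simp add: b_def)
    also have "\<dots> = col B 0" using colB m0 by simp
    also have "\<dots> = 0\<^sub>v n" unfolding z using m0 by (intro eq_vecI) auto
    finally show False using u by simp
  qed
  have s0: "s \<noteq> 0"
  proof
    assume "s = 0"
    then have "complex_of_real (nrm2 B) = 0"
      using nrm2_eq_tr[OF B] T_def[symmetric] Ts tr_smult[OF one_carrier_mat, of 0 m] by simp
    then show False using nrm2_zero[OF B] B0 by simp
  qed
  have R: "B * adj B \<in> M n" using B by simp
  have uc: "adj g * g = 1\<^sub>m n" if "g \<in> G" for g using that by simp
  have "\<exists>t. B * adj B = t \<cdot>\<^sub>m 1\<^sub>m n"
  proof (rule commutes_G[OF R])
    fix l assume l: "l \<in> L"
    obtain k where k: "l = c ^\<^sub>m k" using c(2)[OF l] by blast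
    have lG: "l \<in> G" using l by simp
    show "B * adj B * l = l * (B * adj B)"
      using cB[of k] unfolding k[symmetric]
      by (intro commute_if_intertwines[OF GM[OF lG] GM[OF Gadj[OF lG]] uc[OF lG] refl B _ adj_shift_unitary[OF m0]]) auto
  next
    fix d assume d: "d \<in> D"
    have dG: "d \<in> G" using d by simp
    have "\<chi> d j * cnj (\<chi> d j) = 1" for j using \<chi>[OF d, of j] by auto
    then show "B * adj B * d = d * (B * adj B)"
      using dB[OF d]
      by (intro commute_if_intertwines[OF GM[OF dG] GM[OF Gadj[OF dG]] uc[OF dG] refl B _ adj_shift_unitary[OF m0]]) auto
  qed
  then obtain t where t: "B * adj B = t \<cdot>\<^sub>m 1\<^sub>m n" by blast
  have ts: "t = s"
  proof -
    have "t \<cdot>\<^sub>m B = (B * adj B) * B"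
      unfolding t using B by (simp add: mult_smult_assoc_mat[of _ n n _ m])
    also have "\<dots> = B * T" unfolding T_def using B aB by (intro assoc_mult_mat[of _ n m _ n _ m]) auto
    also have "\<dots> = s \<cdot>\<^sub>m B" unfolding Ts using B by (simp add: mult_smult_distrib[of _ n m _ m])
    finally have e: "t \<cdot>\<^sub>m B = s \<cdot>\<^sub>m B" .
    have "\<exists>i<n. \<exists>j<m. B $$ (i, j) \<noteq> 0"
    proof (rule ccontr)
      assume "\<not> ?thesis"
      then have "B = 0\<^sub>m n m" using B by (intro eq_matI) auto
      with B0 show False by (rule notE)
    qed
    then obtain i j where ij: "i < n" "j < m" "B $$ (i, j) \<noteq> 0" by blast
    have "(t \<cdot>\<^sub>m B) $$ (i, j) = (s \<cdot>\<^sub>m B) $$ (i, j)" by (rule e[THEN arg_cong, of "\<lambda>X. X $$ (i, j)"])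
    then have "t * B $$ (i, j) = s * B $$ (i, j)" using ij B by simp
    then show ?thesis using ij(3) by simp
  qed
  have mn: "m = n"
  proof -
    have "tr (B * adj B) = tr T" unfolding T_def using B aB by (rule tr_mult_comm)
    then have "s * of_nat n = s * of_nat m"
      unfolding t ts Ts by (simp add: tr_smult[OF one_carrier_mat])
    then show ?thesis using s0 by simp
  qed
  define Y where "Y = (1 / s) \<cdot>\<^sub>m adj B"
  have BM: "B \<in> M n" "adj B \<in> M n" "Y \<in> M n" using B by (simp_all add: mn Y_def)
  have YB: "Y * B = 1\<^sub>m n"
    using BM s0 Ts unfolding Y_def T_def mn by (simp add: mat_smult[where n = n])
  have BY: "B * Y = 1\<^sub>m n"
    using BM s0 t unfolding Y_def ts by (simp add: mat_smult[where n = n])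
  have "m dvd r" using r(3)[OF c(1)] by (simp add: cm)
  then have "odd n" using r(1) mn dvd_trans by blast
  then show ?thesis
    using that[OF BM(1,3) YB BY _ c(1), of \<chi>] c(2) cB dB \<chi> unfolding mn cycle_mat_power_shift_mat by blast
qed

text \<open>
  In the monomial basis only the condition defining \<open>J_set\<close> remains to be checked. The average
  is an orbit product, hence a scalar \<open>\<epsilon>\<close> with \<open>\<epsilon>\<^sup>2 = 1\<close>. Its determinant is
  \<open>\<epsilon>\<^sup>n = \<epsilon>\<close>, and as a product of \<open>r\<close> conjugates it is also the \<open>r\<close>-th power of the
  determinant of \<open>d\<close>, where the order \<open>r\<close> is odd because it divides \<open>n\<close>.
\<close>

theorem cyclic_J_structure:
  "odd n \<and> (\<exists>X Y \<D>. X \<in> M n \<and> Y \<in> M n \<and> X * Y = 1\<^sub>m n \<and> Y * X = 1\<^sub>m n \<and>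
     subgroup \<D> (GL n) \<and> \<D> \<subseteq> J_set n \<and> cycle_stable n \<D> \<and> nonscalar n \<D> \<and>
     (\<lambda>A. Y * A * X) ` G = {C * D | C D. C \<in> cycle_group n \<and> D \<in> \<D>})"
proof -
  interpret FA: free_abelian_action gp D L Z by (rule free_action)
  obtain B Y c \<chi> where BY: "B \<in> M n" "Y \<in> M n" "Y * B = 1\<^sub>m n" "B * Y = 1\<^sub>m n" and odd: "odd n"
    and c: "c \<in> L" "\<And>x. x \<in> L \<Longrightarrow> \<exists>k. x = c ^\<^sub>m k" "\<And>k. c ^\<^sub>m k * B = B * cycle_mat n ^\<^sub>m k"
    and dB: "\<And>d. d \<in> D \<Longrightarrow> d * B = B * shift_mat n 0 (\<chi> d)"
    and \<chi>: "\<And>d i. d \<in> D \<Longrightarrow> \<chi> d i = 1 \<or> \<chi> d i = (-1::complex)"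
    by (rule monomial_basis) blast
  have n0: "n > 0" using n1 by simp
  interpret gl: group "GL n" by (rule group_GL)
  have YB_cancel: "Y * (B * Z) = Z" "B * (Y * Z) = Z" if "Z \<in> M n" for Z
    using that BY by (simp_all add: mat_assoc[where n = n, symmetric] del: assoc_mult_mat)
  define f where "f A = Y * A * B" for A
  have fM [simp]: "f A \<in> M n" if "A \<in> M n" for A using that BY by (simp add: f_def)
  have f_mult: "f (a * b) = f a * f b" if "a \<in> M n" "b \<in> M n" for a b
    using that BY(1,2) by (simp add: f_def mat_assoc[where n = n] YB_cancel)
  have f_one: "f (1\<^sub>m n) = 1\<^sub>m n" using BY by (simp add: f_def)
  have f_scalar: "f (e \<cdot>\<^sub>m 1\<^sub>m n) = e \<cdot>\<^sub>m 1\<^sub>m n" for e using BY by (simp add: f_def mat_smult[where n = n])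
  have f_inj: "a = b" if "f a = f b" "a \<in> M n" "b \<in> M n" for a b
  proof -
    have "B * f a * Y = B * f b * Y" by (simp only: that(1))
    then show ?thesis using that(2,3) BY by (simp add: f_def mat_assoc[where n = n] YB_cancel)
  qed
  have f_c: "f (c ^\<^sub>m k) = cycle_mat n ^\<^sub>m k" for k
  proof -
    have "f (c ^\<^sub>m k) = Y * (c ^\<^sub>m k * B)" using BY c(1) by (simp add: f_def mat_assoc[where n = n])
    then show ?thesis unfolding c(3) by (simp add: YB_cancel)
  qed
  have f_d: "f d = shift_mat n 0 (\<chi> d)" if d: "d \<in> D" for d
  proof -
    have "f d = Y * (d * B)" using BY d by (simp add: f_def mat_assoc[where n = n])
    then show ?thesis unfolding dB[OF d] by (simp add: YB_cancel)
  qed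
  have f_inv: "inv\<^bsub>GL n\<^esub> (f g) = f (adj g)" "f g \<in> carrier (GL n)" if g: "g \<in> G" for g
  proof -
    have e: "f (adj g) * f g = 1\<^sub>m n" "f g * f (adj g) = 1\<^sub>m n"
      using g f_mult[of g "adj g"] f_mult[of "adj g" g] f_one by simp_all
    show "inv\<^bsub>GL n\<^esub> (f g) = f (adj g)" "f g \<in> carrier (GL n)"
      using inv_GL_eq[OF _ _ e] g by simp_all
  qed
  have conj_f: "conj_by n (f g) (f d) = f (adj g * d * g)" if "g \<in> G" "d \<in> G" for g d
    using that f_inv(1)[OF that(1)] by (simp add: conj_by_def f_mult)
  have f_pow: "f g ^\<^sub>m k = f (g ^\<^sub>m k)" if g: "g \<in> G" for g k
  proof (induction k)
    case 0
    have "dim_row (f g) = n" using fM[OF GM[OF g]] by (rule carrier_matD)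
    then show ?case using g by (simp add: f_one)
  next
    case (Suc k)
    then show ?case using g by (simp add: f_mult)
  qed
  define \<D> where "\<D> = f ` D"
  have J: "f d \<in> J_set n" if d: "d \<in> D" for d
  proof -
    have sd: "f d \<in> sign_diag n"
      unfolding f_d[OF d] using \<chi>[OF d] by (auto simp: sign_diag_def diagonal_mat_def shift_mat_def)
    have ddet: "det (f d) * det (f d) = 1"
    proof -
      have "f d * f d = f (d * d)" using f_mult[of d d] d by simp
      also have "\<dots> = 1\<^sub>m n" unfolding D_sq[OF d] by (rule f_one)
      finally have "det (f d * f d) = 1" by simp
      then show ?thesis using det_mult[of "f d" n "f d"] d by simp
    qed
    have "avg n H (f d) = det (f d) \<cdot>\<^sub>m 1\<^sub>m n" if H: "H \<in> cycle_group n - {1\<^sub>m n}" for H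
    proof -
      obtain k where k: "H = cycle_mat n ^\<^sub>m k" using H cycle_group_eq[OF n0] by auto
      define g where "g = c ^\<^sub>m k"
      have g: "g \<in> L" "H = f g" using c(1) by (simp_all add: g_def k f_c)
      have gG: "g \<in> G" using g by simp
      have g1: "g \<noteq> 1\<^sub>m n" using H g(2) f_one by auto
      define r where "r = group.ord (GL n) H"
      have r: "r dvd n" unfolding r_def k by (rule ord_cycle_power(1)[OF n0])
      then have r_odd: "odd r" using odd dvd_trans by blast
      have gr: "g ^\<^sub>m r = 1\<^sub>m n"
      proof -
        have "f (g ^\<^sub>m r) = H [^]\<^bsub>GL n\<^esub> r"
        proof -
          have "H [^]\<^bsub>GL n\<^esub> j = H ^\<^sub>m j" for j :: nat
            by (induction j) (auto simp: k carrier_matD[OF cycle_mat_M])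
          then show ?thesis using f_pow[OF gG, of r] g(2) by simp
        qed
        also have "\<dots> = f (1\<^sub>m n)"
          unfolding r_def f_one using gl.pow_ord_eq_1[of H] f_inv(2)[OF gG] g(2) by simp
        finally have "f (g ^\<^sub>m r) = f (1\<^sub>m n)" .
        then show ?thesis by (rule f_inj) (use gG in simp_all)
      qed
      define h where "h j = adj (g ^\<^sub>m j) * d * g ^\<^sub>m j" for j
      have hD: "h j \<in> D" for j using d gG by (simp add: h_def)
      have fold: "foldr (*) (map (\<lambda>j. f (h j)) xs) (1\<^sub>m n) = f (FA.prodD h (set xs)) \<and>
          det (f (FA.prodD h (set xs))) = det (f d) ^ length xs" if "distinct xs" for xs
        using that
      proof (induction xs)
        case Nil
        then show ?case using FA.K.finprod_empty[of h] by (simp add: f_one)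
      next
        case (Cons x xs)
        have pD: "FA.prodD h (set xs) \<in> D" using hD by (intro FA.prodD_closed)
        have ins: "FA.prodD h (set (x # xs)) = h x * FA.prodD h (set xs)"
          using Cons.prems hD FA.prodD_insert[of "set xs" x h] by simp
        have M: "h x \<in> M n" "FA.prodD h (set xs) \<in> M n" using hD[of x] pD by auto
        have fm: "f (FA.prodD h (set (x # xs))) = f (h x) * f (FA.prodD h (set xs))"
          unfolding ins by (rule f_mult[OF M])
        have "det (f (h x)) = det (f d)"
        proof -
          have gx: "g ^\<^sub>m x \<in> G" using gG by simp
          have "f (g ^\<^sub>m x) * f (h x) = f d * f (g ^\<^sub>m x)"
          proof -
            have "g ^\<^sub>m x * h x = d * g ^\<^sub>m x" unfolding h_def using gx d by (simp add: mat_assoc[where n = n])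
            then show ?thesis using gx d M by (simp add: f_mult[symmetric])
          qed
          from arg_cong[OF this, of det]
          have E: "det (f (g ^\<^sub>m x)) * det (f (h x)) = det (f d) * det (f (g ^\<^sub>m x))"
            unfolding det_mult[OF fM[OF GM[OF gx]] fM[OF M(1)]] det_mult[OF fM[OF GM[OF DG[OF d]]] fM[OF GM[OF gx]]] .
          have nz: "det (f (g ^\<^sub>m x)) \<noteq> 0" using f_inv(2)[OF gx] by simp
          from mult.commute E have "det (f (h x)) * det (f (g ^\<^sub>m x)) = det (f d) * det (f (g ^\<^sub>m x))" by (rule trans)
          then show ?thesis by (rule mult_right_cancel[OF nz, THEN iffD1])
        qed
        then show ?case
          unfolding fm using Cons M det_mult[of "f (h x)" n "f (FA.prodD h (set xs))"] by simp
      qed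
      define z where "z = FA.prodD h {..<r}"
      have av: "avg n H (f d) = f z" and detz: "det (f z) = det (f d) ^ r"
      proof -
        have "avg n H (f d) = foldr (*) (map (\<lambda>j. f (h j)) [0..<r]) (1\<^sub>m n)"
        proof -
          have "conj_by n (H ^\<^sub>m j) (f d) = f (h j)" for j
            unfolding g(2) f_pow[OF gG] h_def using gG d by (intro conj_f) auto
          then show ?thesis unfolding avg_def r_def[symmetric] by simp
        qed
        then show "avg n H (f d) = f z" "det (f z) = det (f d) ^ r"
          using fold[of "[0..<r]"] by (simp_all add: z_def lessThan_atLeast0)
      qed
      have "z \<in> Z"
      proof -
        have hz: "h = (\<lambda>j. gp.cj d (g [^]\<^bsub>gp\<^esub> j))"
          using gG d by (intro ext) (simp add: h_def gp_pow gp_cj)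
        have "FA.orbit_prod r g d \<in> Z"
          using g(1) g1 gr d gp_pow[OF gG, of r] by (intro FA.orbit_prod_Z) auto
        then show ?thesis by (simp add: z_def hz FA.orbit_prod_def)
      qed
      then obtain e where e: "z = e \<cdot>\<^sub>m 1\<^sub>m n" "z \<in> D" unfolding Z_def by blast
      have e1: "e = 1 \<or> e = -1" using scalar_sign[of e] DG[OF e(2)] e(1) by simp
      have "det (f z) = e ^ n" unfolding e(1) f_scalar by (simp add: det_smult)
      also have "\<dots> = e" using e1 odd by auto
      finally have "e = det (f d) ^ r" using detz by simp
      also have "\<dots> = det (f d)"
      proof -
        have "det (f d) = 1 \<or> det (f d) = -1" using ddet by (simp add: square_eq_1_iff)
        then show ?thesis using r_odd by auto
      qed
      finally show ?thesis unfolding av by (simp add: e(1) f_scalar)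
    qed
    then show ?thesis using sd by (simp add: J_set_def)
  qed
  have "subgroup \<D> (GL n)"
  proof (rule gl.subgroupI)
    show "\<D> \<subseteq> carrier (GL n)" unfolding \<D>_def using f_inv(2) DG by blast
    show "\<D> \<noteq> {}" unfolding \<D>_def using D_one by blast
    fix a assume "a \<in> \<D>"
    then obtain d where d: "d \<in> D" "a = f d" by (auto simp: \<D>_def)
    show "inv\<^bsub>GL n\<^esub> a \<in> \<D>" using d f_inv(1)[OF DG[OF d(1)]] by (simp add: \<D>_def)
    fix b assume "b \<in> \<D>"
    then obtain d' where d': "d' \<in> D" "b = f d'" by (auto simp: \<D>_def)
    have "f d * f d' = f (d * d')" using d d' by (simp add: f_mult)
    then show "a \<otimes>\<^bsub>GL n\<^esub> b \<in> \<D>" using d d' by (simp add: \<D>_def)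
  qed
  moreover have "\<D> \<subseteq> J_set n" unfolding \<D>_def using J by blast
  moreover have "cycle_stable n \<D>"
    unfolding cycle_stable_def
  proof (intro ballI)
    fix J H assume J: "J \<in> \<D>" and H: "H \<in> cycle_group n"
    obtain d where d: "d \<in> D" "J = f d" using J by (auto simp: \<D>_def)
    obtain k where k: "H = cycle_mat n ^\<^sub>m k" using H cycle_group_eq[OF n0] by auto
    have cG: "c ^\<^sub>m k \<in> G" using c(1) by simp
    show "conj_by n H J \<in> \<D>"
      unfolding k f_c[symmetric] d(2) conj_f[OF cG DG[OF d(1)]] \<D>_def using d cG by (intro imageI D_conj)
  qed
  moreover have "nonscalar n \<D>"
  proof -
    obtain d where d: "d \<in> D" "\<And>e. d \<noteq> e \<cdot>\<^sub>m 1\<^sub>m n" using nonscalar_D by blast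
    have "f d \<noteq> e \<cdot>\<^sub>m 1\<^sub>m n" for e
    proof
      assume "f d = e \<cdot>\<^sub>m 1\<^sub>m n"
      then have "f d = f (e \<cdot>\<^sub>m 1\<^sub>m n)" unfolding f_scalar .
      then have "d = e \<cdot>\<^sub>m 1\<^sub>m n" by (rule f_inj[OF _ GM[OF DG[OF d(1)]]]) simp
      with d(2) show False by (rule notE)
    qed
    then show ?thesis unfolding nonscalar_def \<D>_def using d(1) by blast
  qed
  moreover have "(\<lambda>A. Y * A * B) ` G = {C * D | C D. C \<in> cycle_group n \<and> D \<in> \<D>}"
  proof (rule equalityI; rule subsetI)
    fix A assume "A \<in> (\<lambda>A. Y * A * B) ` G"
    then obtain g where g: "g \<in> G" "A = Y * g * B" by (rule imageE) (rule that)
    obtain l d where ld: "l \<in> L" "d \<in> D" "g = l * d" using split[OF g(1)] by blast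
    obtain k where k: "l = c ^\<^sub>m k" using c(2)[OF ld(1)] by blast
    have "A = f (l * d)" unfolding g(2) ld(3) f_def ..
    also have "\<dots> = f l * f d" using ld(1,2) by (intro f_mult) simp_all
    also have "f l = cycle_mat n ^\<^sub>m k" unfolding k by (rule f_c)
    finally have "A = cycle_mat n ^\<^sub>m k * f d" .
    moreover have "cycle_mat n ^\<^sub>m k \<in> cycle_group n" unfolding cycle_group_eq[OF n0] by (rule rangeI)
    moreover have "f d \<in> \<D>" unfolding \<D>_def using ld(2) by (rule imageI)
    ultimately show "A \<in> {C * D | C D. C \<in> cycle_group n \<and> D \<in> \<D>}" by blast
  next
    fix A assume "A \<in> {C * D | C D. C \<in> cycle_group n \<and> D \<in> \<D>}"
    then obtain C J where CJ: "A = C * J" "C \<in> cycle_group n" "J \<in> \<D>" by blast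
    obtain k where k: "C = cycle_mat n ^\<^sub>m k" using CJ(2) unfolding cycle_group_eq[OF n0] by blast
    obtain d where d: "d \<in> D" "J = f d" using CJ(3) unfolding \<D>_def by blast
    have G: "c ^\<^sub>m k \<in> G" "d \<in> G" using c(1) d(1) by simp_all
    have "A = f (c ^\<^sub>m k) * f d" unfolding CJ(1) k d(2) f_c ..
    also have "\<dots> = f (c ^\<^sub>m k * d)" using f_mult[OF GM[OF G(1)] GM[OF G(2)]] by (rule sym)
    finally have "A = Y * (c ^\<^sub>m k * d) * B" unfolding f_def .
    then show "A \<in> (\<lambda>A. Y * A * B) ` G" using Gmult[OF G] by (rule image_eqI)
  qed
  ultimately show ?thesis using odd BY by blast
qed

end

section \<open>The equivalence\<close>

lemma commutator_conjugate_spectrum: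
  assumes XY: "X \<in> M n" "Y \<in> M n" "X * Y = 1\<^sub>m n" "Y * X = 1\<^sub>m n" and AB: "A \<in> M n" "B \<in> M n"
  shows "spectrum ((Y * A * X) * (Y * B * X) - (Y * B * X) * (Y * A * X)) = spectrum (A * B - B * A)"
proof -
  have cancel: "X * (Y * Z) = Z" if "Z \<in> M n" for Z
    using that XY by (simp add: mat_assoc[where n = n, symmetric] del: assoc_mult_mat)
  have "(Y * A * X) * (Y * B * X) - (Y * B * X) * (Y * A * X) = Y * (A * B - B * A) * X"
    using XY(1,2) AB by (simp add: mat_assoc[where n = n] cancel mat_distrib[where n = n] mult_minus_distrib_mat[of _ n n _ n] minus_mult_distrib_mat[of _ n n _ _ n])
  then show ?thesis using spectrum_conjugate[OF XY, of "A * B - B * A"] AB by simp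
qed

lemma conjugate_subgroup:
  assumes G: "subgroup G (GL n)" and XY: "X \<in> M n" "Y \<in> M n" "X * Y = 1\<^sub>m n" "Y * X = 1\<^sub>m n"
  shows "subgroup ((\<lambda>A. Y * A * X) ` G) (GL n)"
proof -
  interpret gl: group "GL n" by (rule group_GL)
  have cancel: "X * (Y * Z) = Z" if "Z \<in> M n" for Z
    using that XY by (simp add: mat_assoc[where n = n, symmetric] del: assoc_mult_mat)
  have mult: "(Y * A * X) * (Y * B * X) = Y * (A * B) * X" if "A \<in> M n" "B \<in> M n" for A B
    using XY(1,2) that by (simp add: mat_assoc[where n = n] cancel)
  have GM: "A \<in> M n" if "A \<in> G" for A using subgroup.mem_carrier[OF G that] by simp
  have inv: "\<exists>B\<in>G. inv\<^bsub>GL n\<^esub> (Y * A * X) = Y * B * X \<and> Y * A * X \<in> carrier (GL n)" if A: "A \<in> G" for A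
  proof -
    obtain B where B: "B \<in> G" "B \<in> M n" "A \<in> M n" "A * B = 1\<^sub>m n" "B * A = 1\<^sub>m n"
      by (rule GL_inverse[OF G A])
    have e: "(Y * B * X) * (Y * A * X) = 1\<^sub>m n" "(Y * A * X) * (Y * B * X) = 1\<^sub>m n"
      unfolding mult[OF B(2,3)] mult[OF B(3,2)] B(4,5) using XY by simp_all
    have M: "Y * B * X \<in> M n" "Y * A * X \<in> M n" using XY(1,2) B(2,3) by simp_all
    show ?thesis by (intro bexI[OF _ B(1)] conjI) (rule inv_GL_eq[OF M e])+
  qed
  show ?thesis
  proof (rule gl.subgroupI)
    show "(\<lambda>A. Y * A * X) ` G \<subseteq> carrier (GL n)"
    proof (rule image_subsetI)
      fix A assume "A \<in> G"
      from inv[OF this] show "Y * A * X \<in> carrier (GL n)" by (elim bexE conjE)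
    qed
    show "(\<lambda>A. Y * A * X) ` G \<noteq> {}"
      unfolding image_is_empty using subgroup.one_closed[OF G] by (rule ex_in_conv[THEN iffD1, OF exI])
    fix a assume a: "a \<in> (\<lambda>A. Y * A * X) ` G"
    obtain A where A: "A \<in> G" "a = Y * A * X" using a by (elim imageE) (rule that)
    obtain B where B: "B \<in> G" "inv\<^bsub>GL n\<^esub> (Y * A * X) = Y * B * X"
      using inv[OF A(1)] by (elim bexE conjE) (rule that)
    show "inv\<^bsub>GL n\<^esub> a \<in> (\<lambda>A. Y * A * X) ` G"
      unfolding A(2) B(2) by (rule image_eqI[OF refl B(1)])
    fix b assume b: "b \<in> (\<lambda>A. Y * A * X) ` G"
    obtain B where B: "B \<in> G" "b = Y * B * X" using b by (elim imageE) (rule that)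
    have AB: "A * B \<in> G" using subgroup.m_closed[OF G A(1) B(1)] by simp
    have "a * b = Y * (A * B) * X" unfolding A(2) B(2) by (rule mult[OF GM[OF A(1)] GM[OF B(1)]])
    then have "a * b \<in> (\<lambda>A. Y * A * X) ` G" using AB by (rule image_eqI)
    then show "a \<otimes>\<^bsub>GL n\<^esub> b \<in> (\<lambda>A. Y * A * X) ` G" unfolding GL_simps(2) .
  qed
qed

lemma unitary_real_commutators_structure:
  assumes "real_commutator_group n G"
  shows "odd n \<and> (\<exists>X Y \<D>. X \<in> M n \<and> Y \<in> M n \<and> X * Y = 1\<^sub>m n \<and> Y * X = 1\<^sub>m n \<and>
     subgroup \<D> (GL n) \<and> \<D> \<subseteq> J_set n \<and> cycle_stable n \<D> \<and> nonscalar n \<D> \<and>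
     (\<lambda>A. Y * A * X) ` G = {C * D | C D. C \<in> cycle_group n \<and> D \<in> \<D>})"
proof -
  interpret real_commutator_group n G by (rule assms)
  obtain L where L: "subgroup L gp" "L \<inter> D = {1\<^sub>m n}" "\<And>g. g \<in> G \<Longrightarrow> \<exists>l\<in>L. \<exists>d\<in>D. g = l * d"
    by (rule complement) blast
  interpret split_real_group n G L
    by (rule split_real_group.intro[OF assms split_real_group_axioms.intro]) (rule L(1) L(2) | erule L(3))+
  show ?thesis by (rule cyclic_J_structure)
qed

theorem theorem4p1:
  fixes n :: nat and \<G> :: "complex mat set"
  assumes "n > 1"
    and "subgroup \<G> (GL n)"
    and "compactin (mat_topology n) \<G>"
    and "irreducible_mats n \<G>"
  shows "(\<forall>A\<in>\<G>. \<forall>B\<in>\<G>. spectrum (A * B - B * A) \<subseteq> \<real>) \<longleftrightarrow>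
    odd n \<and>
    (\<exists>X \<in> carrier (GL n). \<exists>\<D>.
       subgroup \<D> (GL n) \<and> \<D> \<subseteq> J_set n \<and> cycle_stable n \<D> \<and> nonscalar n \<D> \<and>
       (\<lambda>A. inv\<^bsub>GL n\<^esub> X * A * X) ` \<G> = {C * D | C D. C \<in> cycle_group n \<and> D \<in> \<D>})"
proof -
  have GM: "A \<in> M n" if "A \<in> \<G>" for A using subgroup.mem_carrier[OF assms(2) that] by simp
  show ?thesis
  proof
    assume real: "\<forall>A\<in>\<G>. \<forall>B\<in>\<G>. spectrum (A * B - B * A) \<subseteq> \<real>"
    obtain b where b: "\<And>g. g \<in> \<G> \<Longrightarrow> nrm2 g \<le> b" by (rule compact_mats_bounded[OF assms(3)]) blast
    obtain P Q where PQ: "P \<in> M n" "Q \<in> M n" "P * Q = 1\<^sub>m n" "Q * P = 1\<^sub>m n"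
      and uni: "\<And>g. g \<in> \<G> \<Longrightarrow> unitary_mat n (P * g * Q)"
      by (rule bounded_group_unitarizable[OF assms(2) b]) blast+
    define H where "H = (\<lambda>A. P * A * Q) ` \<G>"
    have "subgroup H (GL n)" unfolding H_def by (rule conjugate_subgroup[OF assms(2) PQ(2,1,4,3)])
    moreover have "unitary_mat n g" if "g \<in> H" for g using that uni by (auto simp: H_def)
    ultimately have "unitary_group n H" by (rule unitary_group.intro)
    moreover have "irreducible_mats n H"
      unfolding H_def by (rule irreducible_conjugate[OF assms(4) _ PQ(2,1,4,3)]) (rule subsetI, rule GM)
    ultimately have "irreducible_unitary_group n H"
      using assms(1) by (intro irreducible_unitary_group.intro irreducible_unitary_group_axioms.intro)
    moreover have "spectrum (A * B - B * A) \<subseteq> \<real>" if AB: "A \<in> H" "B \<in> H" for A B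
    proof -
      obtain A' B' where A': "A' \<in> \<G>" "A = P * A' * Q" and B': "B' \<in> \<G>" "B = P * B' * Q"
        using AB by (auto simp: H_def)
      show ?thesis
        unfolding A'(2) B'(2) commutator_conjugate_spectrum[OF PQ(2,1,4,3) GM[OF A'(1)] GM[OF B'(1)]]
        using real A'(1) B'(1) by blast
    qed
    ultimately have "real_commutator_group n H"
      by (intro real_commutator_group.intro real_commutator_group_axioms.intro)
    from unitary_real_commutators_structure[OF this]
    obtain X Y \<D> where n: "odd n" and XY: "X \<in> M n" "Y \<in> M n" "X * Y = 1\<^sub>m n" "Y * X = 1\<^sub>m n"
      and \<D>: "subgroup \<D> (GL n)" "\<D> \<subseteq> J_set n" "cycle_stable n \<D>" "nonscalar n \<D>"
      and im: "(\<lambda>A. Y * A * X) ` H = {C * D | C D. C \<in> cycle_group n \<and> D \<in> \<D>}"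
      by blast
    have c: "(Y * P) * (Q * X) = 1\<^sub>m n" "(Q * X) * (Y * P) = 1\<^sub>m n"
    proof -
      have "(Y * P) * (Q * X) = Y * ((P * Q) * X)" using PQ(1,2) XY(1,2) by (simp add: mat_assoc[where n = n])
      then show "(Y * P) * (Q * X) = 1\<^sub>m n" using PQ XY by simp
      have "(Q * X) * (Y * P) = Q * ((X * Y) * P)" using PQ(1,2) XY(1,2) by (simp add: mat_assoc[where n = n])
      then show "(Q * X) * (Y * P) = 1\<^sub>m n" using PQ XY by simp
    qed
    have inv: "inv\<^bsub>GL n\<^esub> (Q * X) = Y * P" "Q * X \<in> carrier (GL n)"
      using inv_GL_eq[OF _ _ c] PQ XY by auto
    have "(\<lambda>A. inv\<^bsub>GL n\<^esub> (Q * X) * A * (Q * X)) ` \<G> = (\<lambda>A. Y * A * X) ` H"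
      unfolding H_def image_image inv(1)
    proof (rule image_cong[OF refl])
      fix A assume "A \<in> \<G>"
      then show "Y * P * A * (Q * X) = Y * (P * A * Q) * X"
        using GM[of A] PQ(1,2) XY(1,2) by (simp add: mat_assoc[where n = n])
    qed
    from this im have img: "(\<lambda>A. inv\<^bsub>GL n\<^esub> (Q * X) * A * (Q * X)) ` \<G>
      = {C * D | C D. C \<in> cycle_group n \<and> D \<in> \<D>}" by (rule trans)
    show "odd n \<and> (\<exists>X \<in> carrier (GL n). \<exists>\<D>.
       subgroup \<D> (GL n) \<and> \<D> \<subseteq> J_set n \<and> cycle_stable n \<D> \<and> nonscalar n \<D> \<and>
       (\<lambda>A. inv\<^bsub>GL n\<^esub> X * A * X) ` \<G> = {C * D | C D. C \<in> cycle_group n \<and> D \<in> \<D>})"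
      by (intro conjI bexI[of _ "Q * X"] exI[of _ \<D>]) (rule n \<D> img inv(2))+
  next
    assume "odd n \<and> (\<exists>X \<in> carrier (GL n). \<exists>\<D>.
       subgroup \<D> (GL n) \<and> \<D> \<subseteq> J_set n \<and> cycle_stable n \<D> \<and> nonscalar n \<D> \<and>
       (\<lambda>A. inv\<^bsub>GL n\<^esub> X * A * X) ` \<G> = {C * D | C D. C \<in> cycle_group n \<and> D \<in> \<D>})"
    then obtain X \<D> where n: "odd n" and X: "X \<in> carrier (GL n)" and \<D>: "\<D> \<subseteq> J_set n"
      and im: "(\<lambda>A. inv\<^bsub>GL n\<^esub> X * A * X) ` \<G> = {C * D | C D. C \<in> cycle_group n \<and> D \<in> \<D>}"
      by blast
    have XM: "X \<in> M n" "det X \<noteq> 0" using X by auto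
    obtain Y where Y: "Y \<in> M n" "X * Y = 1\<^sub>m n" "Y * X = 1\<^sub>m n"
      by (rule invertible_mat_inverse[OF XM])
    have inv: "inv\<^bsub>GL n\<^esub> X = Y" by (rule inv_GL_eq(1)[OF Y(1) XM(1) Y(3,2)])
    have n0: "n > 0" using assms(1) by simp
    have form: "\<exists>k D. D \<in> J_set n \<and> Y * A * X = cycle_mat n ^\<^sub>m k * D" if A: "A \<in> \<G>" for A
    proof -
      have "Y * A * X \<in> {C * D | C D. C \<in> cycle_group n \<and> D \<in> \<D>}"
        unfolding im[symmetric] inv using A by (rule imageI)
      then obtain C D where CD: "Y * A * X = C * D" "C \<in> cycle_group n" "D \<in> \<D>" by blast
      obtain k where k: "C = cycle_mat n ^\<^sub>m k" using CD(2) unfolding cycle_group_eq[OF n0] by blast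
      have "D \<in> J_set n" using \<D> CD(3) by (rule subsetD)
      then show ?thesis using CD(1) unfolding k by blast
    qed
    show "\<forall>A\<in>\<G>. \<forall>B\<in>\<G>. spectrum (A * B - B * A) \<subseteq> \<real>"
    proof (intro ballI)
      fix A B assume AB: "A \<in> \<G>" "B \<in> \<G>"
      obtain k D where k: "D \<in> J_set n" "Y * A * X = cycle_mat n ^\<^sub>m k * D" using form[OF AB(1)] by blast
      obtain l E where l: "E \<in> J_set n" "Y * B * X = cycle_mat n ^\<^sub>m l * E" using form[OF AB(2)] by blast
      show "spectrum (A * B - B * A) \<subseteq> \<real>"
        unfolding commutator_conjugate_spectrum[OF XM(1) Y GM[OF AB(1)] GM[OF AB(2)], symmetric] k(2) l(2)
        by (rule cycle_J_commutator_real[OF n k(1) l(1)])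
    qed
  qed
qed

end
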